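(* Let $\mathcal M$ be a computational model in which $\mathsf H(\cdot,k)$ is a pseudo-random function (PRF) family. Let $n\ge 0$, let $\mathsf k$ be a name, and let $\vec u,t$ be ground terms such that every occurrence of $\mathsf k$ in $\vec u,t$ is as second argument of $\mathsf H$, and such that $\mathsf H(t_1,\mathsf k),\dots,\mathsf H(t_n,\mathsf k)$ are the subterms of $\vec u,t$ of the form $\mathsf H(\cdot,\mathsf k)$. Let $c\equiv\bigvee_{i=1}^n\mathsf{EQ}(t_i;t)$ and let $\mathsf n$ be a name that does not occur in $\vec u,t,c$. Then $$\mathcal M\models\ \vec u,\ \mathsf{if}\ c\ \mathsf{then}\ \mathbf 0\ \mathsf{else}\ \mathsf H(t,\mathsf k)\ \sim\ \vec u,\ \mathsf{if}\ c\ \mathsf{then}\ \mathbf 0\ \mathsf{else}\ \mathsf n .$$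
   Context: Syntax. Terms are built from a countable set of names (sort $\mathsf{Nonce}$), a set $\mathcal F$ of function symbols, and a set $\mathcal G$ of attacker function symbols. Sorts are $\mathsf{bool}$, $\mathsf{Nonce}$, $\mathsf{term}$, with $\mathsf{bool},\mathsf{Nonce}<\mathsf{term}$. $\mathcal F$ contains at least $\mathsf H:\mathsf{term}\times\mathsf{Nonce}\to\mathsf{Nonce}$, $\oplus:\mathsf{Nonce}\times\mathsf{Nonce}\to\mathsf{Nonce}$, pairing $\langle\_,\_\rangle$, projections $\pi_1,\pi_2$, $\mathsf{EQ}(\_;\_):\mathsf{term}\times\mathsf{term}\to\mathsf{bool}$, $\mathsf{if\,then\,else}$, $\mathsf{true},\mathsf{false}$, $\mathbf 0:\ \to\mathsf{Nonce}$. Disjunctions in conditions are shorthand: $\mathsf{if}\ b_1\vee b_2\ \mathsf{then}\ x\ \mathsf{else}\ y$ stands for $\mathsf{if}\ b_1\ \mathsf{then}\ x\ \mathsf{else}\ (\mathsf{if}\ b_2\ \mathsf{then}\ x\ \mathsf{else}\ y)$, the empty disjunction being $\mathsf{false}$. Computational models. For each security parameter $\eta$ and pair of infinite random tapes $\rho_1$ (honest), $\rho_2$ (attacker), a ground term $t$ is interpreted as a bitstring $[\![t]\!]_{\eta,\rho_1,\rho_2}$: names are blocks of $\eta$ bits of $\rho_1$, distinct names using disjoint blocks; $\mathsf{true},\mathsf{false},\mathsf{EQ}$ (equality of bitstrings), $\mathsf{if\,then\,else}$, $\oplus$ (bitwise xor), $\mathbf 0$ ($0^\eta$) have their expected meaning;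 every other $f\in\mathcal F$ is a deterministic polynomial-time function of $1^\eta$ and the argument values, respecting sorts ($\mathsf{Nonce}$ = bitstrings of length $\eta$); each $g\in\mathcal G$ is a polynomial-time machine applied to $1^\eta$, the argument values and $\rho_2$, with no access to $\rho_1$. $\vec u\sim\vec v$ holds iff for every deterministic polynomial-time $\mathcal A$, $|\Pr_{\rho_1,\rho_2}(\mathcal A([\![\vec u]\!],1^\eta,\rho_2)=1)-\Pr_{\rho_1,\rho_2}(\mathcal A([\![\vec v]\!],1^\eta,\rho_2)=1)|$ is negligible in $\eta$. PRF. $\mathsf H(\cdot,k):\{0,1\}^*\to\{0,1\}^\eta$ is a PRF family if for every probabilistic polynomial-time oracle adversary $\mathcal A$, $|\Pr(\mathcal A^{\mathsf H(\cdot,k)}(1^\eta)=1)-\Pr(\mathcal A^{g(\cdot)}(1^\eta)=1)|$ is negligible in $\eta$, where $k$ is uniform in $\{0,1\}^\eta$, $g$ is a uniformly random function from $\{0,1\}^*$ to $\{0,1\}^\eta$, and probabilities are also over the random tape of $\mathcal A$. *)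

theory Defs
  imports "HOL-Probability.Probability" "HOL-Computational_Algebra.Polynomial"
begin

section \<open>Polynomial-time machines\<close>

type_synonym bits = "bool list"
type_synonym tape = "nat \<Rightarrow> bool"

text \<open>
  Machines are while programs over finitely many stacks of bits (numbered by naturals), with
  a read-only infinite tape and an oracle.  Every instruction counts as one step.  A multitape
  Turing machine is simulated step by step (two stacks hold one work tape), and conversely a
  Turing machine simulates a program with polynomial overhead, so that the polynomial-time
  machines are the usual ones.  \<open>Read r\<close> pushes the next bit of the infinite tape,
  \<open>Rewind\<close> returns to its first cell, \<open>Query i j\<close> replaces stack
  \<open>j\<close> by the answer of the oracle to stack \<open>i\<close>, \<open>Case r p q q'\<close>
  branches on the top of stack \<open>r\<close> (absent, \<open>0\<close>, \<open>1\<close>), and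
  \<open>While r p\<close> iterates while stack \<open>r\<close> is nonempty.
\<close>

datatype prog =
    Skip
  | Push nat bool
  | Pop nat
  | Read nat
  | Rewind
  | Query nat nat
  | Seq prog prog
  | Case nat prog prog prog
  | While nat prog

text \<open>Contents of the stacks, and position of the head on the infinite tape.\<close>

type_synonym state = "(nat \<Rightarrow> bits) \<times> nat"

text \<open>\<open>exec orc \<rho> p s m s'\<close>: with oracle \<open>orc\<close> and tape
  \<open>\<rho>\<close>, program \<open>p\<close> leads from \<open>s\<close> to \<open>s'\<close>
  and halts after exactly \<open>m\<close> steps.\<close>

inductive exec :: "(bits \<Rightarrow> bits) \<Rightarrow> tape \<Rightarrow> prog \<Rightarrow> state \<Rightarrow> nat \<Rightarrow> state \<Rightarrow> bool"
  for orc :: "bits \<Rightarrow> bits" and \<rho> :: tape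
where
  Skip: "exec orc \<rho> Skip s 1 s"
| Push: "exec orc \<rho> (Push r b) (R, h) 1 (R(r := b # R r), h)"
| Pop: "exec orc \<rho> (Pop r) (R, h) 1 (R(r := tl (R r)), h)"
| Read: "exec orc \<rho> (Read r) (R, h) 1 (R(r := \<rho> h # R r), Suc h)"
| Rewind: "exec orc \<rho> Rewind (R, h) 1 (R, 0)"
| Query: "exec orc \<rho> (Query i j) (R, h) 1 (R(j := orc (R i)), h)"
| Seq: "exec orc \<rho> p s m s' \<Longrightarrow> exec orc \<rho> q s' m' s'' \<Longrightarrow> exec orc \<rho> (Seq p q) s (m + m') s''"
| Case_Empty: "R r = [] \<Longrightarrow> exec orc \<rho> p (R, h) m s \<Longrightarrow>
    exec orc \<rho> (Case r p q q') (R, h) (Suc m) s"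
| Case_False: "R r = False # w \<Longrightarrow> exec orc \<rho> q (R, h) m s \<Longrightarrow>
    exec orc \<rho> (Case r p q q') (R, h) (Suc m) s"
| Case_True: "R r = True # w \<Longrightarrow> exec orc \<rho> q' (R, h) m s \<Longrightarrow>
    exec orc \<rho> (Case r p q q') (R, h) (Suc m) s"
| While_Stop: "R r = [] \<Longrightarrow> exec orc \<rho> (While r p) (R, h) 1 (R, h)"
| While_Step: "R r \<noteq> [] \<Longrightarrow> exec orc \<rho> p (R, h) m s \<Longrightarrow> exec orc \<rho> (While r p) s m' s' \<Longrightarrow>
    exec orc \<rho> (While r p) (R, h) (Suc (m + m')) s'"

primrec oracle_free :: "prog \<Rightarrow> bool" where
  "oracle_free Skip = True"
| "oracle_free (Push r b) = True"
| "oracle_free (Pop r) = True"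
| "oracle_free (Read r) = True"
| "oracle_free Rewind = True"
| "oracle_free (Query i j) = False"
| "oracle_free (Seq p q) = (oracle_free p \<and> oracle_free q)"
| "oracle_free (Case r p q q') = (oracle_free p \<and> oracle_free q \<and> oracle_free q')"
| "oracle_free (While r p) = oracle_free p"

primrec tape_free :: "prog \<Rightarrow> bool" where
  "tape_free Skip = True"
| "tape_free (Push r b) = True"
| "tape_free (Pop r) = True"
| "tape_free (Read r) = False"
| "tape_free Rewind = False"
| "tape_free (Query i j) = True"
| "tape_free (Seq p q) = (tape_free p \<and> tape_free q)"
| "tape_free (Case r p q q') = (tape_free p \<and> tape_free q \<and> tape_free q')"
| "tape_free (While r p) = tape_free p"

text \<open>Stack \<open>0\<close> initially holds \<open>1\<close> repeated \<open>\<eta>\<close> times and finally the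
  result; the arguments are on the stacks \<open>1, 2, \<dots>\<close>, and all other stacks are empty.\<close>

definition init :: "nat \<Rightarrow> bits list \<Rightarrow> state" where
  "init \<eta> xs =
    ((\<lambda>i. if i = 0 then replicate \<eta> True else if i \<le> length xs then xs ! (i - 1) else []), 0)"

definition runs :: "(bits \<Rightarrow> bits) \<Rightarrow> tape \<Rightarrow> prog \<Rightarrow> nat \<Rightarrow> bits list \<Rightarrow> nat \<Rightarrow> bits \<Rightarrow> bool" where
  "runs orc \<rho> p \<eta> xs m y \<longleftrightarrow> (\<exists>s. exec orc \<rho> p (init \<eta> xs) m s \<and> fst s 0 = y)"

definition accepts :: "(bits \<Rightarrow> bits) \<Rightarrow> tape \<Rightarrow> prog \<Rightarrow> nat \<Rightarrow> bits list \<Rightarrow> bool" where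
  "accepts orc \<rho> p \<eta> xs \<longleftrightarrow> (\<exists>m. runs orc \<rho> p \<eta> xs m [True])"

text \<open>Oracle of an oracle-free program, and tape of a tape-free one; their values are
  irrelevant.\<close>

abbreviation no_oracle :: "bits \<Rightarrow> bits" where
  "no_oracle \<equiv> \<lambda>_. []"

abbreviation no_tape :: tape where
  "no_tape \<equiv> \<lambda>_. False"

definition input_size :: "nat \<Rightarrow> bits list \<Rightarrow> nat" where
  "input_size \<eta> xs = \<eta> + sum_list (map length xs)"

text \<open>Polynomial-time functions of \<open>\<eta>\<close> in unary and of the arguments, on a domain that
  may depend on \<open>\<eta>\<close>; the second version has the infinite tape as additional input.\<close>

definition ptime_fun :: "(nat \<Rightarrow> bits list set) \<Rightarrow> (nat \<Rightarrow> bits list \<Rightarrow> bits) \<Rightarrow> bool" where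
  "ptime_fun D f \<longleftrightarrow> (\<exists>p (q :: nat poly). oracle_free p \<and> tape_free p \<and>
     (\<forall>\<eta>. \<forall>xs \<in> D \<eta>. \<exists>m \<le> poly q (input_size \<eta> xs).
        runs no_oracle no_tape p \<eta> xs m (f \<eta> xs)))"

definition ptime_tape_fun ::
    "(nat \<Rightarrow> bits list set) \<Rightarrow> (nat \<Rightarrow> bits list \<Rightarrow> tape \<Rightarrow> bits) \<Rightarrow> bool" where
  "ptime_tape_fun D f \<longleftrightarrow> (\<exists>p (q :: nat poly). oracle_free p \<and>
     (\<forall>\<eta> \<rho>. \<forall>xs \<in> D \<eta>. \<exists>m \<le> poly q (input_size \<eta> xs).
        runs no_oracle \<rho> p \<eta> xs m (f \<eta> xs \<rho>)))"

text \<open>Attackers against \<open>l\<close> messages.\<close>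

definition ptime_adversary :: "nat \<Rightarrow> prog \<Rightarrow> bool" where
  "ptime_adversary l p \<longleftrightarrow> oracle_free p \<and> (\<exists>q :: nat poly. \<forall>\<eta> \<rho> xs. length xs = l \<longrightarrow>
     (\<exists>m \<le> poly q (input_size \<eta> xs). \<exists>y. runs no_oracle \<rho> p \<eta> xs m y))"

text \<open>Oracle attackers: the time bound is uniform in the tape and in the oracle, which
  answers with \<open>\<eta>\<close> bits.\<close>

definition ptime_oracle_adversary :: "prog \<Rightarrow> bool" where
  "ptime_oracle_adversary p \<longleftrightarrow> (\<exists>q :: nat poly. \<forall>\<eta> \<rho> orc. (\<forall>x. length (orc x) = \<eta>) \<longrightarrow>
     (\<exists>m \<le> poly q \<eta>. \<exists>y. runs orc \<rho> p \<eta> [] m y))"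


section \<open>Probabilities and pseudo-random functions\<close>

definition negligible :: "(nat \<Rightarrow> real) \<Rightarrow> bool" where
  "negligible f \<longleftrightarrow> (\<forall>c :: nat. \<forall>\<^sub>F \<eta> in sequentially. \<bar>f \<eta>\<bar> < 1 / real \<eta> ^ c)"

definition random_tape :: "tape measure" where
  "random_tape = PiM UNIV (\<lambda>_. measure_pmf (pmf_of_set UNIV))"

definition random_bits :: "nat \<Rightarrow> bits measure" where
  "random_bits \<eta> = measure_pmf (pmf_of_set {w. length w = \<eta>})"

definition random_fun :: "nat \<Rightarrow> (bits \<Rightarrow> bits) measure" where
  "random_fun \<eta> = PiM UNIV (\<lambda>_. random_bits \<eta>)"

text \<open>The hash function is given as \<open>h \<eta> x k\<close>, with \<open>k\<close> the key.\<close>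

definition prf_family :: "(nat \<Rightarrow> bits \<Rightarrow> bits \<Rightarrow> bits) \<Rightarrow> bool" where
  "prf_family h \<longleftrightarrow> (\<forall>p. ptime_oracle_adversary p \<longrightarrow> negligible (\<lambda>\<eta>.
      \<P>(\<omega> in random_bits \<eta> \<Otimes>\<^sub>M random_tape. accepts (\<lambda>x. h \<eta> x (fst \<omega>)) (snd \<omega>) p \<eta> [])
    - \<P>(\<omega> in random_fun \<eta> \<Otimes>\<^sub>M random_tape. accepts (fst \<omega>) (snd \<omega>) p \<eta> [])))"


section \<open>Terms\<close>

datatype sort = Bool_Sort | Nonce_Sort | Term_Sort

datatype 'f fsym = Pair_Sym | Proj1_Sym | Proj2_Sym | Other 'f

text \<open>\<open>'f\<close> are the function symbols that are not named explicitly, \<open>'g\<close> the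
  attacker function symbols.\<close>

datatype ('f, 'g) tm =
    Name nat
  | TT
  | FF
  | Zero
  | Xor "('f, 'g) tm" "('f, 'g) tm"
  | EQ "('f, 'g) tm" "('f, 'g) tm"
  | Ite "('f, 'g) tm" "('f, 'g) tm" "('f, 'g) tm"
  | H "('f, 'g) tm" "('f, 'g) tm"
  | Fun "'f fsym" "('f, 'g) tm list"
  | Att 'g "('f, 'g) tm list"

record ('f, 'g) signature =
  other_sort :: "'f \<Rightarrow> sort list \<times> sort"
  att_arity :: "'g \<Rightarrow> nat"

primrec fsym_sort :: "('f, 'g) signature \<Rightarrow> 'f fsym \<Rightarrow> sort list \<times> sort" where
  "fsym_sort S Pair_Sym = ([Term_Sort, Term_Sort], Term_Sort)"
| "fsym_sort S Proj1_Sym = ([Term_Sort], Term_Sort)"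
| "fsym_sort S Proj2_Sym = ([Term_Sort], Term_Sort)"
| "fsym_sort S (Other f) = other_sort S f"

text \<open>The conditional is overloaded: it has every sort that both branches have.\<close>

inductive has_sort :: "('f, 'g) signature \<Rightarrow> ('f, 'g) tm \<Rightarrow> sort \<Rightarrow> bool"
  for S :: "('f, 'g) signature"
where
  "has_sort S (Name a) Nonce_Sort"
| "has_sort S TT Bool_Sort"
| "has_sort S FF Bool_Sort"
| "has_sort S Zero Nonce_Sort"
| "has_sort S x Nonce_Sort \<Longrightarrow> has_sort S y Nonce_Sort \<Longrightarrow> has_sort S (Xor x y) Nonce_Sort"
| "has_sort S x Term_Sort \<Longrightarrow> has_sort S y Term_Sort \<Longrightarrow> has_sort S (EQ x y) Bool_Sort"
| "has_sort S b Bool_Sort \<Longrightarrow> has_sort S x s \<Longrightarrow> has_sort S y s \<Longrightarrow> has_sort S (Ite b x y) s"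
| "has_sort S x Term_Sort \<Longrightarrow> has_sort S y Nonce_Sort \<Longrightarrow> has_sort S (H x y) Nonce_Sort"
| "list_all2 (has_sort S) xs (fst (fsym_sort S f)) \<Longrightarrow> has_sort S (Fun f xs) (snd (fsym_sort S f))"
| "length xs = att_arity S g \<Longrightarrow> \<forall>x \<in> set xs. has_sort S x Term_Sort \<Longrightarrow>
    has_sort S (Att g xs) Term_Sort"
| "has_sort S x s \<Longrightarrow> has_sort S x Term_Sort"

definition ground_term :: "('f, 'g) signature \<Rightarrow> ('f, 'g) tm \<Rightarrow> bool" where
  "ground_term S t \<longleftrightarrow> has_sort S t Term_Sort"

fun names :: "('f, 'g) tm \<Rightarrow> nat set" where
  "names (Name a) = {a}"
| "names TT = {}"
| "names FF = {}"
| "names Zero = {}"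
| "names (Xor x y) = names x \<union> names y"
| "names (EQ x y) = names x \<union> names y"
| "names (Ite b x y) = names b \<union> names x \<union> names y"
| "names (H x y) = names x \<union> names y"
| "names (Fun f xs) = (\<Union>x \<in> set xs. names x)"
| "names (Att g xs) = (\<Union>x \<in> set xs. names x)"

fun subterms :: "('f, 'g) tm \<Rightarrow> ('f, 'g) tm set" where
  "subterms (Name a) = {Name a}"
| "subterms TT = {TT}"
| "subterms FF = {FF}"
| "subterms Zero = {Zero}"
| "subterms (Xor x y) = insert (Xor x y) (subterms x \<union> subterms y)"
| "subterms (EQ x y) = insert (EQ x y) (subterms x \<union> subterms y)"
| "subterms (Ite b x y) = insert (Ite b x y) (subterms b \<union> subterms x \<union> subterms y)"
| "subterms (H x y) = insert (H x y) (subterms x \<union> subterms y)"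
| "subterms (Fun f xs) = insert (Fun f xs) (\<Union>x \<in> set xs. subterms x)"
| "subterms (Att g xs) = insert (Att g xs) (\<Union>x \<in> set xs. subterms x)"

text \<open>Every occurrence of the name \<open>k\<close> is as second argument of \<open>H\<close>.\<close>

fun only_hash_key :: "nat \<Rightarrow> ('f, 'g) tm \<Rightarrow> bool" where
  "only_hash_key k (Name a) \<longleftrightarrow> a \<noteq> k"
| "only_hash_key k TT \<longleftrightarrow> True"
| "only_hash_key k FF \<longleftrightarrow> True"
| "only_hash_key k Zero \<longleftrightarrow> True"
| "only_hash_key k (Xor x y) \<longleftrightarrow> only_hash_key k x \<and> only_hash_key k y"
| "only_hash_key k (EQ x y) \<longleftrightarrow> only_hash_key k x \<and> only_hash_key k y"
| "only_hash_key k (Ite b x y) \<longleftrightarrow> only_hash_key k b \<and> only_hash_key k x \<and> only_hash_key k y"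
| "only_hash_key k (H x y) \<longleftrightarrow> only_hash_key k x \<and> (y = Name k \<or> only_hash_key k y)"
| "only_hash_key k (Fun f xs) \<longleftrightarrow> (\<forall>x \<in> set xs. only_hash_key k x)"
| "only_hash_key k (Att g xs) \<longleftrightarrow> (\<forall>x \<in> set xs. only_hash_key k x)"

text \<open>Conditional whose condition is the disjunction of a list of terms.\<close>

fun ite_disj :: "('f, 'g) tm list \<Rightarrow> ('f, 'g) tm \<Rightarrow> ('f, 'g) tm \<Rightarrow> ('f, 'g) tm" where
  "ite_disj [] x y = Ite FF x y"
| "ite_disj [b] x y = Ite b x y"
| "ite_disj (b # b' # bs) x y = Ite b x (ite_disj (b' # bs) x y)"


section \<open>Computational models\<close>

text \<open>\<open>name_pos M \<eta> a\<close> is the first position of the block of the name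
  \<open>a\<close> on the honest tape.\<close>

record ('f, 'g) model =
  name_pos :: "nat \<Rightarrow> nat \<Rightarrow> nat"
  hash :: "nat \<Rightarrow> bits \<Rightarrow> bits \<Rightarrow> bits"
  fsym_int :: "'f fsym \<Rightarrow> nat \<Rightarrow> bits list \<Rightarrow> bits"
  att_int :: "'g \<Rightarrow> nat \<Rightarrow> bits list \<Rightarrow> tape \<Rightarrow> bits"

primrec sort_set :: "nat \<Rightarrow> sort \<Rightarrow> bits set" where
  "sort_set \<eta> Bool_Sort = {[True], [False]}"
| "sort_set \<eta> Nonce_Sort = {w. length w = \<eta>}"
| "sort_set \<eta> Term_Sort = UNIV"

definition sorted_args :: "sort list \<Rightarrow> nat \<Rightarrow> bits list set" where
  "sorted_args ss \<eta> = {xs. list_all2 (\<lambda>x s. x \<in> sort_set \<eta> s) xs ss}"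

definition computational_model :: "('f, 'g) signature \<Rightarrow> ('f, 'g) model \<Rightarrow> bool" where
  "computational_model S M \<longleftrightarrow>
     (\<forall>\<eta> a b. a \<noteq> b \<longrightarrow>
        {name_pos M \<eta> a ..< name_pos M \<eta> a + \<eta>} \<inter> {name_pos M \<eta> b ..< name_pos M \<eta> b + \<eta>} = {}) \<and>
     ptime_fun (sorted_args [Term_Sort, Nonce_Sort]) (\<lambda>\<eta> xs. hash M \<eta> (xs ! 0) (xs ! 1)) \<and>
     (\<forall>\<eta> x k. length k = \<eta> \<longrightarrow> length (hash M \<eta> x k) = \<eta>) \<and>
     (\<forall>f. ptime_fun (sorted_args (fst (fsym_sort S f))) (fsym_int M f)) \<and>
     (\<forall>f \<eta>. \<forall>xs \<in> sorted_args (fst (fsym_sort S f)) \<eta>.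
        fsym_int M f \<eta> xs \<in> sort_set \<eta> (snd (fsym_sort S f))) \<and>
     (\<forall>g. ptime_tape_fun (\<lambda>_. {xs. length xs = att_arity S g}) (att_int M g))"

fun interp :: "('f, 'g) model \<Rightarrow> nat \<Rightarrow> tape \<Rightarrow> tape \<Rightarrow> ('f, 'g) tm \<Rightarrow> bits" where
  "interp M \<eta> \<rho>1 \<rho>2 (Name a) = map (\<lambda>i. \<rho>1 (name_pos M \<eta> a + i)) [0..<\<eta>]"
| "interp M \<eta> \<rho>1 \<rho>2 TT = [True]"
| "interp M \<eta> \<rho>1 \<rho>2 FF = [False]"
| "interp M \<eta> \<rho>1 \<rho>2 Zero = replicate \<eta> False"
| "interp M \<eta> \<rho>1 \<rho>2 (Xor x y) = map2 (\<noteq>) (interp M \<eta> \<rho>1 \<rho>2 x) (interp M \<eta> \<rho>1 \<rho>2 y)"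
| "interp M \<eta> \<rho>1 \<rho>2 (EQ x y) = [interp M \<eta> \<rho>1 \<rho>2 x = interp M \<eta> \<rho>1 \<rho>2 y]"
| "interp M \<eta> \<rho>1 \<rho>2 (Ite b x y) =
     (if interp M \<eta> \<rho>1 \<rho>2 b = [True] then interp M \<eta> \<rho>1 \<rho>2 x else interp M \<eta> \<rho>1 \<rho>2 y)"
| "interp M \<eta> \<rho>1 \<rho>2 (H x y) = hash M \<eta> (interp M \<eta> \<rho>1 \<rho>2 x) (interp M \<eta> \<rho>1 \<rho>2 y)"
| "interp M \<eta> \<rho>1 \<rho>2 (Fun f xs) = fsym_int M f \<eta> (map (interp M \<eta> \<rho>1 \<rho>2) xs)"
| "interp M \<eta> \<rho>1 \<rho>2 (Att g xs) = att_int M g \<eta> (map (interp M \<eta> \<rho>1 \<rho>2) xs) \<rho>2"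

definition accept_prob :: "('f, 'g) model \<Rightarrow> prog \<Rightarrow> ('f, 'g) tm list \<Rightarrow> nat \<Rightarrow> real" where
  "accept_prob M p us \<eta> =
     \<P>(\<omega> in random_tape \<Otimes>\<^sub>M random_tape.
        accepts no_oracle (snd \<omega>) p \<eta> (map (interp M \<eta> (fst \<omega>) (snd \<omega>)) us))"

definition indist :: "('f, 'g) model \<Rightarrow> ('f, 'g) tm list \<Rightarrow> ('f, 'g) tm list \<Rightarrow> bool" where
  "indist M us vs \<longleftrightarrow> length us = length vs \<and>
     (\<forall>p. ptime_adversary (length us) p \<longrightarrow>
        negligible (\<lambda>\<eta>. accept_prob M p us \<eta> - accept_prob M p vs \<eta>))"

end

theory Submission imports Defs begin

text \<open>
  Both games are played by oracle programs that sample the names other than \<open>k\<close> from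
  the beginning of their tape, use the rest of the tape as attacker tape, and evaluate
  \<open>H(s, k)\<close> by querying the oracle at the value of \<open>s\<close>.  With the oracle
  \<open>H(_, K)\<close> for a random \<open>K\<close> they reproduce the two real games, so by the
  PRF assumption the oracle may be replaced by a random function \<open>g\<close>.  There, unless
  the condition holds, no query has been made at the value \<open>x\<close> of \<open>t\<close>, and
  resampling \<open>g x\<close> by the independent value of \<open>n\<close> turns one game into the other.
\<close>

section \<open>Executions\<close>

text \<open>The PRF assumption speaks of concrete oracle programs, so each game has to be an actual
  program whose time bound is uniform in oracle and tape. Hence the class
  \<open>oracle_ptime\<close> and its closure under composition, which handles terms of any shape.
  The point x is itself computed from g, and a random function may be resampled only at a point
  chosen independently of it. The ideal experiment is therefore cut into countably many events, one
  for each value x of t that no t_i takes, and the event of a hit, where both games show the same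
  messages. On each event x is constant, and changing g there leaves the values of t and of all t_i
  as they are, although the t_i may contain hashes under k themselves. One block of the tape is
  reserved for n in both games. The game with H(t, k) does not read it, which provides the
  independent string for the resampling. If k does not occur in the terms, n may be equal to k. The
  key of the right game then has to come from another name, and this is harmless because the oracle
  is never queried.\<close>

inductive_cases exec_SkipE: "exec orc \<rho> Skip s m s'"
inductive_cases exec_PushE: "exec orc \<rho> (Push r b) s m s'"
inductive_cases exec_PopE: "exec orc \<rho> (Pop r) s m s'"
inductive_cases exec_ReadE: "exec orc \<rho> (Read r) s m s'"
inductive_cases exec_RewindE: "exec orc \<rho> Rewind s m s'"
inductive_cases exec_QueryE: "exec orc \<rho> (Query i j) s m s'"
inductive_cases exec_SeqE: "exec orc \<rho> (Seq p q) s m s'"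
inductive_cases exec_CaseE: "exec orc \<rho> (Case r p q q') s m s'"
inductive_cases exec_WhileE: "exec orc \<rho> (While r p) s m s'"

lemmas exec_atomic = exec.Skip[unfolded One_nat_def] exec.Push[unfolded One_nat_def]
  exec.Pop[unfolded One_nat_def] exec.Read[unfolded One_nat_def] exec.Rewind[unfolded One_nat_def]
  exec.Query[unfolded One_nat_def] exec.While_Stop[unfolded One_nat_def]

lemmas exec_elims = exec_SkipE exec_PushE exec_PopE exec_ReadE exec_RewindE exec_QueryE

text \<open>By uniqueness, a single halting run decides \<open>accepts\<close>: no other step count
  can lead to a different result.\<close>

lemma exec_deterministic:
  "exec orc \<rho> p s m s1 \<Longrightarrow> exec orc \<rho> p s m' s2 \<Longrightarrow> m' = m \<and> s2 = s1"
proof (induction arbitrary: m' s2 rule: exec.induct)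
  case (Seq p s m s' q m'' s'')
  from Seq.prems show ?case by (rule exec_SeqE) (use Seq.IH in blast)
next
  case (Case_Empty R r p h m s q q')
  from Case_Empty.prems Case_Empty.hyps(1) obtain l where "m' = Suc l" "exec orc \<rho> p (R, h) l s2"
    by (auto elim: exec_CaseE)
  with Case_Empty.IH show ?case by blast
next
  case (Case_False R r w q h m s p q')
  from Case_False.prems Case_False.hyps(1) obtain l where "m' = Suc l" "exec orc \<rho> q (R, h) l s2"
    by (auto elim: exec_CaseE)
  with Case_False.IH show ?case by blast
next
  case (Case_True R r w q' h m s p q)
  from Case_True.prems Case_True.hyps(1) obtain l where "m' = Suc l" "exec orc \<rho> q' (R, h) l s2"
    by (auto elim: exec_CaseE)
  with Case_True.IH show ?case by blast
next
  case (While_Stop R r p h)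
  from While_Stop.prems show ?case
    by (rule exec_WhileE) (use While_Stop.hyps in auto)
next
  case (While_Step R r p h m s m1 s1)
  from While_Step.prems While_Step.hyps(1) obtain l l' s' where
    "m' = Suc (l + l')" "exec orc \<rho> p (R, h) l s'" "exec orc \<rho> (While r p) s' l' s2"
    by (auto elim: exec_WhileE)
  with While_Step.IH show ?case by blast
qed (auto elim: exec_elims)

lemma runs_deterministic: "runs orc \<rho> p \<eta> xs m y \<Longrightarrow> runs orc \<rho> p \<eta> xs m' y' \<Longrightarrow> y = y'"
  unfolding runs_def using exec_deterministic by blast

lemma accepts_iff_runs:
  "runs orc \<rho> p \<eta> xs m y \<Longrightarrow> accepts orc \<rho> p \<eta> xs \<longleftrightarrow> y = [True]"
  unfolding accepts_def using runs_deterministic by blast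

section \<open>Finite dependence of runs on oracle and tape\<close>

text \<open>This says that \<open>Q\<close> holds on a basic neighbourhood in the product topology:
  finitely many oracle answers and a finite prefix of the tape are prescribed. Halting events are
  open in this sense, which later makes them measurable.\<close>

definition holds_near ::
    "((bits \<Rightarrow> bits) \<Rightarrow> tape \<Rightarrow> bool) \<Rightarrow> (bits \<Rightarrow> bits) \<Rightarrow> tape \<Rightarrow> bool" where
  "holds_near Q orc \<rho> \<longleftrightarrow> (\<exists>B N. finite B \<and>
    (\<forall>orc' \<rho>'. (\<forall>x\<in>B. orc' x = orc x) \<longrightarrow> (\<forall>i<N. \<rho>' i = \<rho> i) \<longrightarrow> Q orc' \<rho>'))"

lemma holds_nearI:
  assumes "finite B"
    and "\<And>orc' \<rho>'. (\<forall>x\<in>B. orc' x = orc x) \<Longrightarrow> (\<forall>i<N. \<rho>' i = \<rho> i) \<Longrightarrow> Q orc' \<rho>'"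
  shows "holds_near Q orc \<rho>"
  unfolding holds_near_def using assms by (intro exI[of _ B] exI[of _ N]) simp

lemma holds_near_True: "(\<And>orc' \<rho>'. Q orc' \<rho>') \<Longrightarrow> holds_near Q orc \<rho>"
  by (rule holds_nearI[of "{}" _ 0]) simp_all

lemma holds_near_conj:
  assumes "holds_near Q orc \<rho>" "holds_near Q' orc \<rho>"
    and "\<And>orc' \<rho>'. Q orc' \<rho>' \<Longrightarrow> Q' orc' \<rho>' \<Longrightarrow> Q'' orc' \<rho>'"
  shows "holds_near Q'' orc \<rho>"
proof -
  from assms(1) obtain B N where 1: "finite B"
    "\<And>orc' \<rho>'. (\<forall>x\<in>B. orc' x = orc x) \<Longrightarrow> (\<forall>i<N. \<rho>' i = \<rho> i) \<Longrightarrow> Q orc' \<rho>'"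
    unfolding holds_near_def by blast
  from assms(2) obtain B' N' where 2: "finite B'"
    "\<And>orc' \<rho>'. (\<forall>x\<in>B'. orc' x = orc x) \<Longrightarrow> (\<forall>i<N'. \<rho>' i = \<rho> i) \<Longrightarrow> Q' orc' \<rho>'"
    unfolding holds_near_def by blast
  show ?thesis
    by (rule holds_nearI[of "B \<union> B'" _ "N + N'"]) (use 1 2 in \<open>auto intro!: assms(3)\<close>)
qed

lemma holds_near_mono:
  assumes "holds_near Q orc \<rho>" "\<And>orc' \<rho>'. Q orc' \<rho>' \<Longrightarrow> Q' orc' \<rho>'"
  shows "holds_near Q' orc \<rho>"
  by (rule holds_near_conj[OF assms(1) holds_near_True[of "\<lambda>_ _. True"]]) (simp_all add: assms(2))

text \<open>A halting run makes finitely many queries and reads finitely many cells. Every oracle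
  and tape that agree there replay it step by step.\<close>

lemma exec_holds_near:
  "exec orc \<rho> p s m s' \<Longrightarrow> holds_near (\<lambda>orc' \<rho>'. exec orc' \<rho>' p s m s') orc \<rho>"
proof (induction rule: exec.induct)
  case (Read r R h)
  have "exec orc' \<rho>' (Read r) (R, h) 1 (R(r := \<rho> h # R r), Suc h)"
    if "\<forall>i<Suc h. \<rho>' i = \<rho> i" for orc' \<rho>'
    using exec.Read[of orc' \<rho>' r R h] that by simp
  then show ?case by (intro holds_nearI[of "{}" _ "Suc h"]) simp_all
next
  case (Query i j R h)
  have "exec orc' \<rho>' (Query i j) (R, h) 1 (R(j := orc (R i)), h)"
    if "\<forall>x\<in>{R i}. orc' x = orc x" for orc' \<rho>'
    using exec.Query[of orc' \<rho>' i j R h] that by simp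
  then show ?case by (intro holds_nearI[of "{R i}"]) simp_all
next
  case (Seq p s m s' q m' s'')
  from Seq.IH show ?case by (rule holds_near_conj) (rule exec.Seq)
next
  case (While_Step R r p h m s m1 s1)
  from While_Step.IH show ?case by (rule holds_near_conj) (rule exec.While_Step[where R = R and r = r, OF While_Step.hyps(1)])
next
  case (Case_Empty R r p h m s q q')
  from Case_Empty.IH show ?case by (rule holds_near_mono) (rule exec.Case_Empty[where R = R and r = r, OF Case_Empty.hyps(1)])
next
  case (Case_False R r w q h m s p q')
  from Case_False.IH show ?case by (rule holds_near_mono) (rule exec.Case_False[where R = R and r = r, OF Case_False.hyps(1)])
next
  case (Case_True R r w q' h m s p q)
  from Case_True.IH show ?case by (rule holds_near_mono) (rule exec.Case_True[where R = R and r = r, OF Case_True.hyps(1)])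
qed (rule holds_near_True, (rule exec.intros; assumption))+

text \<open>One step adds at most one bit to a stack, except for a query, whose answer has length at
  most \<open>L\<close> whatever was on the stack before.\<close>

lemma exec_length:
  "exec orc \<rho> p s m s' \<Longrightarrow> (\<And>x. length (orc x) \<le> L) \<Longrightarrow> (\<And>r. length (fst s r) \<le> L) \<Longrightarrow>
    length (fst s' r) \<le> L + m"
proof -
  assume e: "exec orc \<rho> p s m s'" and orc: "\<And>x. length (orc x) \<le> L"
  \<comment> \<open>The bound on the stacks grows along the run while the bound on the oracle
    answers stays \<open>L\<close>, so the induction has to separate the two.\<close>
  have "\<forall>L'\<ge>L. (\<forall>r. length (fst s r) \<le> L') \<longrightarrow> (\<forall>r. length (fst s' r) \<le> L' + m)"
    using e
  proof (induction rule: exec.induct)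
    case (Query i j R h)
    show ?case by (auto intro!: le_SucI order_trans[OF orc])
  next
    case (Seq p s m s' q m' s'')
    show ?case
    proof (intro allI impI)
      fix L' r assume "L \<le> L'" "\<forall>r. length (fst s r) \<le> L'"
      with Seq.IH(1) have "\<forall>r. length (fst s' r) \<le> L' + m" by blast
      with Seq.IH(2)[rule_format, of "L' + m"] \<open>L \<le> L'\<close> show "length (fst s'' r) \<le> L' + (m + m')"
        by (simp add: add.assoc)
    qed
  next
    case (While_Step R r p h m s m' s')
    show ?case
    proof (intro allI impI)
      fix L' a assume "L \<le> L'" "\<forall>r. length (fst (R, h) r) \<le> L'"
      with While_Step.IH(1) have "\<forall>r. length (fst s r) \<le> L' + m" by blast
      with While_Step.IH(2)[rule_format, of "L' + m" a] \<open>L \<le> L'\<close>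
      show "length (fst s' a) \<le> L' + Suc (m + m')"
        by (simp add: add.assoc)
    qed
  next
    case (Pop r R h)
    show ?case by (auto intro!: le_SucI order_trans[OF diff_le_self])
  qed (simp_all add: le_SucI)
  then show "(\<And>r. length (fst s r) \<le> L) \<Longrightarrow> length (fst s' r) \<le> L + m" by blast
qed

lemma exec_oracle_free:
  "exec orc \<rho> p s m s' \<Longrightarrow> oracle_free p \<Longrightarrow> exec orc' \<rho> p s m s'"
  by (induction rule: exec.induct) (auto intro: exec.intros exec_atomic)

lemma exec_tape_free:
  "exec orc \<rho> p s m s' \<Longrightarrow> tape_free p \<Longrightarrow> exec orc \<rho>' p s m s'"
  by (induction rule: exec.induct) (auto intro: exec.intros exec_atomic)

lemma runs_oracle_free: "runs orc \<rho> p \<eta> xs m y \<Longrightarrow> oracle_free p \<Longrightarrow> runs orc' \<rho> p \<eta> xs m y"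
  unfolding runs_def using exec_oracle_free by blast

lemma runs_tape_free: "runs orc \<rho> p \<eta> xs m y \<Longrightarrow> tape_free p \<Longrightarrow> runs orc \<rho>' p \<eta> xs m y"
  unfolding runs_def using exec_tape_free by blast

section \<open>Runs within a time bound\<close>

text \<open>An upper bound instead of an exact count lets branches of different length be rounded up
  to a common value, and bounds still add up under \<open>Seq\<close>.\<close>

definition exec_within :: "(bits \<Rightarrow> bits) \<Rightarrow> tape \<Rightarrow> prog \<Rightarrow> state \<Rightarrow> nat \<Rightarrow> state \<Rightarrow> bool" where
  "exec_within orc \<rho> p s T s' \<longleftrightarrow> (\<exists>m\<le>T. exec orc \<rho> p s m s')"

lemma exec_withinI: "exec orc \<rho> p s m s' \<Longrightarrow> m \<le> T \<Longrightarrow> exec_within orc \<rho> p s T s'"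
  by (auto simp: exec_within_def)

lemma exec_within_mono: "exec_within orc \<rho> p s T s' \<Longrightarrow> T \<le> T' \<Longrightarrow> exec_within orc \<rho> p s T' s'"
  unfolding exec_within_def using le_trans by blast

lemma exec_within_Seq:
  "exec_within orc \<rho> p s T s' \<Longrightarrow> exec_within orc \<rho> q s' T' s'' \<Longrightarrow>
    exec_within orc \<rho> (Seq p q) s (T + T') s''"
  unfolding exec_within_def
  by (elim exE conjE, rule exI, rule conjI[rotated], rule exec.Seq, assumption+, simp)

lemma exec_within_Skip: "exec_within orc \<rho> Skip s 1 s"
  by (rule exec_withinI, rule exec.Skip) simp

lemma exec_within_Push: "exec_within orc \<rho> (Push r b) (R, h) 1 (R(r := b # R r), h)"
  by (rule exec_withinI, rule exec.Push) simp

lemma exec_within_Pop: "exec_within orc \<rho> (Pop r) (R, h) 1 (R(r := tl (R r)), h)"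
  by (rule exec_withinI, rule exec.Pop) simp

lemma exec_within_Read: "exec_within orc \<rho> (Read r) (R, h) 1 (R(r := \<rho> h # R r), Suc h)"
  by (rule exec_withinI, rule exec.Read) simp

lemma exec_within_Rewind: "exec_within orc \<rho> Rewind (R, h) 1 (R, 0)"
  by (rule exec_withinI, rule exec.Rewind) simp

lemma exec_within_Query: "exec_within orc \<rho> (Query i j) (R, h) 1 (R(j := orc (R i)), h)"
  by (rule exec_withinI, rule exec.Query) simp

lemma exec_within_Case_Empty:
  "R r = [] \<Longrightarrow> exec_within orc \<rho> p (R, h) T s \<Longrightarrow> exec_within orc \<rho> (Case r p q q') (R, h) (Suc T) s"
  unfolding exec_within_def
  by (elim exE conjE, rule exI, rule conjI[rotated], rule exec.Case_Empty, assumption+, simp)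

lemma exec_within_Case_False:
  "R r = False # w \<Longrightarrow> exec_within orc \<rho> q (R, h) T s \<Longrightarrow> exec_within orc \<rho> (Case r p q q') (R, h) (Suc T) s"
  unfolding exec_within_def
  by (elim exE conjE, rule exI, rule conjI[rotated], rule exec.Case_False, assumption+, simp)

lemma exec_within_Case_True:
  "R r = True # w \<Longrightarrow> exec_within orc \<rho> q' (R, h) T s \<Longrightarrow> exec_within orc \<rho> (Case r p q q') (R, h) (Suc T) s"
  unfolding exec_within_def
  by (elim exE conjE, rule exI, rule conjI[rotated], rule exec.Case_True, assumption+, simp)

lemma exec_within_While_Stop: "R r = [] \<Longrightarrow> exec_within orc \<rho> (While r p) (R, h) 1 (R, h)"
  by (rule exec_withinI, rule exec.While_Stop) simp_all

lemma exec_within_While_Step: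
  "R r \<noteq> [] \<Longrightarrow> exec_within orc \<rho> p (R, h) T s \<Longrightarrow> exec_within orc \<rho> (While r p) s T' s' \<Longrightarrow>
    exec_within orc \<rho> (While r p) (R, h) (Suc (T + T')) s'"
  unfolding exec_within_def
  by (elim exE conjE, rule exI, rule conjI[rotated], rule exec.While_Step, assumption+, simp)

lemma exec_within_loop:
  assumes step: "\<And>i. i < n \<Longrightarrow> fst (s i) r \<noteq> [] \<and> exec_within orc \<rho> p (s i) c (s (Suc i))"
    and stop: "fst (s n) r = []"
  shows "exec_within orc \<rho> (While r p) (s 0) (n * Suc c + 1) (s n)"
proof -
  \<comment> \<open>Induction on the number \<open>k\<close> of iterations still to come, because
    \<open>While_Step\<close> unrolls a loop at its start.\<close>
  have "k \<le> n \<Longrightarrow> exec_within orc \<rho> (While r p) (s (n - k)) (k * Suc c + 1) (s n)" for k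
  proof (induction k)
    case 0
    show ?case using stop exec_within_While_Stop[of "fst (s n)" r orc \<rho> p "snd (s n)"] by simp
  next
    case (Suc k)
    then have i: "n - Suc k < n" "Suc (n - Suc k) = n - k" by auto
    have "exec_within orc \<rho> (While r p) (fst (s (n - Suc k)), snd (s (n - Suc k)))
      (Suc (c + (k * Suc c + 1))) (s n)"
      using step[OF i(1)] Suc i(2) by (intro exec_within_While_Step) auto
    then show ?case by (simp add: algebra_simps)
  qed
  from this[of n] show ?thesis by simp
qed

text \<open>Replacing \<open>Rewind\<close> by a program \<open>w\<close> that moves the head to position
  \<open>d\<close> makes a program run on the suffix of the tape that starts there.\<close>

primrec embed :: "(nat \<Rightarrow> nat) \<Rightarrow> prog \<Rightarrow> prog \<Rightarrow> prog" where
  "embed f w Skip = Skip"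
| "embed f w (Push r b) = Push (f r) b"
| "embed f w (Pop r) = Pop (f r)"
| "embed f w (Read r) = Read (f r)"
| "embed f w Rewind = w"
| "embed f w (Query i j) = Query (f i) (f j)"
| "embed f w (Seq p q) = Seq (embed f w p) (embed f w q)"
| "embed f w (Case r p q q') = Case (f r) (embed f w p) (embed f w q) (embed f w q')"
| "embed f w (While r p) = While (f r) (embed f w p)"

text \<open>Only \<open>Rewind\<close> gets longer, so each step of \<open>p\<close> costs at most
  \<open>c\<close> steps. The registers outside \<open>range f\<close> keep the content
  \<open>S0\<close> throughout: \<open>w\<close> may rely on this, for instance to find a counter
  there, and has to leave all registers as they were.\<close>

lemma exec_embed:
  assumes f: "inj f" and c: "1 \<le> c"
    and w: "\<And>S h. (\<forall>x. x \<notin> range f \<longrightarrow> S x = S0 x) \<Longrightarrow> exec_within orc \<rho> w (S, h) c (S, d)"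
  shows "exec orc (\<lambda>j. \<rho> (d + j)) p s m s' \<Longrightarrow>
    \<forall>i. S (f i) = fst s i \<Longrightarrow> \<forall>x. x \<notin> range f \<longrightarrow> S x = S0 x \<Longrightarrow>
    exec_within orc \<rho> (embed f w p) (S, d + snd s) (m * c)
      (\<lambda>x. if x \<in> range f then fst s' (inv f x) else S0 x, d + snd s')"
proof (induction arbitrary: S rule: exec.induct)
  case (Skip s)
  have "S = (\<lambda>x. if x \<in> range f then fst s (inv f x) else S0 x)"
    using Skip f by (auto simp: fun_eq_iff)
  with exec_within_mono[OF exec_within_Skip[of orc \<rho> "(S, d + snd s)"], of c] c show ?case by simp
next
  case (Push r b R h)
  have "S(f r := b # S (f r)) = (\<lambda>x. if x \<in> range f then fst (R(r := b # R r), h) (inv f x) else S0 x)"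
    using Push f by (auto simp: fun_eq_iff inj_eq)
  with exec_within_mono[OF exec_within_Push[of orc \<rho> "f r" b S "d + h"], of c] c show ?case by simp
next
  case (Pop r R h)
  have "S(f r := tl (S (f r))) = (\<lambda>x. if x \<in> range f then fst (R(r := tl (R r)), h) (inv f x) else S0 x)"
    using Pop f by (auto simp: fun_eq_iff inj_eq)
  with exec_within_mono[OF exec_within_Pop[of orc \<rho> "f r" S "d + h"], of c] c show ?case by simp
next
  case (Read r R h)
  have "S(f r := \<rho> (d + h) # S (f r)) = (\<lambda>x. if x \<in> range f then fst (R(r := \<rho> (d + h) # R r), Suc h) (inv f x) else S0 x)"
    using Read f by (auto simp: fun_eq_iff inj_eq)
  with exec_within_mono[OF exec_within_Read[of orc \<rho> "f r" S "d + h"], of c] c show ?case by simp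
next
  case (Rewind R h)
  have "S = (\<lambda>x. if x \<in> range f then fst (R, 0) (inv f x) else S0 x)"
    using Rewind f by (auto simp: fun_eq_iff)
  moreover have "exec_within orc \<rho> w (S, d + h) c (S, d)" using w Rewind(2) by blast
  ultimately show ?case by (simp only: embed.simps fst_conv snd_conv mult_1 add_0_right)
next
  case (Query i j R h)
  have "S(f j := orc (S (f i))) = (\<lambda>x. if x \<in> range f then fst (R(j := orc (R i)), h) (inv f x) else S0 x)"
    using Query f by (auto simp: fun_eq_iff inj_eq)
  with exec_within_mono[OF exec_within_Query[of orc \<rho> "f i" "f j" S "d + h"], of c] c show ?case by simp
next
  case (Seq p s m s' q m' s'')
  show ?case
    unfolding embed.simps add_mult_distrib
    by (rule exec_within_Seq, rule Seq.IH(1), use Seq.prems in simp, use Seq.prems in simp,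
        rule Seq.IH(2)) (use f in auto)
next
  case (Case_Empty R r p h m s q q')
  have "exec_within orc \<rho> (embed f w p) (S, d + h) (m * c)
    (\<lambda>x. if x \<in> range f then fst s (inv f x) else S0 x, d + snd s)"
    using Case_Empty.IH[OF Case_Empty.prems] by (simp only: snd_conv)
  with Case_Empty.hyps(1) Case_Empty.prems(1)[rule_format, of r]
  have "exec_within orc \<rho> (embed f w (Case r p q q')) (S, d + h) (Suc (m * c))
    (\<lambda>x. if x \<in> range f then fst s (inv f x) else S0 x, d + snd s)"
    by (simp add: exec_within_Case_Empty)
  then show ?case
    unfolding snd_conv by (rule exec_within_mono) (use c in simp)
next
  case (Case_False R r v q h m s p q')
  have "exec_within orc \<rho> (embed f w q) (S, d + h) (m * c)
    (\<lambda>x. if x \<in> range f then fst s (inv f x) else S0 x, d + snd s)"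
    using Case_False.IH[OF Case_False.prems] by (simp only: snd_conv)
  with Case_False.hyps(1) Case_False.prems(1)[rule_format, of r]
  have "exec_within orc \<rho> (embed f w (Case r p q q')) (S, d + h) (Suc (m * c))
    (\<lambda>x. if x \<in> range f then fst s (inv f x) else S0 x, d + snd s)"
    by (simp add: exec_within_Case_False)
  then show ?case
    unfolding snd_conv by (rule exec_within_mono) (use c in simp)
next
  case (Case_True R r v q' h m s p q)
  have "exec_within orc \<rho> (embed f w q') (S, d + h) (m * c)
    (\<lambda>x. if x \<in> range f then fst s (inv f x) else S0 x, d + snd s)"
    using Case_True.IH[OF Case_True.prems] by (simp only: snd_conv)
  with Case_True.hyps(1) Case_True.prems(1)[rule_format, of r]
  have "exec_within orc \<rho> (embed f w (Case r p q q')) (S, d + h) (Suc (m * c))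
    (\<lambda>x. if x \<in> range f then fst s (inv f x) else S0 x, d + snd s)"
    by (simp add: exec_within_Case_True)
  then show ?case
    unfolding snd_conv by (rule exec_within_mono) (use c in simp)
next
  case (While_Stop R r p h)
  have "S = (\<lambda>x. if x \<in> range f then fst (R, h) (inv f x) else S0 x)"
    using While_Stop f by (auto simp: fun_eq_iff)
  with exec_within_mono[OF exec_within_While_Stop[of S "f r" orc \<rho> "embed f w p" "d + h"], of c] c
    While_Stop show ?case by simp
next
  case (While_Step R r p h m s m' s')
  let ?S = "\<lambda>x. if x \<in> range f then fst s (inv f x) else S0 x"
  have S: "\<forall>i. ?S (f i) = fst s i" "\<forall>x. x \<notin> range f \<longrightarrow> ?S x = S0 x"
    using f by simp_all
  have "S (f r) \<noteq> []" using While_Step.hyps(1) While_Step.prems(1) by simp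
  from exec_within_While_Step[OF this While_Step.IH(1)[OF While_Step.prems, unfolded snd_conv]
      While_Step.IH(2)[OF S, unfolded embed.simps]]
  have "exec_within orc \<rho> (While (f r) (embed f w p)) (S, d + h) (Suc (m * c + m' * c))
    (\<lambda>x. if x \<in> range f then fst s' (inv f x) else S0 x, d + snd s')" .
  then show ?case
    unfolding embed.simps fst_conv snd_conv
    by (rule exec_within_mono) (use c in \<open>auto simp: algebra_simps\<close>)
qed

lemma exec_within_cong:
  "exec_within orc \<rho> p s T s' \<Longrightarrow> s' = s'' \<Longrightarrow> T \<le> T' \<Longrightarrow> exec_within orc \<rho> p s T' s''"
  using exec_within_mono by blast

section \<open>Programs for stacks, head and unary counters\<close>

definition clear :: "nat \<Rightarrow> prog" where
  "clear r = While r (Pop r)"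

lemma exec_clear: "exec_within orc \<rho> (clear r) (S, h) (2 * length (S r) + 1) (S(r := []), h)"
proof (induction "S r" arbitrary: S)
  case Nil
  show ?case
    unfolding clear_def by (rule exec_within_cong[OF exec_within_While_Stop]) (use Nil in auto)
next
  case (Cons b w)
  have "w = (S(r := tl (S r))) r" using Cons.hyps(2)[symmetric] by simp
  from Cons.hyps(1)[of "S(r := tl (S r))", OF this] have
    "exec_within orc \<rho> (While r (Pop r)) (S(r := tl (S r)), h) (2 * length w + 1) (S(r := []), h)"
    using Cons.hyps(2)[symmetric] by (simp add: clear_def)
  from exec_within_While_Step[OF _ exec_within_Pop this] show ?case
    unfolding clear_def using Cons.hyps(2)[symmetric] by simp
qed

definition move_rev :: "nat \<Rightarrow> nat \<Rightarrow> prog" where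
  "move_rev a b = While a (Seq (Case a Skip (Push b False) (Push b True)) (Pop a))"

lemma exec_move_rev:
  assumes "a \<noteq> b"
  shows "exec_within orc \<rho> (move_rev a b) (S, h) (4 * length (S a) + 1)
    (S(a := [], b := rev (S a) @ S b), h)"
proof (induction "S a" arbitrary: S)
  case Nil
  show ?case
    unfolding move_rev_def
    by (rule exec_within_cong[OF exec_within_While_Stop]) (use Nil in \<open>auto simp: fun_eq_iff\<close>)
next
  case (Cons c w)
  let ?S = "S(b := c # S b, a := w)"
  have "w = ?S a" by simp
  from Cons.hyps(1)[of ?S, OF this] have IH:
    "exec_within orc \<rho> (move_rev a b) (?S, h) (4 * length w + 1) (S(a := [], b := rev (S a) @ S b), h)"
    using Cons.hyps(2)[symmetric] assms by (simp add: fun_upd_twist[of a b])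
  have "exec_within orc \<rho> (Case a Skip (Push b False) (Push b True)) (S, h) 2 (S(b := c # S b), h)"
  proof (cases c)
    case True
    with Cons.hyps(2)[symmetric] show ?thesis
      using exec_within_Case_True[OF _ exec_within_Push, of S a w] by (simp add: numeral_2_eq_2)
  next
    case False
    with Cons.hyps(2)[symmetric] show ?thesis
      using exec_within_Case_False[OF _ exec_within_Push, of S a w] by (simp add: numeral_2_eq_2)
  qed
  from exec_within_Seq[OF this exec_within_Pop[of orc \<rho> a]]
  have "exec_within orc \<rho> (Seq (Case a Skip (Push b False) (Push b True)) (Pop a)) (S, h) 3 (?S, h)"
    using Cons.hyps(2)[symmetric] assms by (simp add: fun_upd_twist[of a b])
  from exec_within_While_Step[OF _ this IH[unfolded move_rev_def]] show ?case
    unfolding move_rev_def using Cons.hyps(2)[symmetric] by (simp add: exec_within_mono)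
qed

text \<open>Reading is the only way to move the head forward. The bit read is popped at once, so
  that the register ends up unchanged.\<close>

primrec skip_bits :: "nat \<Rightarrow> nat \<Rightarrow> prog" where
  "skip_bits 0 r = Skip"
| "skip_bits (Suc n) r = Seq (Read r) (Seq (Pop r) (skip_bits n r))"

lemma exec_skip_bits: "exec_within orc \<rho> (skip_bits n r) (S, h) (2 * n + 1) (S, h + n)"
proof (induction n arbitrary: h)
  case 0
  show ?case using exec_within_Skip[of orc \<rho> "(S, h)"] by simp
next
  case (Suc n)
  have "exec_within orc \<rho> (Pop r) (S(r := \<rho> h # S r), Suc h) 1 (S, Suc h)"
    using exec_within_Pop[of orc \<rho> r "S(r := \<rho> h # S r)" "Suc h"] by simp
  from exec_within_Seq[OF exec_within_Read exec_within_Seq[OF this Suc.IH]] show ?case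
    by simp
qed

text \<open>The target \<open>N * \<eta>\<close> depends on the security parameter, which is
  available only in unary on \<open>c\<close>; each unit is worth \<open>N\<close> cells. The units
  pass to \<open>t\<close> and back, so the counter survives and the program can stand in for
  \<open>Rewind\<close> any number of times.\<close>

definition goto :: "nat \<Rightarrow> nat \<Rightarrow> nat \<Rightarrow> nat \<Rightarrow> prog" where
  "goto N c t r = Seq Rewind
    (Seq (While c (Seq (Pop c) (Seq (Push t True) (skip_bits N r))))
         (While t (Seq (Pop t) (Push c True))))"

lemma exec_goto:
  assumes c: "S c = replicate \<eta> True" and t: "S t = []" and ct: "c \<noteq> t"
  shows "exec_within orc \<rho> (goto N c t r) (S, h) (3 + \<eta> * (2 * N + 7)) (S, N * \<eta>)"
proof -
  let ?s = "\<lambda>i. (S(c := replicate (\<eta> - i) True, t := replicate i True), i * N)"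
  let ?u = "\<lambda>i. (S(c := replicate i True, t := replicate (\<eta> - i) True), \<eta> * N)"
  have "exec_within orc \<rho> (While c (Seq (Pop c) (Seq (Push t True) (skip_bits N r)))) (?s 0)
    (\<eta> * Suc (1 + (1 + (2 * N + 1))) + 1) (?s \<eta>)"
  proof (rule exec_within_loop)
    fix i assume i: "i < \<eta>"
    have "exec_within orc \<rho> (Seq (Pop c) (Seq (Push t True) (skip_bits N r))) (?s i)
      (1 + (1 + (2 * N + 1))) (?s (Suc i))"
      by (rule exec_within_cong,
          rule exec_within_Seq[OF exec_within_Pop exec_within_Seq[OF exec_within_Push exec_skip_bits]])
        (use i ct in \<open>auto simp: fun_eq_iff simp flip: replicate_Suc\<close>)
    then show "fst (?s i) c \<noteq> [] \<and> exec_within orc \<rho> (Seq (Pop c) (Seq (Push t True) (skip_bits N r))) (?s i)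
      (1 + (1 + (2 * N + 1))) (?s (Suc i))"
      using i ct by simp
  qed (use ct in simp)
  moreover have "?s 0 = (S, 0)" using c t by (auto simp: fun_eq_iff)
  moreover have "exec_within orc \<rho> (While t (Seq (Pop t) (Push c True))) (?u 0) (\<eta> * Suc (1 + 1) + 1) (?u \<eta>)"
  proof (rule exec_within_loop)
    fix i assume i: "i < \<eta>"
    have "exec_within orc \<rho> (Seq (Pop t) (Push c True)) (?u i) (1 + 1) (?u (Suc i))"
      by (rule exec_within_cong, rule exec_within_Seq[OF exec_within_Pop exec_within_Push])
        (use i ct in \<open>auto simp: fun_eq_iff simp flip: replicate_Suc\<close>)
    then show "fst (?u i) t \<noteq> [] \<and> exec_within orc \<rho> (Seq (Pop t) (Push c True)) (?u i) (1 + 1) (?u (Suc i))"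
      using i ct by simp
  qed (use ct in simp)
  moreover have "?u 0 = ?s \<eta>" "?u \<eta> = (S, N * \<eta>)" using c t by (auto simp: fun_eq_iff)
  ultimately have
    "exec_within orc \<rho> (While c (Seq (Pop c) (Seq (Push t True) (skip_bits N r)))) (S, 0)
      (\<eta> * Suc (1 + (1 + (2 * N + 1))) + 1) (?s \<eta>)"
    "exec_within orc \<rho> (While t (Seq (Pop t) (Push c True))) (?s \<eta>) (\<eta> * Suc (1 + 1) + 1) (S, N * \<eta>)"
    by (simp_all only:)
  from exec_within_Seq[OF exec_within_Rewind exec_within_Seq[OF this]] show ?thesis
    unfolding goto_def by (rule exec_within_cong) (auto simp: algebra_simps)
qed

primrec push_all :: "nat list \<Rightarrow> prog" where
  "push_all [] = Skip"
| "push_all (r # rs) = Seq (Push r True) (push_all rs)"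

lemma exec_push_all:
  "distinct rs \<Longrightarrow> exec_within orc \<rho> (push_all rs) (S, h) (length rs + 1)
    (\<lambda>x. if x \<in> set rs then True # S x else S x, h)"
proof (induction rs arbitrary: S)
  case Nil
  show ?case using exec_within_Skip[of orc \<rho> "(S, h)"] by simp
next
  case (Cons r rs)
  from Cons.prems have "exec_within orc \<rho> (push_all rs) (S(r := True # S r), h) (length rs + 1)
    (\<lambda>x. if x \<in> set rs then True # (S(r := True # S r)) x else (S(r := True # S r)) x, h)"
    by (intro Cons.IH) simp
  from exec_within_Seq[OF exec_within_Push this] show ?case
    unfolding push_all.simps by (rule exec_within_cong) (use Cons.prems in \<open>auto simp: fun_eq_iff\<close>)
qed

text \<open>Each subprogram expects \<eta> in unary on a register \<open>0\<close> of its own. The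
  copy on \<open>a\<close> is consumed by the first loop, so \<open>a\<close> has to be one of the
  targets \<open>rs\<close> to get it back.\<close>

definition distribute :: "nat \<Rightarrow> nat \<Rightarrow> nat list \<Rightarrow> prog" where
  "distribute a t rs = Seq (While a (Seq (Pop a) (Push t True))) (While t (Seq (Pop t) (push_all rs)))"

lemma exec_distribute:
  assumes a: "S a = replicate \<eta> True" "a \<in> set rs" and t: "S t = []" "t \<notin> set rs"
    and rs: "distinct rs" "\<And>r. r \<in> set rs \<Longrightarrow> r \<noteq> a \<Longrightarrow> S r = []"
  shows "exec_within orc \<rho> (distribute a t rs) (S, h) (2 + \<eta> * (length rs + 6))
    (\<lambda>x. if x \<in> set rs then replicate \<eta> True else S x, h)"
proof -
  have at: "a \<noteq> t" using a t by auto
  let ?s = "\<lambda>i. (S(a := replicate (\<eta> - i) True, t := replicate i True), h)"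
  let ?u = "\<lambda>i. (\<lambda>x. if x \<in> set rs then replicate i True else if x = t then replicate (\<eta> - i) True else S x, h)"
  have "exec_within orc \<rho> (While a (Seq (Pop a) (Push t True))) (?s 0) (\<eta> * Suc (1 + 1) + 1) (?s \<eta>)"
  proof (rule exec_within_loop)
    fix i assume i: "i < \<eta>"
    have "exec_within orc \<rho> (Seq (Pop a) (Push t True)) (?s i) (1 + 1) (?s (Suc i))"
      by (rule exec_within_cong, rule exec_within_Seq[OF exec_within_Pop exec_within_Push])
        (use i at in \<open>auto simp: fun_eq_iff simp flip: replicate_Suc\<close>)
    then show "fst (?s i) a \<noteq> [] \<and> exec_within orc \<rho> (Seq (Pop a) (Push t True)) (?s i) (1 + 1) (?s (Suc i))"
      using i at by simp
  qed (use at in simp)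
  moreover have "?s 0 = (S, h)" using a t by (auto simp: fun_eq_iff)
  moreover have "exec_within orc \<rho> (While t (Seq (Pop t) (push_all rs))) (?u 0)
    (\<eta> * Suc (1 + (length rs + 1)) + 1) (?u \<eta>)"
  proof (rule exec_within_loop)
    fix i assume i: "i < \<eta>"
    have "exec_within orc \<rho> (Seq (Pop t) (push_all rs)) (?u i) (1 + (length rs + 1)) (?u (Suc i))"
      by (rule exec_within_cong, rule exec_within_Seq[OF exec_within_Pop exec_push_all[OF rs(1)]])
        (use i t in \<open>auto simp: fun_eq_iff simp flip: replicate_Suc\<close>)
    then show "fst (?u i) t \<noteq> [] \<and>
      exec_within orc \<rho> (Seq (Pop t) (push_all rs)) (?u i) (1 + (length rs + 1)) (?u (Suc i))"
      using i t by simp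
  qed (use t in simp)
  moreover have "?u 0 = ?s \<eta>" "?u \<eta> = (\<lambda>x. if x \<in> set rs then replicate \<eta> True else S x, h)"
    using a t rs(2) at by (auto simp: fun_eq_iff)
  ultimately have
    "exec_within orc \<rho> (While a (Seq (Pop a) (Push t True))) (S, h) (\<eta> * Suc (1 + 1) + 1) (?s \<eta>)"
    "exec_within orc \<rho> (While t (Seq (Pop t) (push_all rs))) (?s \<eta>)
    (\<eta> * Suc (1 + (length rs + 1)) + 1) (\<lambda>x. if x \<in> set rs then replicate \<eta> True else S x, h)"
    by (simp_all only:)
  from exec_within_Seq[OF this] show ?thesis
    unfolding distribute_def by (rule exec_within_cong) (auto simp: algebra_simps)
qed

text \<open>\<open>prod_encode (b, i)\<close> plays the role of register \<open>i\<close> of block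
  \<open>b\<close>, which gives infinitely many disjoint register sets. Every subprogram reads the
  tape from its first cell, hence the \<open>Rewind\<close> before each of them and the plain
  \<open>Rewind\<close> inside.\<close>

primrec run_blocks :: "nat \<Rightarrow> prog list \<Rightarrow> prog" where
  "run_blocks b [] = Skip"
| "run_blocks b (p # ps) =
     Seq Rewind (Seq (embed (\<lambda>i. prod_encode (b, i)) Rewind p) (run_blocks (Suc b) ps))"

lemma exec_run_blocks:
  assumes "list_all2 (\<lambda>p y. \<exists>m\<le>T. runs orc \<rho> p \<eta> [] m y) ps ys"
    and "\<And>i j. i < length ps \<Longrightarrow> S (prod_encode (b + i, j)) = fst (init \<eta> []) j"
  shows "\<exists>S' h'. exec_within orc \<rho> (run_blocks b ps) (S, h) (length ps * (T + 1) + 1) (S', h') \<and>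
    (\<forall>i<length ps. S' (prod_encode (b + i, 0)) = ys ! i) \<and>
    (\<forall>c j. c < b \<or> b + length ps \<le> c \<longrightarrow> S' (prod_encode (c, j)) = S (prod_encode (c, j)))"
  using assms
proof (induction ps ys arbitrary: b S h rule: list_all2_induct)
  case Nil
  show ?case using exec_within_Skip[of orc \<rho> "(S, h)"] by auto
next
  case (Cons p ps y ys)
  let ?f = "\<lambda>i. prod_encode (b, i)"
  have f: "inj ?f" by (auto simp: inj_def)
  from Cons.hyps(1) obtain m s where m: "m \<le> T" "exec orc \<rho> p (init \<eta> []) m s" "fst s 0 = y"
    by (auto simp: runs_def)
  let ?S = "\<lambda>x. if x \<in> range ?f then fst s (inv ?f x) else S x"
  have S: "\<forall>i. S (?f i) = fst (init \<eta> []) i" using Cons.prems[of 0] by simp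
  have "exec_within orc \<rho> (embed ?f Rewind p) (S, 0 + snd (init \<eta> [])) (m * 1) (?S, 0 + snd s)"
    using m(2) by (intro exec_embed[OF f _ _ _ S]) (simp_all add: exec_within_Rewind[unfolded One_nat_def])
  moreover have "snd (init \<eta> []) = 0" by (simp add: init_def)
  ultimately have 1: "exec_within orc \<rho> (embed ?f Rewind p) (S, 0) T (?S, snd s)"
    using m(1) exec_within_mono by fastforce
  \<comment> \<open>The embedded program touches block \<open>b\<close> only, so the blocks of the
    remaining programs are still in their initial state.\<close>
  have S2: "?S (prod_encode (c, j)) = (if c = b then fst s j else S (prod_encode (c, j)))" for c j
  proof (cases "c = b")
    case True
    then show ?thesis using inv_f_f[OF f, of j] by auto
  qed auto
  have "?S (prod_encode (Suc b + i, j)) = fst (init \<eta> []) j" if "i < length ps" for i j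
    using S2[of "Suc b + i" j] Cons.prems[of "Suc i" j] that by simp
  from Cons.IH[of ?S "Suc b" "snd s", OF this] obtain S' h' where
    2: "exec_within orc \<rho> (run_blocks (Suc b) ps) (?S, snd s) (length ps * (T + 1) + 1) (S', h')"
    and 3: "\<forall>i<length ps. S' (prod_encode (Suc b + i, 0)) = ys ! i"
    and 4: "\<forall>c j. c < Suc b \<or> Suc b + length ps \<le> c \<longrightarrow> S' (prod_encode (c, j)) = ?S (prod_encode (c, j))"
    by blast
  have "exec_within orc \<rho> (run_blocks b (p # ps)) (S, h) (length (p # ps) * (T + 1) + 1) (S', h')"
    unfolding run_blocks.simps
    by (rule exec_within_mono[OF exec_within_Seq[OF exec_within_Rewind exec_within_Seq[OF 1 2]]]) simp
  moreover have "S' (prod_encode (b + i, 0)) = (y # ys) ! i" if "i < length (p # ps)" for i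
  proof (cases i)
    case 0
    then show ?thesis using 4[rule_format, of b 0] S2[of b 0] m(3) by simp
  next
    case (Suc j)
    then show ?thesis using 3 that by auto
  qed
  moreover have "S' (prod_encode (c, j)) = S (prod_encode (c, j))"
    if "c < b \<or> b + length (p # ps) \<le> c" for c j
    using 4[rule_format, of c j] S2[of c j] that by auto
  ultimately show ?case by blast
qed

section \<open>Polynomial-time functions of an oracle and a tape\<close>

lemma poly_nat_mono: "x \<le> y \<Longrightarrow> poly q x \<le> poly q (y :: nat)"
  by (induction q) (auto intro!: add_mono mult_mono)

text \<open>Domination by a polynomial is closed under the operations that occur in time bounds, so
  the polynomial for a composed program follows from the shape of its bound.\<close>

definition poly_bounded :: "(nat \<Rightarrow> nat) \<Rightarrow> bool" where
  "poly_bounded f \<longleftrightarrow> (\<exists>q. \<forall>x. f x \<le> poly q x)"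

lemma poly_bounded_const: "poly_bounded (\<lambda>_. c)"
  unfolding poly_bounded_def by (rule exI[of _ "[:c:]"]) simp

lemma poly_bounded_id: "poly_bounded (\<lambda>x. x)"
  unfolding poly_bounded_def by (rule exI[of _ "[:0, 1:]"]) simp

lemma poly_bounded_add: "poly_bounded f \<Longrightarrow> poly_bounded g \<Longrightarrow> poly_bounded (\<lambda>x. f x + g x)"
  unfolding poly_bounded_def by (metis add_mono poly_add)

lemma poly_bounded_mult: "poly_bounded f \<Longrightarrow> poly_bounded g \<Longrightarrow> poly_bounded (\<lambda>x. f x * g x)"
  unfolding poly_bounded_def by (metis mult_le_mono poly_mult)

lemma poly_bounded_poly_comp: "poly_bounded f \<Longrightarrow> poly_bounded (\<lambda>x. poly q (f x))"
  unfolding poly_bounded_def by (metis poly_nat_mono poly_pcompose)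

lemmas poly_bounded_intros = poly_bounded_poly_comp poly_bounded_const poly_bounded_id
  poly_bounded_add poly_bounded_mult

text \<open>There are no arguments: whatever a game needs is sampled from the tape or obtained from
  the oracle. As in \<open>ptime_oracle_adversary\<close>, the oracle answers with \<eta> bits; the
  length of the answers enters the time of every program that processes them.\<close>

definition oracle_ptime :: "(nat \<Rightarrow> (bits \<Rightarrow> bits) \<Rightarrow> tape \<Rightarrow> bits) \<Rightarrow> bool" where
  "oracle_ptime F \<longleftrightarrow> (\<exists>p (q :: nat poly). \<forall>\<eta> orc \<rho>. (\<forall>x. length (orc x) = \<eta>) \<longrightarrow>
     (\<exists>m\<le>poly q \<eta>. runs orc \<rho> p \<eta> [] m (F \<eta> orc \<rho>)))"

lemma oracle_ptime_list:
  assumes "\<forall>F\<in>set Fs. oracle_ptime F"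
  shows "\<exists>ps (q :: nat poly). \<forall>\<eta> orc \<rho>. (\<forall>x. length (orc x) = \<eta>) \<longrightarrow>
    list_all2 (\<lambda>p y. \<exists>m\<le>poly q \<eta>. runs orc \<rho> p \<eta> [] m y) ps (map (\<lambda>F. F \<eta> orc \<rho>) Fs)"
  using assms
proof (induction Fs)
  case Nil
  show ?case by (rule exI[of _ "[]"]) simp
next
  case (Cons F Fs)
  have "\<forall>F\<in>set Fs. oracle_ptime F" using Cons.prems by simp
  from Cons.IH[OF this] obtain ps q where 1: "\<And>\<eta> orc \<rho>. (\<forall>x. length (orc x) = \<eta>) \<Longrightarrow>
    list_all2 (\<lambda>p y. \<exists>m\<le>poly q \<eta>. runs orc \<rho> p \<eta> [] m y) ps (map (\<lambda>F. F \<eta> orc \<rho>) Fs)"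
    by blast
  have "oracle_ptime F" using Cons.prems by simp
  then obtain p q' where 2: "\<And>\<eta> orc \<rho>. (\<forall>x. length (orc x) = \<eta>) \<Longrightarrow>
     \<exists>m\<le>poly q' \<eta>. runs orc \<rho> p \<eta> [] m (F \<eta> orc \<rho>)"
    unfolding oracle_ptime_def by blast
  show ?case
  proof (intro exI[of _ "p # ps"] exI[of _ "q + q'"] allI impI)
    fix \<eta> and orc :: "bits \<Rightarrow> bits" and \<rho>
    assume orc: "\<forall>x. length (orc x) = \<eta>"
    have "list_all2 (\<lambda>p y. \<exists>m\<le>poly (q + q') \<eta>. runs orc \<rho> p \<eta> [] m y) ps (map (\<lambda>F. F \<eta> orc \<rho>) Fs)"
      using 1[OF orc] by (rule list_all2_mono) (auto intro: trans_le_add1)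
    with 2[OF orc, of \<rho>]
    show "list_all2 (\<lambda>p y. \<exists>m\<le>poly (q + q') \<eta>. runs orc \<rho> p \<eta> [] m y) (p # ps)
      (map (\<lambda>F. F \<eta> orc \<rho>) (F # Fs))"
      by (auto intro: trans_le_add2)
  qed
qed

text \<open>The output of one program becomes an argument of the next, whose time is polynomial in
  the lengths of its arguments; this bound keeps the composed time polynomial in \<eta>.\<close>

lemma runs_length:
  assumes "runs orc \<rho> p \<eta> [] m y" "\<forall>x. length (orc x) = \<eta>"
  shows "length y \<le> \<eta> + m"
proof -
  from assms(1) obtain s where "exec orc \<rho> p (init \<eta> []) m s" "fst s 0 = y"
    by (auto simp: runs_def)
  with exec_length[OF this(1), of \<eta> 0] assms(2) show ?thesis by (simp add: init_def)
qed

definition shift :: "nat \<Rightarrow> tape \<Rightarrow> tape" where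
  "shift d \<rho> = (\<lambda>j. \<rho> (d + j))"

text \<open>Block \<open>0\<close> thus contains the actual register \<open>0\<close>, where \<eta>
  is given and the result is expected.\<close>

lemma prod_encode_0_0: "prod_encode (0, 0) = 0"
  by (simp add: prod_encode_def)

text \<open>Each subprogram runs in a private block of registers; the main program reads its
  arguments off the first registers of these blocks, so that nothing has to be copied or cleaned
  up.  The last block is used for moving to the shifted start of the tape.\<close>

lemma oracle_ptime_compose:
  fixes Q :: "nat poly"
  assumes Fs: "\<forall>F\<in>set Fs. oracle_ptime F"
    and q: "\<And>\<eta> orc \<rho>. (\<forall>x. length (orc x) = \<eta>) \<Longrightarrow>
      \<exists>m \<le> poly Q (input_size \<eta> (map (\<lambda>F. F \<eta> orc \<rho>) Fs)).
        runs orc (shift (N * \<eta>) \<rho>) q \<eta> (map (\<lambda>F. F \<eta> orc \<rho>) Fs) m (G \<eta> orc \<rho>)"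
  shows "oracle_ptime G"
proof -
  define n where "n = length Fs"
  from oracle_ptime_list[OF Fs] obtain ps q' where
    ps: "\<And>\<eta> orc \<rho>. (\<forall>x. length (orc x) = \<eta>) \<Longrightarrow>
      list_all2 (\<lambda>p y. \<exists>m\<le>poly q' \<eta>. runs orc \<rho> p \<eta> [] m y) ps (map (\<lambda>F. F \<eta> orc \<rho>) Fs)"
    by blast
  \<comment> \<open>The registers \<open>0\<close> of block \<open>0\<close> (main program), of the
    blocks \<open>1\<close> to \<open>n\<close> (subprograms) and of block \<open>n + 1\<close>
    (counter for \<open>goto\<close>). Each receives \<eta> in unary.\<close>
  define rs where "rs = map (\<lambda>b. prod_encode (b, 0)) [0..<n + 2]"
  define c where "c = prod_encode (Suc n, 0)"
  define t where "t = prod_encode (Suc n, 1)"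
  define w where "w = goto N c t (prod_encode (Suc n, 2))"
  \<comment> \<open>Argument \<open>i\<close> of the main program is the output register of block
    \<open>i\<close>. Its other registers lie in block \<open>0\<close>, so it does not see what the
    subprograms leave in theirs.\<close>
  define f where "f i = (if i = 0 then prod_encode (0, 0) else if i \<le> n then prod_encode (i, 0)
    else prod_encode (0, i))" for i
  define P where "P = Seq (distribute 0 t rs) (Seq (run_blocks 1 ps) (Seq w (embed f w q)))"
  define g where "g \<eta> = 3 + \<eta> * (2 * N + 7)" for \<eta>
  \<comment> \<open>The summands follow \<open>P\<close>: distribution, the subprograms, the initial
    \<open>goto\<close>, and the main program, slowed down by the factor \<open>g \<eta>\<close>
    because each of its rewinds is a \<open>goto\<close>. The argument of \<open>poly Q\<close>
    bounds the size of its input.\<close>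
  define T where "T \<eta> = 2 + \<eta> * (n + 8) + (n * (poly q' \<eta> + 1) + 1 +
    (g \<eta> + poly Q (\<eta> + n * (\<eta> + poly q' \<eta>)) * g \<eta>))" for \<eta>
  have inj: "inj f"
    by (auto simp: inj_def f_def split: if_splits)
  have outside: "prod_encode (Suc n, j) \<notin> range f" for j
    by (auto simp: f_def split: if_splits)
  have rs: "length rs = n + 2" "distinct rs" "set rs = {prod_encode (b, 0) |b. b < n + 2}"
    by (auto simp: rs_def distinct_map inj_on_def)
  have mem_rs: "prod_encode (b, j) \<in> set rs \<longleftrightarrow> b < n + 2 \<and> j = 0" for b j
    by (auto simp: rs(3))
  have eq_0: "prod_encode (b, j) = 0 \<longleftrightarrow> b = 0 \<and> j = 0" for b j
    using prod_encode_0_0 by (metis prod_encode_eq prod.inject)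
  have main: "\<exists>m\<le>T \<eta>. runs orc \<rho> P \<eta> [] m (G \<eta> orc \<rho>)" if orc: "\<forall>x. length (orc x) = \<eta>" for \<eta> orc \<rho>
  proof -
    define ys where "ys = map (\<lambda>F. F \<eta> orc \<rho>) Fs"
    define S1 where "S1 x = (if x \<in> set rs then replicate \<eta> True else fst (init \<eta> []) x)" for x
    have len: "length ys = n" "length ps = n"
      using list_all2_lengthD[OF ps[OF orc, of \<rho>]] by (simp_all add: ys_def n_def)
    have "t \<noteq> 0" "t \<notin> set rs" by (simp_all add: t_def eq_0 mem_rs)
    moreover have "0 \<in> set rs" using mem_rs[of 0 0] by (simp add: prod_encode_0_0)
    ultimately have 1: "exec_within orc \<rho> (distribute 0 t rs) (fst (init \<eta> []), 0) (2 + \<eta> * (n + 8)) (S1, 0)"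
      using exec_distribute[of "fst (init \<eta> [])" 0 \<eta> rs t orc \<rho> 0] rs(1,2)
      by (simp add: init_def S1_def[abs_def] ac_simps)
    have S1: "S1 (prod_encode (1 + i, j)) = fst (init \<eta> []) j" if "i < length ps" for i j
      using that len by (auto simp: S1_def mem_rs init_def eq_0)
    from exec_run_blocks[OF ps[OF orc, of \<rho>, folded ys_def], of S1 1 0, OF S1, unfolded len]
    obtain S2 h where
      2: "exec_within orc \<rho> (run_blocks 1 ps) (S1, 0) (n * (poly q' \<eta> + 1) + 1) (S2, h)"
      and args: "\<forall>i<n. S2 (prod_encode (1 + i, 0)) = ys ! i"
      and rest: "\<forall>b j. b < 1 \<or> 1 + n \<le> b \<longrightarrow> S2 (prod_encode (b, j)) = S1 (prod_encode (b, j))"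
      by blast
    have S2: "S2 (prod_encode (1 + i, 0)) = ys ! i" if "i < n" for i
      using args that by blast
    have S2': "S2 (prod_encode (b, j)) = S1 (prod_encode (b, j))" if "b = 0 \<or> n < b" for b j
      using rest that by auto
    have c: "S2 c = replicate \<eta> True" and t: "S2 t = []"
      by (simp_all add: c_def t_def S2' S1_def mem_rs init_def eq_0)
    have ct: "c \<noteq> t" by (simp add: c_def t_def)
    have 3: "exec_within orc \<rho> w (S, h) (g \<eta>) (S, N * \<eta>)"
      if "\<forall>x. x \<notin> range f \<longrightarrow> S x = S2 x" for S h
      unfolding w_def g_def using that c t outside ct
      by (intro exec_goto) (simp_all add: c_def t_def)
    from q[OF orc, of \<rho>] obtain m s where m: "m \<le> poly Q (input_size \<eta> ys)"
      and s: "exec orc (shift (N * \<eta>) \<rho>) q (init \<eta> ys) m s" "fst s 0 = G \<eta> orc \<rho>"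
      unfolding ys_def runs_def by blast
    have f: "\<forall>i. S2 (f i) = fst (init \<eta> ys) i"
    proof
      fix i
      show "S2 (f i) = fst (init \<eta> ys) i"
        using S2[of "i - 1"] len(1) by (auto simp: f_def S2' S1_def mem_rs init_def eq_0)
    qed
    let ?S = "\<lambda>x. if x \<in> range f then fst s (inv f x) else S2 x"
    have "exec_within orc \<rho> (embed f w q) (S2, N * \<eta> + snd (init \<eta> ys)) (m * g \<eta>) (?S, N * \<eta> + snd s)"
      by (rule exec_embed[OF inj _ 3 s(1)[unfolded shift_def] f]) (simp_all add: g_def)
    then have 4: "exec_within orc \<rho> (embed f w q) (S2, N * \<eta>) (m * g \<eta>) (?S, N * \<eta> + snd s)"
      by (simp add: init_def)
    have "length y \<le> \<eta> + poly q' \<eta>" if "y \<in> set ys" for y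
    proof -
      from that obtain i where "i < n" "y = ys ! i" by (auto simp: in_set_conv_nth len)
      with list_all2_nthD2[OF ps[OF orc, of \<rho>], of i] len
      obtain m where "m \<le> poly q' \<eta>" "runs orc \<rho> (ps ! i) \<eta> [] m y"
        by (auto simp: ys_def)
      with runs_length[OF this(2) orc] show ?thesis by simp
    qed
    then have "sum_list (map length ys) \<le> sum_list (map (\<lambda>_. \<eta> + poly q' \<eta>) ys)"
      by (rule sum_list_mono)
    also have "\<dots> = n * (\<eta> + poly q' \<eta>)" by (simp add: sum_list_triv len)
    finally have "input_size \<eta> ys \<le> \<eta> + n * (\<eta> + poly q' \<eta>)" by (simp add: input_size_def)
    from order_trans[OF m poly_nat_mono[OF this]]
    have "m \<le> poly Q (\<eta> + n * (\<eta> + poly q' \<eta>))" .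
    then have "m * g \<eta> \<le> poly Q (\<eta> + n * (\<eta> + poly q' \<eta>)) * g \<eta>" by simp
    from exec_within_Seq[OF 1 exec_within_Seq[OF 2 exec_within_Seq[OF 3 exec_within_mono[OF 4 this]]]]
    have "exec_within orc \<rho> P (fst (init \<eta> []), 0) (T \<eta>) (?S, N * \<eta> + snd s)"
      by (simp add: P_def T_def)
    moreover have "?S 0 = fst s 0"
      using inv_f_f[OF inj, of 0] rangeI[of f 0] by (simp add: f_def prod_encode_0_0)
    ultimately show ?thesis
      unfolding exec_within_def runs_def using s(2) by (fastforce simp: init_def)
  qed
  have "poly_bounded T"
    unfolding T_def[abs_def] g_def[abs_def] by (intro poly_bounded_intros)
  then obtain qT where qT: "\<And>\<eta>. T \<eta> \<le> poly qT \<eta>" by (auto simp: poly_bounded_def)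
  show ?thesis
    unfolding oracle_ptime_def
  proof (intro exI[of _ P] exI[of _ qT] allI impI)
    fix \<eta> and orc :: "bits \<Rightarrow> bits" and \<rho>
    assume "\<forall>x. length (orc x) = \<eta>"
    from main[OF this, of \<rho>] qT[of \<eta>] show "\<exists>m\<le>poly qT \<eta>. runs orc \<rho> P \<eta> [] m (G \<eta> orc \<rho>)"
      using le_trans by blast
  qed
qed

section \<open>Programs for the built-in operations\<close>

text \<open>All operations with a fixed interpretation run in linear time, so a single constant
  \<open>c\<close> describes their bound.\<close>

lemma ptime_funI:
  assumes "oracle_free p" "tape_free p"
    and "\<And>\<eta> xs. xs \<in> D \<eta> \<Longrightarrow> \<exists>S h. exec_within no_oracle no_tape p (fst (init \<eta> xs), 0)
      (c * input_size \<eta> xs + c) (S, h) \<and> S 0 = f \<eta> xs"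
  shows "ptime_fun D f"
  unfolding ptime_fun_def
proof (intro exI[of _ p] exI[of _ "[:c, c:]"] conjI allI ballI assms)
  fix \<eta> xs assume "xs \<in> D \<eta>"
  from assms(3)[OF this] obtain S h m where
    "m \<le> c * input_size \<eta> xs + c" "exec no_oracle no_tape p (fst (init \<eta> xs), 0) m (S, h)" "S 0 = f \<eta> xs"
    unfolding exec_within_def by blast
  then show "\<exists>m\<le>poly [:c, c:] (input_size \<eta> xs). runs no_oracle no_tape p \<eta> xs m (f \<eta> xs)"
    unfolding runs_def by (intro exI[of _ m]) (auto simp: init_def mult.commute intro!: exI[of _ "(S, h)"])
qed

lemma init_simps:
  "fst (init \<eta> xs) 0 = replicate \<eta> True"
  "fst (init \<eta> xs) (Suc i) = (if i < length xs then xs ! i else [])"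
  by (simp_all add: init_def)

lemma ptime_fun_bool: "ptime_fun (\<lambda>_. {[]}) (\<lambda>_ _. [b])"
proof (rule ptime_funI[where p = "Seq (clear 0) (Push 0 b)" and c = 2])
  fix \<eta> :: nat and xs :: "bits list"
  show "\<exists>S h. exec_within no_oracle no_tape (Seq (clear 0) (Push 0 b)) (fst (init \<eta> xs), 0)
      (2 * input_size \<eta> xs + 2) (S, h) \<and> S 0 = [b]"
    by (intro exI conjI, rule exec_within_mono, rule exec_within_Seq[OF exec_clear exec_within_Push])
      (auto simp: init_simps input_size_def)
qed (simp_all add: clear_def)

lemma ptime_fun_zero: "ptime_fun (\<lambda>_. {[]}) (\<lambda>\<eta> _. replicate \<eta> False)"
proof (rule ptime_funI[where p = "Seq (While 0 (Seq (Pop 0) (Push 1 False))) (move_rev 1 0)" and c = 7])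
  fix \<eta> :: nat and xs :: "bits list" assume xs: "xs \<in> {[]}"
  let ?S = "fst (init \<eta> xs)"
  let ?s = "\<lambda>i. (?S(0 := replicate (\<eta> - i) True, 1 := replicate i False), 0)"
  have "exec_within no_oracle no_tape (While 0 (Seq (Pop 0) (Push 1 False))) (?s 0) (\<eta> * Suc (1 + 1) + 1) (?s \<eta>)"
  proof (rule exec_within_loop)
    fix i assume i: "i < \<eta>"
    have "exec_within no_oracle no_tape (Seq (Pop 0) (Push 1 False)) (?s i) (1 + 1) (?s (Suc i))"
      by (rule exec_within_cong, rule exec_within_Seq[OF exec_within_Pop exec_within_Push])
        (use i in \<open>auto simp: fun_eq_iff simp flip: replicate_Suc\<close>)
    then show "fst (?s i) 0 \<noteq> [] \<and>
        exec_within no_oracle no_tape (Seq (Pop 0) (Push 1 False)) (?s i) (1 + 1) (?s (Suc i))"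
      using i by simp
  qed simp
  moreover have eq: "?s 0 = (?S, 0)" using xs by (auto simp: fun_eq_iff init_def)
  ultimately have "exec_within no_oracle no_tape (While 0 (Seq (Pop 0) (Push 1 False))) (?S, 0)
      (\<eta> * Suc (1 + 1) + 1) (?s \<eta>)" unfolding eq by blast
  from exec_within_Seq[OF this exec_move_rev]
  have "exec_within no_oracle no_tape (Seq (While 0 (Seq (Pop 0) (Push 1 False))) (move_rev 1 0)) (?S, 0)
    (7 * input_size \<eta> xs + 7) ((fst (?s \<eta>))(1 := [], 0 := replicate \<eta> False), 0)"
    by (rule exec_within_cong) (auto simp: input_size_def fun_eq_iff)
  then show "\<exists>S h. exec_within no_oracle no_tape
      (Seq (While 0 (Seq (Pop 0) (Push 1 False))) (move_rev 1 0)) (fst (init \<eta> xs), 0)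
      (7 * input_size \<eta> xs + 7) (S, h) \<and> S 0 = replicate \<eta> False"
    by (intro exI conjI, assumption) simp
qed (simp_all add: move_rev_def)

lemma exec_within_Case:
  assumes "\<And>w. S r = [] \<Longrightarrow> exec_within orc \<rho> p (S, h) T s"
    and "\<And>w. S r = False # w \<Longrightarrow> exec_within orc \<rho> q (S, h) T s"
    and "\<And>w. S r = True # w \<Longrightarrow> exec_within orc \<rho> q' (S, h) T s"
  shows "exec_within orc \<rho> (Case r p q q') (S, h) (Suc T) s"
proof (cases "S r")
  case Nil
  then show ?thesis by (rule exec_within_Case_Empty) (rule assms(1)[OF Nil])
next
  case (Cons b w)
  show ?thesis
  proof (cases b)
    case True
    with Cons show ?thesis by (auto intro: exec_within_Case_True assms(3))
  next
    case False
    with Cons show ?thesis by (auto intro: exec_within_Case_False assms(2))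
  qed
qed

text \<open>When stack \<open>2\<close> runs out first, nothing is pushed, which matches the
  truncation done by \<open>map2\<close>. The bits arrive on stack \<open>3\<close> in reverse
  order.\<close>

definition xor_body :: prog where
  "xor_body = Seq (Case 1 Skip
      (Case 2 Skip (Push 3 False) (Push 3 True))
      (Case 2 Skip (Push 3 True) (Push 3 False))) (Seq (Pop 1) (Pop 2))"

lemma exec_xor_loop:
  "exec_within orc \<rho> (While 1 xor_body) (S, h) (6 * length (S 1) + 1)
    (S(1 := [], 2 := drop (length (S 1)) (S 2), 3 := rev (map2 (\<noteq>) (S 1) (S 2)) @ S 3), h)"
proof (induction "S 1" arbitrary: S)
  case Nil
  show ?case
    by (rule exec_within_cong[OF exec_within_While_Stop]) (use Nil in \<open>auto simp: fun_eq_iff\<close>)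
next
  case (Cons b w)
  let ?S1 = "S(3 := (case S 2 of [] \<Rightarrow> S 3 | c # _ \<Rightarrow> (b \<noteq> c) # S 3))"
  let ?S = "?S1(1 := w, 2 := tl (S 2))"
  have S1: "S (Suc 0) = b # w" "S 1 = b # w" using Cons.hyps(2) by simp_all
  have "exec_within orc \<rho> (Case 1 Skip
      (Case 2 Skip (Push 3 False) (Push 3 True))
      (Case 2 Skip (Push 3 True) (Push 3 False))) (S, h) (Suc (Suc 1)) (?S1, h)"
    by (intro exec_within_Case; rule exec_within_cong, rule exec_within_Skip exec_within_Push)
      (use S1 in \<open>auto simp: fun_eq_iff\<close>)
  from exec_within_Seq[OF this exec_within_Seq[OF exec_within_Pop exec_within_Pop]]
  have 1: "exec_within orc \<rho> xor_body (S, h) 5 (?S, h)"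
    unfolding xor_body_def by (rule exec_within_cong) (use S1 in \<open>auto simp: fun_eq_iff\<close>)
  have "w = ?S 1" by simp
  from Cons.hyps(1)[of ?S, OF this]
  have "exec_within orc \<rho> (While 1 xor_body) (?S, h) (6 * length w + 1)
    (S(1 := [], 2 := drop (length (S 1)) (S 2), 3 := rev (map2 (\<noteq>) (S 1) (S 2)) @ S 3), h)"
    by (rule exec_within_cong)
      (use S1 in \<open>auto simp: fun_eq_iff drop_Suc split: list.splits\<close>)
  from exec_within_While_Step[OF _ 1 this] show ?case
    using S1 by simp
qed

lemma ptime_fun_xor:
  "ptime_fun (\<lambda>_. {xs. length xs = 2}) (\<lambda>_ xs. map2 (\<noteq>) (xs ! 0) (xs ! 1))"
proof (rule ptime_funI[where p = "Seq (clear 0) (Seq (While 1 xor_body) (move_rev 3 0))" and c = 12])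
  fix \<eta> :: nat and xs :: "bits list" assume "xs \<in> {xs. length xs = 2}"
  then obtain x y where xs: "xs = [x, y]" by (auto simp: numeral_2_eq_2 length_Suc_conv)
  let ?S = "fst (init \<eta> xs)"
  have S: "?S 0 = replicate \<eta> True" "?S 1 = x" "?S (Suc 0) = x" "?S 2 = y" "?S 3 = []"
    using xs by (simp_all add: init_def)
  have len: "length (map2 (\<noteq>) x y) \<le> length x" by simp
  show "\<exists>S h. exec_within no_oracle no_tape (Seq (clear 0) (Seq (While 1 xor_body) (move_rev 3 0)))
      (?S, 0) (12 * input_size \<eta> xs + 12) (S, h) \<and> S 0 = map2 (\<noteq>) (xs ! 0) (xs ! 1)"
    by (intro exI conjI, rule exec_within_mono,
        rule exec_within_Seq[OF exec_clear exec_within_Seq[OF exec_xor_loop exec_move_rev]])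
      (use S len in \<open>auto simp: input_size_def xs\<close>)
qed (simp_all add: clear_def xor_body_def move_rev_def)

definition set_false :: prog where
  "set_false = Seq (Pop 0) (Push 0 False)"

lemma exec_set_false:
  "exec_within orc \<rho> set_false (S, h) 2 (S(0 := False # tl (S 0)), h)"
  unfolding set_false_def
  by (rule exec_within_cong, rule exec_within_Seq[OF exec_within_Pop exec_within_Push]) auto

text \<open>Register \<open>0\<close> holds the verdict so far; it turns false on a mismatch or when
  stack \<open>2\<close> is exhausted before stack \<open>1\<close>.\<close>

definition eq_body :: prog where
  "eq_body = Seq (Case 1 Skip (Case 2 set_false Skip set_false) (Case 2 set_false set_false Skip))
    (Seq (Pop 1) (Pop 2))"

text \<open>The loop looks at only as many bits as stack \<open>1\<close> has. What then remains on
  stack \<open>2\<close> is left for the caller to test.\<close>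

lemma exec_eq_loop:
  assumes "S 0 = [b]"
  shows "exec_within orc \<rho> (While 1 eq_body) (S, h) (7 * length (S 1) + 1)
    (S(1 := [], 2 := drop (length (S 1)) (S 2), 0 := [b \<and> S 1 = take (length (S 1)) (S 2)]), h)"
  using assms
proof (induction "S 1" arbitrary: S b)
  case Nil
  show ?case
    by (rule exec_within_cong[OF exec_within_While_Stop]) (use Nil in \<open>auto simp: fun_eq_iff\<close>)
next
  case (Cons c w)
  let ?b = "b \<and> S 2 \<noteq> [] \<and> hd (S 2) = c"
  let ?S1 = "S(0 := [?b])"
  let ?S = "?S1(1 := w, 2 := tl (S 2))"
  have S1: "S (Suc 0) = c # w" "S 1 = c # w" using Cons.hyps(2) by simp_all
  have "exec_within orc \<rho> (Case 1 Skip (Case 2 set_false Skip set_false) (Case 2 set_false set_false Skip))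
      (S, h) (Suc (Suc 2)) (?S1, h)"
    by (intro exec_within_Case; rule exec_within_cong, rule exec_within_Skip exec_set_false)
      (use S1 Cons.prems in \<open>auto simp: fun_eq_iff\<close>)
  from exec_within_Seq[OF this exec_within_Seq[OF exec_within_Pop exec_within_Pop]]
  have 1: "exec_within orc \<rho> eq_body (S, h) 6 (?S, h)"
    unfolding eq_body_def by (rule exec_within_cong) (use S1 in \<open>auto simp: fun_eq_iff\<close>)
  have w: "w = ?S 1" "?S 0 = [?b]" by simp_all
  from Cons.hyps(1)[of ?S, OF w]
  have "exec_within orc \<rho> (While 1 eq_body) (?S, h) (7 * length w + 1)
    (S(1 := [], 2 := drop (length (S 1)) (S 2), 0 := [b \<and> S 1 = take (length (S 1)) (S 2)]), h)"
    by (rule exec_within_cong, use S1 in \<open>cases "S 2"; auto simp: fun_eq_iff drop_Suc\<close>) simp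
  from exec_within_While_Step[OF _ 1 this] show ?case
    using S1 by simp
qed

lemma ptime_fun_eq: "ptime_fun (\<lambda>_. {xs. length xs = 2}) (\<lambda>_ xs. [xs ! 0 = xs ! 1])"
proof (rule ptime_funI[where c = 12
      and p = "Seq (clear 0) (Seq (Push 0 True) (Seq (While 1 eq_body) (Case 2 Skip set_false set_false)))"])
  fix \<eta> :: nat and xs :: "bits list" assume "xs \<in> {xs. length xs = 2}"
  then obtain x y where xs: "xs = [x, y]" by (auto simp: numeral_2_eq_2 length_Suc_conv)
  let ?S = "fst (init \<eta> xs)"
  have S: "?S 0 = replicate \<eta> True" "?S 1 = x" "?S (Suc 0) = x" "?S 2 = y"
    using xs by (simp_all add: init_def)
  have final: "exec_within no_oracle no_tape (Case 2 Skip set_false set_false) (R, 0) (Suc 2)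
    (R(0 := [b \<and> R 2 = []]), 0)" if "R 0 = [b]" for R b
    by (intro exec_within_Case; rule exec_within_cong, rule exec_within_Skip exec_set_false)
      (use that in \<open>auto simp: fun_eq_iff\<close>)
  \<comment> \<open>The loop decides whether \<open>x\<close> is a prefix of \<open>y\<close>, and
    the final \<open>Case\<close> whether nothing of \<open>y\<close> is left.\<close>
  have eq: "x = y \<longleftrightarrow> x = take (length x) y \<and> drop (length x) y = []"
    by (metis append_Nil2 append_take_drop_id drop_all order_refl take_all)
  show "\<exists>S h. exec_within no_oracle no_tape
      (Seq (clear 0) (Seq (Push 0 True) (Seq (While 1 eq_body) (Case 2 Skip set_false set_false))))
      (?S, 0) (12 * input_size \<eta> xs + 12) (S, h) \<and> S 0 = [xs ! 0 = xs ! 1]"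
    by (intro exI conjI, rule exec_within_mono,
        rule exec_within_Seq[OF exec_clear exec_within_Seq[OF exec_within_Push
          exec_within_Seq[OF exec_eq_loop[where b = True] final]]])
      (use S eq in \<open>auto simp: input_size_def xs\<close>)
qed (simp_all add: clear_def eq_body_def set_false_def)

text \<open>Two reversing moves through the scratch stack \<open>4\<close> restore the order of the
  bits.\<close>

definition copy_result :: "nat \<Rightarrow> prog" where
  "copy_result r = Seq (clear 0) (Seq (move_rev r 4) (move_rev 4 0))"

lemma exec_copy_result:
  assumes "S 4 = []" "r \<noteq> 0" "r \<noteq> 4"
  shows "exec_within orc \<rho> (copy_result r) (S, h) (2 * length (S 0) + 8 * length (S r) + 3)
    (S(0 := S r, r := []), h)"
  unfolding copy_result_def
  by (rule exec_within_cong,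
      rule exec_within_Seq[OF exec_clear exec_within_Seq[OF exec_move_rev exec_move_rev]])
    (use assms in \<open>auto simp: fun_eq_iff\<close>)

text \<open>The condition is met only by the exact string \<open>[True]\<close>: the top bit has to
  be \<open>True\<close>, and nothing may remain after popping it. Every other string selects the
  else branch, as in \<open>interp\<close>.\<close>

lemma ptime_fun_ite:
  "ptime_fun (\<lambda>_. {xs. length xs = 3}) (\<lambda>_ xs. if xs ! 0 = [True] then xs ! 1 else xs ! 2)"
proof (rule ptime_funI[where c = 20 and p = "Case 1 (copy_result 3) (copy_result 3)
      (Seq (Pop 1) (Case 1 (copy_result 2) (copy_result 3) (copy_result 3)))"])
  fix \<eta> :: nat and xs :: "bits list" assume "xs \<in> {xs. length xs = 3}"
  then obtain x y z where xs: "xs = [x, y, z]" by (auto simp: numeral_3_eq_3 length_Suc_conv)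
  let ?S = "fst (init \<eta> xs)"
  have S: "?S 0 = replicate \<eta> True" "?S 1 = x" "?S (Suc 0) = x" "?S 2 = y" "?S 3 = z" "?S 4 = []"
    using xs by (simp_all add: init_def)
  let ?T = "2 * \<eta> + 8 * length y + 8 * length z + 3"
  have 2: "exec_within no_oracle no_tape (copy_result 2) (?S(1 := w), 0) ?T ((?S(1 := w))(0 := y, 2 := []), 0)"
    and 3: "exec_within no_oracle no_tape (copy_result 3) (?S(1 := w), 0) ?T ((?S(1 := w))(0 := z, 3 := []), 0)" for w
    using S by (auto intro!: exec_within_cong[OF exec_copy_result])
  have els: "exec_within no_oracle no_tape (copy_result 3) (?S, 0) ?T (?S(0 := z, 3 := []), 0)"
    using 3[of "?S 1"] by simp
  let ?p = "Seq (Pop 1) (Case 1 (copy_result 2) (copy_result 3) (copy_result 3))"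
  have "exec_within no_oracle no_tape (Case 1 (copy_result 2) (copy_result 3) (copy_result 3)) (?S(1 := w), 0)
      (Suc ?T) (if w = [] then (?S(1 := w))(0 := y, 2 := []) else (?S(1 := w))(0 := z, 3 := []), 0)" for w
    by (intro exec_within_Case) (use 2[of w] 3[of w] in auto)
  from exec_within_Seq[OF exec_within_Pop this[of "tl (?S 1)"]]
  have p: "exec_within no_oracle no_tape ?p (?S, 0) (1 + Suc ?T)
      (if tl x = [] then (?S(1 := tl x))(0 := y, 2 := []) else (?S(1 := tl x))(0 := z, 3 := []), 0)"
    by (simp only: S(2))
  have "\<exists>S. exec_within no_oracle no_tape (Case 1 (copy_result 3) (copy_result 3) ?p) (?S, 0)
      (Suc (1 + Suc ?T)) (S, 0) \<and> S 0 = (if x = [True] then y else z)"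
    by (rule exI[of _ "if x = [True] then (?S(1 := tl x))(0 := y, 2 := [])
          else if x \<noteq> [] \<and> hd x then (?S(1 := tl x))(0 := z, 3 := []) else ?S(0 := z, 3 := [])"],
        rule conjI, intro exec_within_Case)
      (use p els S in \<open>auto elim: exec_within_mono\<close>)
  then obtain S where S: "S 0 = (if x = [True] then y else z)"
    and e: "exec_within no_oracle no_tape (Case 1 (copy_result 3) (copy_result 3) ?p) (?S, 0)
      (Suc (1 + Suc ?T)) (S, 0)"
    by blast
  show "\<exists>S h. exec_within no_oracle no_tape (Case 1 (copy_result 3) (copy_result 3) ?p)
      (?S, 0) (20 * input_size \<eta> xs + 20) (S, h) \<and> S 0 = (if xs ! 0 = [True] then xs ! 1 else xs ! 2)"
    by (intro exI[of _ S] exI[of _ 0] conjI exec_within_mono[OF e]) (auto simp: S xs input_size_def)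
qed (simp_all add: copy_result_def clear_def move_rev_def)

section \<open>Terms evaluated with an oracle\<close>

text \<open>Blocks are reversed because a block read from the tape is pushed bit by bit.\<close>

definition slot :: "nat \<Rightarrow> nat \<Rightarrow> tape \<Rightarrow> bits" where
  "slot i \<eta> \<rho> = rev (map (\<lambda>j. \<rho> (i * \<eta> + j)) [0..<\<eta>])"

lemma length_slot [simp]: "length (slot i \<eta> \<rho>) = \<eta>"
  by (simp add: slot_def)

text \<open>The unary \<eta> moves to register \<open>1\<close> as a loop counter, which empties
  register \<open>0\<close> for the block. Starting at cell \<open>i * \<eta>\<close> is left to
  \<open>oracle_ptime_compose\<close>, used with no subprograms and with
  \<open>N = i\<close>.\<close>

lemma oracle_ptime_slot: "oracle_ptime (\<lambda>\<eta> orc \<rho>. slot i \<eta> \<rho>)"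
proof (rule oracle_ptime_compose[where Fs = "[]" and N = i and Q = "[:7, 7:]"
      and q = "Seq (move_rev 0 1) (While 1 (Seq (Pop 1) (Read 0)))"])
  fix \<eta> and orc :: "bits \<Rightarrow> bits" and \<rho> :: tape
  let ?R = "fst (init \<eta> [])"
  let ?\<rho> = "shift (i * \<eta>) \<rho>"
  let ?s = "\<lambda>j. (?R(0 := rev (map ?\<rho> [0..<j]), 1 := replicate (\<eta> - j) True), j)"
  have "exec_within orc ?\<rho> (While 1 (Seq (Pop 1) (Read 0))) (?s 0) (\<eta> * Suc (1 + 1) + 1) (?s \<eta>)"
  proof (rule exec_within_loop)
    fix j assume j: "j < \<eta>"
    have "exec_within orc ?\<rho> (Seq (Pop 1) (Read 0)) (?s j) (1 + 1) (?s (Suc j))"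
      by (rule exec_within_cong, rule exec_within_Seq[OF exec_within_Pop exec_within_Read])
        (use j in \<open>auto simp: fun_eq_iff\<close>)
    then show "fst (?s j) 1 \<noteq> [] \<and> exec_within orc ?\<rho> (Seq (Pop 1) (Read 0)) (?s j) (1 + 1) (?s (Suc j))"
      using j by simp
  qed simp
  moreover have "exec_within orc ?\<rho> (move_rev 0 1) (?R, 0) (4 * \<eta> + 1) (?s 0)"
    by (rule exec_within_cong, rule exec_move_rev) (auto simp: init_def fun_eq_iff)
  ultimately have "exec_within orc ?\<rho> (Seq (move_rev 0 1) (While 1 (Seq (Pop 1) (Read 0)))) (?R, 0)
    (4 * \<eta> + 1 + (\<eta> * Suc (1 + 1) + 1)) (?s \<eta>)"
    by (intro exec_within_Seq)
  then have "exec_within orc ?\<rho> (Seq (move_rev 0 1) (While 1 (Seq (Pop 1) (Read 0)))) (?R, 0)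
    (poly [:7, 7:] (input_size \<eta> [])) (?s \<eta>)"
    by (rule exec_within_mono) (simp add: input_size_def)
  moreover have init: "(?R, 0) = init \<eta> []" by (simp add: init_def)
  moreover have "fst (?s \<eta>) 0 = slot i \<eta> \<rho>"
    by (simp add: slot_def shift_def)
  ultimately show "\<exists>m\<le>poly [:7, 7:] (input_size \<eta> (map (\<lambda>F. F \<eta> orc \<rho>) [])).
     runs orc ?\<rho> (Seq (move_rev 0 1) (While 1 (Seq (Pop 1) (Read 0)))) \<eta>
       (map (\<lambda>F. F \<eta> orc \<rho>) []) m (slot i \<eta> \<rho>)"
    unfolding runs_def exec_within_def list.map init by blast
qed simp

lemma oracle_ptime_ptime_fun:
  assumes "ptime_fun D f" "\<forall>F\<in>set Fs. oracle_ptime F"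
    and "\<And>\<eta> orc \<rho>. (\<forall>x. length (orc x) = \<eta>) \<Longrightarrow> map (\<lambda>F. F \<eta> orc \<rho>) Fs \<in> D \<eta>"
  shows "oracle_ptime (\<lambda>\<eta> orc \<rho>. f \<eta> (map (\<lambda>F. F \<eta> orc \<rho>) Fs))"
proof -
  from assms(1) obtain p q where p: "oracle_free p" "tape_free p"
    and q: "\<And>\<eta> xs. xs \<in> D \<eta> \<Longrightarrow> \<exists>m \<le> poly q (input_size \<eta> xs). runs no_oracle no_tape p \<eta> xs m (f \<eta> xs)"
    unfolding ptime_fun_def by blast
  show ?thesis
  proof (rule oracle_ptime_compose[where Q = q and q = p and N = 0, OF assms(2)])
    fix \<eta> and orc :: "bits \<Rightarrow> bits" and \<rho> :: tape assume orc: "\<forall>x. length (orc x) = \<eta>"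
    show "\<exists>m\<le>poly q (input_size \<eta> (map (\<lambda>F. F \<eta> orc \<rho>) Fs)).
      runs orc (shift (0 * \<eta>) \<rho>) p \<eta> (map (\<lambda>F. F \<eta> orc \<rho>) Fs) m (f \<eta> (map (\<lambda>F. F \<eta> orc \<rho>) Fs))"
      using q[OF assms(3)[OF orc, of \<rho>]] runs_oracle_free[OF _ p(1)] runs_tape_free[OF _ p(2)] by blast
  qed
qed

text \<open>The tape is passed on only from cell \<open>N * \<eta>\<close>: the cells before it hold
  the sampled names, which an attacker function must not read.\<close>

lemma oracle_ptime_tape_fun:
  assumes "ptime_tape_fun D f" "\<forall>F\<in>set Fs. oracle_ptime F"
    and "\<And>\<eta> orc \<rho>. (\<forall>x. length (orc x) = \<eta>) \<Longrightarrow> map (\<lambda>F. F \<eta> orc \<rho>) Fs \<in> D \<eta>"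
  shows "oracle_ptime (\<lambda>\<eta> orc \<rho>. f \<eta> (map (\<lambda>F. F \<eta> orc \<rho>) Fs) (shift (N * \<eta>) \<rho>))"
proof -
  from assms(1) obtain p q where p: "oracle_free p"
    and q: "\<And>\<eta> \<rho> xs. xs \<in> D \<eta> \<Longrightarrow> \<exists>m \<le> poly q (input_size \<eta> xs). runs no_oracle \<rho> p \<eta> xs m (f \<eta> xs \<rho>)"
    unfolding ptime_tape_fun_def by blast
  show ?thesis
  proof (rule oracle_ptime_compose[where Q = q and q = p and N = N, OF assms(2)])
    fix \<eta> and orc :: "bits \<Rightarrow> bits" and \<rho> :: tape assume orc: "\<forall>x. length (orc x) = \<eta>"
    show "\<exists>m\<le>poly q (input_size \<eta> (map (\<lambda>F. F \<eta> orc \<rho>) Fs)).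
      runs orc (shift (N * \<eta>) \<rho>) p \<eta> (map (\<lambda>F. F \<eta> orc \<rho>) Fs) m
        (f \<eta> (map (\<lambda>F. F \<eta> orc \<rho>) Fs) (shift (N * \<eta>) \<rho>))"
      using q[OF assms(3)[OF orc, of \<rho>]] runs_oracle_free[OF _ p(1)] by blast
  qed
qed

lemma oracle_ptime_query:
  assumes "oracle_ptime F"
  shows "oracle_ptime (\<lambda>\<eta> orc \<rho>. orc (F \<eta> orc \<rho>))"
proof (rule oracle_ptime_compose[where Fs = "[F]" and N = 0 and Q = "[:1:]" and q = "Query 1 0"])
  fix \<eta> and orc :: "bits \<Rightarrow> bits" and \<rho> :: tape
  have "exec orc (shift (0 * \<eta>) \<rho>) (Query 1 0) (fst (init \<eta> [F \<eta> orc \<rho>]), 0) 1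
    ((fst (init \<eta> [F \<eta> orc \<rho>]))(0 := orc (fst (init \<eta> [F \<eta> orc \<rho>]) 1)), 0)"
    by (rule exec.Query)
  moreover have "(fst (init \<eta> [F \<eta> orc \<rho>]), 0) = init \<eta> [F \<eta> orc \<rho>]" by (simp add: init_def)
  moreover have "fst (init \<eta> [F \<eta> orc \<rho>]) 1 = F \<eta> orc \<rho>" by (simp add: init_def)
  ultimately have "runs orc (shift (0 * \<eta>) \<rho>) (Query 1 0) \<eta> [F \<eta> orc \<rho>] 1 (orc (F \<eta> orc \<rho>))"
    unfolding runs_def by (metis fst_conv fun_upd_same)
  then show "\<exists>m\<le>poly [:1:] (input_size \<eta> (map (\<lambda>F. F \<eta> orc \<rho>) [F])).
    runs orc (shift (0 * \<eta>) \<rho>) (Query 1 0) \<eta> (map (\<lambda>F. F \<eta> orc \<rho>) [F]) m (orc (F \<eta> orc \<rho>))"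
    by (intro exI[of _ 1]) simp
qed (use assms in simp)

text \<open>A whole game becomes one oracle attacker, which computes the messages and then runs
  \<open>p\<close> on them with the tape after the name slots.\<close>

lemma ptime_oracle_adversary_compose:
  assumes p: "ptime_adversary (length Fs) p" and Fs: "\<forall>F\<in>set Fs. oracle_ptime F"
  shows "\<exists>P. ptime_oracle_adversary P \<and> (\<forall>\<eta> orc \<rho>. (\<forall>x. length (orc x) = \<eta>) \<longrightarrow>
    (accepts orc \<rho> P \<eta> [] \<longleftrightarrow>
     accepts no_oracle (shift (N * \<eta>) \<rho>) p \<eta> (map (\<lambda>F. F \<eta> orc \<rho>) Fs)))"
proof -
  from p have free: "oracle_free p"
    and "\<exists>q :: nat poly. \<forall>\<eta> \<rho> xs. length xs = length Fs \<longrightarrow>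
      (\<exists>m \<le> poly q (input_size \<eta> xs). \<exists>y. runs no_oracle \<rho> p \<eta> xs m y)"
    unfolding ptime_adversary_def by simp_all
  from this(2) obtain q :: "nat poly" where q: "\<forall>\<eta> \<rho> xs. length xs = length Fs \<longrightarrow>
      (\<exists>m \<le> poly q (input_size \<eta> xs). \<exists>y. runs no_oracle \<rho> p \<eta> xs m y)" ..
  \<comment> \<open>The output of \<open>p\<close> is not given as a function; the choice operator
    makes it one, so that \<open>oracle_ptime_compose\<close> can be applied to it.\<close>
  define G where "G \<eta> orc \<rho> = (SOME y. \<exists>m \<le> poly q (input_size \<eta> (map (\<lambda>F. F \<eta> orc \<rho>) Fs)).
    runs no_oracle (shift (N * \<eta>) \<rho>) p \<eta> (map (\<lambda>F. F \<eta> orc \<rho>) Fs) m y)" for \<eta> orc \<rho>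
  have G: "\<exists>m \<le> poly q (input_size \<eta> (map (\<lambda>F. F \<eta> orc \<rho>) Fs)).
    runs no_oracle (shift (N * \<eta>) \<rho>) p \<eta> (map (\<lambda>F. F \<eta> orc \<rho>) Fs) m (G \<eta> orc \<rho>)" for \<eta> orc \<rho>
    unfolding G_def
  proof (rule someI_ex)
    from q have "\<exists>m \<le> poly q (input_size \<eta> (map (\<lambda>F. F \<eta> orc \<rho>) Fs)).
      \<exists>y. runs no_oracle (shift (N * \<eta>) \<rho>) p \<eta> (map (\<lambda>F. F \<eta> orc \<rho>) Fs) m y"
      by simp
    then show "\<exists>y. \<exists>m \<le> poly q (input_size \<eta> (map (\<lambda>F. F \<eta> orc \<rho>) Fs)).
      runs no_oracle (shift (N * \<eta>) \<rho>) p \<eta> (map (\<lambda>F. F \<eta> orc \<rho>) Fs) m y"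
      by blast
  qed
  have "oracle_ptime G"
    by (rule oracle_ptime_compose[where Q = q and q = p and N = N, OF Fs])
      (use G runs_oracle_free[OF _ free] in blast)
  then obtain P r where P: "\<And>\<eta> orc \<rho>. (\<forall>x. length (orc x) = \<eta>) \<Longrightarrow>
     \<exists>m\<le>poly r \<eta>. runs orc \<rho> P \<eta> [] m (G \<eta> orc \<rho>)"
    unfolding oracle_ptime_def by blast
  show ?thesis
  proof (intro exI[of _ P] conjI allI impI)
    show "ptime_oracle_adversary P"
      unfolding ptime_oracle_adversary_def using P by blast
  next
    fix \<eta> and orc :: "bits \<Rightarrow> bits" and \<rho> assume orc: "\<forall>x. length (orc x) = \<eta>"
    from P[OF orc, of \<rho>] G[of \<eta> orc \<rho>] obtain m m' where
      "runs orc \<rho> P \<eta> [] m (G \<eta> orc \<rho>)"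
      "runs no_oracle (shift (N * \<eta>) \<rho>) p \<eta> (map (\<lambda>F. F \<eta> orc \<rho>) Fs) m' (G \<eta> orc \<rho>)"
      by blast
    then show "accepts orc \<rho> P \<eta> [] \<longleftrightarrow>
      accepts no_oracle (shift (N * \<eta>) \<rho>) p \<eta> (map (\<lambda>F. F \<eta> orc \<rho>) Fs)"
      by (simp add: accepts_iff_runs)
  qed
qed

section \<open>Interpretation relative to an oracle and an environment for names\<close>

text \<open>A hash under \<open>k\<close> is recognised syntactically and sent to the oracle without
  evaluating \<open>Name k\<close>. In a term that satisfies \<open>only_hash_key k\<close>, the
  value \<open>env k\<close> is thus never consulted, and the key exists only inside the
  oracle.\<close>

fun ointerp :: "('f, 'g) model \<Rightarrow> nat \<Rightarrow> nat \<Rightarrow> (nat \<Rightarrow> bits) \<Rightarrow> (bits \<Rightarrow> bits) \<Rightarrow> tape \<Rightarrow> ('f, 'g) tm \<Rightarrow> bits"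
where
  "ointerp M k \<eta> env orc \<rho> (Name a) = env a"
| "ointerp M k \<eta> env orc \<rho> TT = [True]"
| "ointerp M k \<eta> env orc \<rho> FF = [False]"
| "ointerp M k \<eta> env orc \<rho> Zero = replicate \<eta> False"
| "ointerp M k \<eta> env orc \<rho> (Xor x y) =
     map2 (\<noteq>) (ointerp M k \<eta> env orc \<rho> x) (ointerp M k \<eta> env orc \<rho> y)"
| "ointerp M k \<eta> env orc \<rho> (EQ x y) = [ointerp M k \<eta> env orc \<rho> x = ointerp M k \<eta> env orc \<rho> y]"
| "ointerp M k \<eta> env orc \<rho> (Ite b x y) = (if ointerp M k \<eta> env orc \<rho> b = [True]
     then ointerp M k \<eta> env orc \<rho> x else ointerp M k \<eta> env orc \<rho> y)"
| "ointerp M k \<eta> env orc \<rho> (H x y) = (if y = Name k then orc (ointerp M k \<eta> env orc \<rho> x)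
     else hash M \<eta> (ointerp M k \<eta> env orc \<rho> x) (ointerp M k \<eta> env orc \<rho> y))"
| "ointerp M k \<eta> env orc \<rho> (Fun f xs) = fsym_int M f \<eta> (map (ointerp M k \<eta> env orc \<rho>) xs)"
| "ointerp M k \<eta> env orc \<rho> (Att g xs) = att_int M g \<eta> (map (ointerp M k \<eta> env orc \<rho>) xs) \<rho>"

text \<open>The second alternative admits an oracle that has nothing to do with \<open>k\<close>. It
  serves the case where \<open>k\<close> itself is the fresh name, so that no hash under
  \<open>k\<close> occurs.\<close>

lemma interp_eq_ointerp:
  assumes "orc = (\<lambda>x. hash M \<eta> x (interp M \<eta> \<rho>1 \<rho>2 (Name k))) \<or> (\<forall>s. H s (Name k) \<notin> subterms u)"
  shows "interp M \<eta> \<rho>1 \<rho>2 u = ointerp M k \<eta> (\<lambda>a. interp M \<eta> \<rho>1 \<rho>2 (Name a)) orc \<rho>2 u"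
  using assms
proof (induction u)
  case (H x y)
  then show ?case by (cases "y = Name k") auto
next
  case (Fun f xs)
  then have "map (interp M \<eta> \<rho>1 \<rho>2) xs = map (ointerp M k \<eta> (\<lambda>a. interp M \<eta> \<rho>1 \<rho>2 (Name a)) orc \<rho>2) xs"
    by auto
  then show ?case by (simp only: interp.simps ointerp.simps)
next
  case (Att g xs)
  then have "map (interp M \<eta> \<rho>1 \<rho>2) xs = map (ointerp M k \<eta> (\<lambda>a. interp M \<eta> \<rho>1 \<rho>2 (Name a)) orc \<rho>2) xs"
    by auto
  then show ?case by (simp only: interp.simps ointerp.simps)
qed auto

text \<open>The oracles need to agree only at the arguments computed with the first one: from the
  inside out, the arguments of outer hashes then have the same value under both. This is what allows
  the answer at a point that is never queried to be changed.\<close>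

lemma ointerp_cong:
  assumes "only_hash_key k u" "\<And>a. a \<in> names u \<Longrightarrow> a \<noteq> k \<Longrightarrow> env a = env' a"
    and "\<And>s. H s (Name k) \<in> subterms u \<Longrightarrow>
      orc (ointerp M k \<eta> env orc \<rho> s) = orc' (ointerp M k \<eta> env orc \<rho> s)"
  shows "ointerp M k \<eta> env orc \<rho> u = ointerp M k \<eta> env' orc' \<rho> u"
  using assms
proof (induction u)
  case (H x y)
  have x: "ointerp M k \<eta> env orc \<rho> x = ointerp M k \<eta> env' orc' \<rho> x"
    by (rule H.IH(1)) (use H.prems in auto)
  show ?case
  proof (cases "y = Name k")
    case True
    then show ?thesis using x H.prems(3)[of x] by simp
  next
    case False
    have "ointerp M k \<eta> env orc \<rho> y = ointerp M k \<eta> env' orc' \<rho> y"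
      by (rule H.IH(2)) (use H.prems False in auto)
    with False x show ?thesis by simp
  qed
next
  case (Fun f xs)
  have "ointerp M k \<eta> env orc \<rho> x = ointerp M k \<eta> env' orc' \<rho> x" if "x \<in> set xs" for x
  proof (rule Fun.IH[OF that])
    show "only_hash_key k x" using Fun.prems(1) that by simp
    show "env a = env' a" if "a \<in> names x" "a \<noteq> k" for a
      by (rule Fun.prems(2)) (use that \<open>x \<in> set xs\<close> in auto)
    show "orc (ointerp M k \<eta> env orc \<rho> s) = orc' (ointerp M k \<eta> env orc \<rho> s)"
      if "H s (Name k) \<in> subterms x" for s
      by (rule Fun.prems(3)) (use that \<open>x \<in> set xs\<close> in auto)
  qed
  then have "map (ointerp M k \<eta> env orc \<rho>) xs = map (ointerp M k \<eta> env' orc' \<rho>) xs" by auto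
  then show ?case by (simp only: ointerp.simps)
next
  case (Att g xs)
  have "ointerp M k \<eta> env orc \<rho> x = ointerp M k \<eta> env' orc' \<rho> x" if "x \<in> set xs" for x
  proof (rule Att.IH[OF that])
    show "only_hash_key k x" using Att.prems(1) that by simp
    show "env a = env' a" if "a \<in> names x" "a \<noteq> k" for a
      by (rule Att.prems(2)) (use that \<open>x \<in> set xs\<close> in auto)
    show "orc (ointerp M k \<eta> env orc \<rho> s) = orc' (ointerp M k \<eta> env orc \<rho> s)"
      if "H s (Name k) \<in> subterms x" for s
      by (rule Att.prems(3)) (use that \<open>x \<in> set xs\<close> in auto)
  qed
  then have "map (ointerp M k \<eta> env orc \<rho>) xs = map (ointerp M k \<eta> env' orc' \<rho>) xs" by auto
  then show ?case by (simp only: ointerp.simps)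
next
  case (Ite b x y)
  have "ointerp M k \<eta> env orc \<rho> b = ointerp M k \<eta> env' orc' \<rho> b"
    "ointerp M k \<eta> env orc \<rho> x = ointerp M k \<eta> env' orc' \<rho> x"
    "ointerp M k \<eta> env orc \<rho> y = ointerp M k \<eta> env' orc' \<rho> y"
    by (rule Ite.IH; use Ite.prems in auto)+
  then show ?case by simp
next
  case (Xor x y)
  have "ointerp M k \<eta> env orc \<rho> x = ointerp M k \<eta> env' orc' \<rho> x"
    "ointerp M k \<eta> env orc \<rho> y = ointerp M k \<eta> env' orc' \<rho> y"
    by (rule Xor.IH; use Xor.prems in auto)+
  then show ?case by simp
next
  case (EQ x y)
  have "ointerp M k \<eta> env orc \<rho> x = ointerp M k \<eta> env' orc' \<rho> x"
    "ointerp M k \<eta> env orc \<rho> y = ointerp M k \<eta> env' orc' \<rho> y"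
    by (rule EQ.IH; use EQ.prems in auto)+
  then show ?case by simp
qed auto

lemma ointerp_ite_disj:
  "ointerp M k \<eta> env orc \<rho> (ite_disj (map (\<lambda>s. EQ s t) ts) x y) =
    (if \<exists>s\<in>set ts. ointerp M k \<eta> env orc \<rho> s = ointerp M k \<eta> env orc \<rho> t
     then ointerp M k \<eta> env orc \<rho> x else ointerp M k \<eta> env orc \<rho> y)"
proof (induction ts)
  case (Cons s ts)
  then show ?case by (cases ts) auto
qed simp

lemma interp_ite_disj:
  "interp M \<eta> \<rho>1 \<rho>2 (ite_disj (map (\<lambda>s. EQ s t) ts) x y) =
    (if \<exists>s\<in>set ts. interp M \<eta> \<rho>1 \<rho>2 s = interp M \<eta> \<rho>1 \<rho>2 t
     then interp M \<eta> \<rho>1 \<rho>2 x else interp M \<eta> \<rho>1 \<rho>2 y)"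
proof (induction ts)
  case (Cons s ts)
  then show ?case by (cases ts) auto
qed simp

abbreviation (input) oval where
  "oval M k pos N u \<equiv> (\<lambda>\<eta> orc \<rho>. ointerp M k \<eta> (\<lambda>a. slot (pos a) \<eta> \<rho>) orc (shift (N * \<eta>) \<rho>) u)"

text \<open>Time and sort are proved together, because function symbols are known to be
  polynomial-time only on arguments of their declared sorts, and their results become arguments in
  turn.\<close>

lemma oracle_ptime_ointerp:
  assumes M: "computational_model S M" and u: "has_sort S u s"
  shows "oracle_ptime (oval M k pos N u) \<and>
    (\<forall>\<eta> orc \<rho>. (\<forall>x. length (orc x) = \<eta>) \<longrightarrow> oval M k pos N u \<eta> orc \<rho> \<in> sort_set \<eta> s)"
proof -
  have hash: "ptime_fun (sorted_args [Term_Sort, Nonce_Sort]) (\<lambda>\<eta> xs. hash M \<eta> (xs ! 0) (xs ! 1))"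
    "\<And>\<eta> x k. length k = \<eta> \<Longrightarrow> length (hash M \<eta> x k) = \<eta>"
    and fsym: "\<And>f. ptime_fun (sorted_args (fst (fsym_sort S f))) (fsym_int M f)"
    "\<And>f \<eta> xs. xs \<in> sorted_args (fst (fsym_sort S f)) \<eta> \<Longrightarrow>
        fsym_int M f \<eta> xs \<in> sort_set \<eta> (snd (fsym_sort S f))"
    and att: "\<And>g. ptime_tape_fun (\<lambda>_. {xs. length xs = att_arity S g}) (att_int M g)"
    using M unfolding computational_model_def by blast+
  let ?F = "oval M k pos N"
  from u show ?thesis
  proof (induction rule: has_sort.induct)
    case (1 a)
    show ?case by (simp add: oracle_ptime_slot)
  next
    case 2
    show ?case using oracle_ptime_ptime_fun[OF ptime_fun_bool, of "[]" True] by simp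
  next
    case 3
    show ?case using oracle_ptime_ptime_fun[OF ptime_fun_bool, of "[]" False] by simp
  next
    case 4
    show ?case using oracle_ptime_ptime_fun[OF ptime_fun_zero, of "[]"] by simp
  next
    case (5 x y)
    show ?case using oracle_ptime_ptime_fun[OF ptime_fun_xor, of "[?F x, ?F y]"] 5 by simp
  next
    case (6 x y)
    show ?case using oracle_ptime_ptime_fun[OF ptime_fun_eq, of "[?F x, ?F y]"] 6 by simp
  next
    case (7 b x s y)
    show ?case using oracle_ptime_ptime_fun[OF ptime_fun_ite, of "[?F b, ?F x, ?F y]"] 7
      by (simp cong: if_cong)
  next
    case (8 x y)
    show ?case
    proof (cases "y = Name k")
      case True
      \<comment> \<open>The answer of the oracle has \<eta> bits, as the sort of a hash
        requires.\<close>
      then show ?thesis using 8 oracle_ptime_query[of "?F x"] by simp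
    next
      case False
      then show ?thesis
        using oracle_ptime_ptime_fun[OF hash(1), of "[?F x, ?F y]"] 8 hash(2)
        by (simp add: sorted_args_def)
    qed
  next
    case (9 xs f)
    have args: "map (\<lambda>F. F \<eta> orc \<rho>) (map ?F xs) \<in> sorted_args (fst (fsym_sort S f)) \<eta>"
      if "\<forall>x. length (orc x) = \<eta>" for \<eta> orc \<rho>
      using 9 that by (auto simp: sorted_args_def list_all2_conv_all_nth)
    have "\<forall>F\<in>set (map ?F xs). oracle_ptime F"
      using 9 by (auto simp: list_all2_conv_all_nth in_set_conv_nth)
    from oracle_ptime_ptime_fun[OF fsym(1) this args] fsym(2)[OF args] show ?case
      by (simp add: o_def)
  next
    case (10 xs g)
    have "\<forall>F\<in>set (map ?F xs). oracle_ptime F" using 10 by auto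
    from oracle_ptime_tape_fun[OF att this, of g N] 10(1) show ?case
      by (simp add: o_def)
  next
    case (11 x s)
    then show ?case by simp
  qed
qed

section \<open>Measure-preserving maps and measurability\<close>

text \<open>The pushforward of \<open>M\<close> along \<open>f\<close> is \<open>N\<close>, so
  probabilities of events of \<open>N\<close> can be computed on \<open>M\<close>. Every change of
  sample space below is such a map.\<close>

definition measure_preserving :: "'a measure \<Rightarrow> 'b measure \<Rightarrow> ('a \<Rightarrow> 'b) \<Rightarrow> bool" where
  "measure_preserving M N f \<longleftrightarrow> f \<in> measurable M N \<and> distr M N f = N"

lemma measure_preservingI:
  assumes "f \<in> measurable M N"
    and "\<And>A. A \<in> sets N \<Longrightarrow> emeasure M (f -` A \<inter> space M) = emeasure N A"
  shows "measure_preserving M N f"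
  unfolding measure_preserving_def using assms by (auto intro!: measure_eqI simp: emeasure_distr)

lemma measure_preserving_measurable: "measure_preserving M N f \<Longrightarrow> f \<in> measurable M N"
  by (simp add: measure_preserving_def)

lemma measure_preserving_id: "measure_preserving M M (\<lambda>x. x)"
  by (simp add: measure_preserving_def)

lemma measure_preserving_comp:
  assumes "measure_preserving M N f" "measure_preserving N L g"
  shows "measure_preserving M L (\<lambda>x. g (f x))"
  using assms distr_distr[of g N L f M] by (auto simp: measure_preserving_def o_def)

lemma measure_preserving_pair:
  assumes "measure_preserving M S f" "measure_preserving N T g" "prob_space T"
  shows "measure_preserving (M \<Otimes>\<^sub>M N) (S \<Otimes>\<^sub>M T) (\<lambda>(x, y). (f x, g y))"
proof -
  have f: "f \<in> measurable M S" "g \<in> measurable N T" "distr M S f = S" "distr N T g = T"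
    using assms by (auto simp: measure_preserving_def)
  have "sigma_finite_measure (distr N T g)"
    unfolding f using assms(3) by (simp add: prob_space_imp_sigma_finite)
  from pair_measure_distr[OF f(1,2) this] have
    "distr (M \<Otimes>\<^sub>M N) (S \<Otimes>\<^sub>M T) (\<lambda>(x, y). (f x, g y)) = S \<Otimes>\<^sub>M T" unfolding f by simp
  moreover have "(\<lambda>(x, y). (f x, g y)) \<in> measurable (M \<Otimes>\<^sub>M N) (S \<Otimes>\<^sub>M T)"
    using f(1,2) by measurable
  ultimately show ?thesis by (simp add: measure_preserving_def)
qed

lemma measure_preserving_snd:
  assumes "prob_space M" "prob_space N"
  shows "measure_preserving (M \<Otimes>\<^sub>M N) N snd"
proof (rule measure_preservingI)
  interpret M: prob_space M by fact
  interpret N: prob_space N by fact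
  fix A assume A: "A \<in> sets N"
  then have "snd -` A \<inter> space (M \<Otimes>\<^sub>M N) = space M \<times> A"
    using sets.sets_into_space by (fastforce simp: space_pair_measure)
  then show "emeasure (M \<Otimes>\<^sub>M N) (snd -` A \<inter> space (M \<Otimes>\<^sub>M N)) = emeasure N A"
    using A by (simp add: N.emeasure_pair_measure_Times M.emeasure_space_1)
qed simp

text \<open>By Fubini, both bracketings lead to the same threefold iterated integral of the
  indicator function.\<close>

lemma measure_preserving_assoc:
  assumes "prob_space L" "prob_space M" "prob_space N"
  shows "measure_preserving (L \<Otimes>\<^sub>M (M \<Otimes>\<^sub>M N)) ((L \<Otimes>\<^sub>M M) \<Otimes>\<^sub>M N) (\<lambda>(x, y, z). ((x, y), z))"
proof (rule measure_preservingI)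
  interpret L: prob_space L by fact
  interpret M: prob_space M by fact
  interpret N: prob_space N by fact
  interpret MN: pair_prob_space M N ..
  fix A assume A: "A \<in> sets ((L \<Otimes>\<^sub>M M) \<Otimes>\<^sub>M N)"
  let ?f = "\<lambda>(x, y, z). ((x, y), z)"
  have f: "?f \<in> measurable (L \<Otimes>\<^sub>M (M \<Otimes>\<^sub>M N)) ((L \<Otimes>\<^sub>M M) \<Otimes>\<^sub>M N)" by measurable
  have 1: "(\<lambda>p. indicator A (?f p) :: ennreal) \<in> borel_measurable (L \<Otimes>\<^sub>M (M \<Otimes>\<^sub>M N))"
    using f A by measurable
  have 2: "(\<lambda>p. indicator A p :: ennreal) \<in> borel_measurable ((L \<Otimes>\<^sub>M M) \<Otimes>\<^sub>M N)"
    using A by measurable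
  have "emeasure (L \<Otimes>\<^sub>M (M \<Otimes>\<^sub>M N)) (?f -` A \<inter> space (L \<Otimes>\<^sub>M (M \<Otimes>\<^sub>M N))) =
    (\<integral>\<^sup>+p. indicator (?f -` A \<inter> space (L \<Otimes>\<^sub>M (M \<Otimes>\<^sub>M N))) p \<partial>(L \<Otimes>\<^sub>M (M \<Otimes>\<^sub>M N)))"
    using measurable_sets[OF f A] by simp
  also have "\<dots> = (\<integral>\<^sup>+p. indicator A (?f p) \<partial>(L \<Otimes>\<^sub>M (M \<Otimes>\<^sub>M N)))"
    by (intro nn_integral_cong) (auto simp: indicator_def)
  also have "\<dots> = (\<integral>\<^sup>+x. \<integral>\<^sup>+q. indicator A (?f (x, q)) \<partial>(M \<Otimes>\<^sub>M N) \<partial>L)"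
    by (rule MN.nn_integral_fst[OF 1, symmetric])
  also have "\<dots> = (\<integral>\<^sup>+x. \<integral>\<^sup>+y. \<integral>\<^sup>+z. indicator A ((x, y), z) \<partial>N \<partial>M \<partial>L)"
  proof (rule nn_integral_cong)
    fix x assume x: "x \<in> space L"
    have "(\<lambda>q. indicator A (?f (x, q)) :: ennreal) \<in> borel_measurable (M \<Otimes>\<^sub>M N)"
      using measurable_compose[OF measurable_Pair1'[OF x] 1] .
    from N.nn_integral_fst[OF this, symmetric]
    show "(\<integral>\<^sup>+q. indicator A (?f (x, q)) \<partial>(M \<Otimes>\<^sub>M N)) = (\<integral>\<^sup>+y. \<integral>\<^sup>+z. indicator A ((x, y), z) \<partial>N \<partial>M)"
      by simp
  qed
  also have "\<dots> = (\<integral>\<^sup>+q. \<integral>\<^sup>+z. indicator A (q, z) \<partial>N \<partial>(L \<Otimes>\<^sub>M M))"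
    using M.nn_integral_fst[OF N.borel_measurable_nn_integral_fst[OF 2], symmetric] by simp
  also have "\<dots> = emeasure ((L \<Otimes>\<^sub>M M) \<Otimes>\<^sub>M N) A"
    using N.nn_integral_fst[OF 2] A by simp
  finally show "emeasure (L \<Otimes>\<^sub>M (M \<Otimes>\<^sub>M N)) (?f -` A \<inter> space (L \<Otimes>\<^sub>M (M \<Otimes>\<^sub>M N))) =
    emeasure ((L \<Otimes>\<^sub>M M) \<Otimes>\<^sub>M N) A" .
qed measurable

lemma measure_preserving_emeasure:
  assumes "measure_preserving M N f" "A \<in> sets N"
  shows "emeasure M (f -` A \<inter> space M) = emeasure N A"
  using assms by (metis emeasure_distr measure_preserving_def)

lemma measure_preserving_prob:
  assumes "measure_preserving M N f" "{x \<in> space N. Q x} \<in> sets N"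
  shows "\<P>(x in M. Q (f x)) = \<P>(x in N. Q x)"
proof -
  have f: "f \<in> measurable M N" using assms(1) by (simp add: measure_preserving_def)
  have "{x \<in> space M. Q (f x)} = f -` {x \<in> space N. Q x} \<inter> space M"
    using measurable_space[OF f] by auto
  then show ?thesis
    using measure_preserving_emeasure[OF assms] by (simp add: measure_def)
qed

section \<open>Random tapes, strings and functions\<close>

abbreviation coin :: "bool measure" where
  "coin \<equiv> measure_pmf (pmf_of_set UNIV)"

text \<open>Provides the fact that \<open>comb_seq\<close>, which follows one coin sequence for a
  given number of cells and then starts the other, turns two independent coin sequences into a coin
  sequence.\<close>

interpretation coin: sequence_space coin
  by unfold_locales

lemma prob_space_random_tape: "prob_space random_tape"
  unfolding random_tape_def by (intro prob_space_PiM) (rule prob_space_measure_pmf)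

lemma prob_space_random_bits: "prob_space (random_bits \<eta>)"
  unfolding random_bits_def by (rule prob_space_measure_pmf)

lemma prob_space_random_fun: "prob_space (random_fun \<eta>)"
  unfolding random_fun_def by (intro prob_space_PiM) (rule prob_space_random_bits)

lemma space_random_tape [simp]: "space random_tape = UNIV"
  by (simp add: random_tape_def space_PiM)

lemma space_random_bits [simp]: "space (random_bits \<eta>) = UNIV"
  by (simp add: random_bits_def)

lemma sets_random_bits [simp]: "sets (random_bits \<eta>) = UNIV"
  by (simp add: random_bits_def)

lemma space_random_fun [simp]: "space (random_fun \<eta>) = UNIV"
  by (simp add: random_fun_def space_PiM)

lemma finite_bits: "finite {w :: bits. length w = \<eta>}"
  using finite_lists_length_eq[of "UNIV :: bool set" \<eta>] by simp

lemma card_bits: "card {w :: bits. length w = \<eta>} = 2 ^ \<eta>"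
  using card_lists_length_eq[of "UNIV :: bool set" \<eta>] by simp

lemma bits_nonempty: "{w :: bits. length w = \<eta>} \<noteq> {}"
  by (auto intro: exI[of _ "replicate \<eta> False"])

lemma AE_random_bits: "AE w in random_bits \<eta>. length w = \<eta>"
  unfolding random_bits_def by (simp add: AE_measure_pmf_iff set_pmf_of_set[OF bits_nonempty finite_bits])

lemma AE_random_fun: "AE g in random_fun \<eta>. \<forall>x. length (g x) = \<eta>"
  unfolding AE_all_countable random_fun_def
  by (intro allI AE_PiM_component prob_space_random_bits AE_random_bits) simp

lemma measurable_random_bits_eq: "measurable M (random_bits \<eta>) = measurable M (count_space UNIV)"
  by (intro measurable_cong_sets) (simp_all add: random_bits_def)

lemma measurable_random_bits_dom: "f \<in> measurable (random_bits \<eta>) M \<longleftrightarrow> range f \<subseteq> space M"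
  by (auto simp: measurable_def)

lemma measurable_oracle_value [measurable]: "(\<lambda>g. g x) \<in> measurable (random_fun \<eta>) (count_space UNIV)"
  unfolding measurable_random_bits_eq[of _ \<eta>, symmetric] random_fun_def
  by (rule measurable_component_singleton) simp

lemma measurable_tape_bit [measurable]: "(\<lambda>\<rho>. \<rho> i) \<in> measurable random_tape (count_space UNIV)"
  unfolding random_tape_def
  using measurable_component_singleton[of i UNIV "\<lambda>_. coin"] by (simp add: measurable_def)

section \<open>Measurability of halting and acceptance\<close>

text \<open>An open set is the union of the cylinders that it contains. A cylinder is described by a
  finite list of queries with their answers and by a tape prefix, so there are only countably many
  of them.\<close>

lemma sets_open:
  fixes A :: "((bits \<Rightarrow> bits) \<times> tape) set"
  assumes "\<And>orc \<rho>. (orc, \<rho>) \<in> A \<Longrightarrow> holds_near (\<lambda>orc' \<rho>'. (orc', \<rho>') \<in> A) orc \<rho>"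
  shows "A \<in> sets (random_fun \<eta> \<Otimes>\<^sub>M random_tape)"
proof -
  define C :: "(bits \<times> bits) list \<times> bits \<Rightarrow> ((bits \<Rightarrow> bits) \<times> tape) set" where
    "C lw = {\<omega> \<in> space (random_fun \<eta> \<Otimes>\<^sub>M random_tape).
      (\<forall>p\<in>set (fst lw). fst \<omega> (fst p) = snd p) \<and> (\<forall>i\<in>{..<length (snd lw)}. snd \<omega> i = snd lw ! i)}" for lw
  have C: "C lw \<in> sets (random_fun \<eta> \<Otimes>\<^sub>M random_tape)" for lw
    unfolding C_def by measurable
  have "A = (\<Union>lw \<in> {lw. C lw \<subseteq> A}. C lw)"
  proof (intro subset_antisym subsetI)
    fix \<omega> assume "\<omega> \<in> A"
    then obtain orc \<rho> where \<omega>: "\<omega> = (orc, \<rho>)" "(orc, \<rho>) \<in> A" by (cases \<omega>) auto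
    from assms[OF \<omega>(2)] obtain B N where B: "finite B"
      and near: "\<And>orc' \<rho>'. (\<forall>x\<in>B. orc' x = orc x) \<Longrightarrow> (\<forall>i<N. \<rho>' i = \<rho> i) \<Longrightarrow> (orc', \<rho>') \<in> A"
      unfolding holds_near_def by blast
    from B obtain l where l: "set l = B" using finite_list by blast
    let ?lw = "(map (\<lambda>x. (x, orc x)) l, map \<rho> [0..<N])"
    have "C ?lw \<subseteq> A"
    proof
      fix \<omega>' assume "\<omega>' \<in> C ?lw"
      then have "(\<forall>x\<in>B. fst \<omega>' x = orc x)" "(\<forall>i<N. snd \<omega>' i = \<rho> i)" by (auto simp: C_def l)
      from near[OF this] show "\<omega>' \<in> A" by simp
    qed
    moreover have "\<omega> \<in> C ?lw" using \<omega> by (auto simp: C_def space_pair_measure)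
    ultimately show "\<omega> \<in> (\<Union>lw \<in> {lw. C lw \<subseteq> A}. C lw)" by blast
  qed auto
  also have "\<dots> \<in> sets (random_fun \<eta> \<Otimes>\<^sub>M random_tape)"
    by (intro sets.countable_UN'' C) simp
  finally show ?thesis .
qed

lemma sets_runs:
  "{\<omega>. \<exists>m. runs (fst \<omega>) (snd \<omega>) p \<eta>' xs m y} \<in> sets (random_fun \<eta> \<Otimes>\<^sub>M random_tape)"
proof (rule sets_open)
  fix orc \<rho> assume "(orc, \<rho>) \<in> {\<omega>. \<exists>m. runs (fst \<omega>) (snd \<omega>) p \<eta>' xs m y}"
  then obtain m s where s: "exec orc \<rho> p (init \<eta>' xs) m s" "fst s 0 = y"
    by (auto simp: runs_def)
  show "holds_near (\<lambda>orc' \<rho>'. (orc', \<rho>') \<in> {\<omega>. \<exists>m. runs (fst \<omega>) (snd \<omega>) p \<eta>' xs m y}) orc \<rho>"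
    by (rule holds_near_mono[OF exec_holds_near[OF s(1)]])
      (unfold mem_Collect_eq fst_conv snd_conv runs_def, use s(2) in blast)
qed

lemma sets_accepts:
  "{\<omega>. accepts (fst \<omega>) (snd \<omega>) p \<eta>' xs} \<in> sets (random_fun \<eta> \<Otimes>\<^sub>M random_tape)"
  unfolding accepts_def by (rule sets_runs)

text \<open>The event is the preimage of the one for random functions under the map from a key to
  its hash function, which is measurable because \<open>random_bits\<close> is discrete.\<close>

lemma sets_accepts_hash:
  "{\<omega>. accepts (\<lambda>x. h x (fst \<omega>)) (snd \<omega>) p \<eta>' xs} \<in> sets (random_bits \<eta> \<Otimes>\<^sub>M random_tape)"
proof -
  have g: "(\<lambda>w x. h x w) \<in> measurable (random_bits \<eta>) (random_fun \<eta>)"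
    by (simp add: measurable_random_bits_dom)
  have f: "(\<lambda>\<omega>. (\<lambda>x. h x (fst \<omega>), snd \<omega>)) \<in>
      measurable (random_bits \<eta> \<Otimes>\<^sub>M random_tape) (random_fun \<eta> \<Otimes>\<^sub>M random_tape)"
    by (intro measurable_Pair measurable_compose[OF measurable_fst g] measurable_snd)
  show ?thesis
    using measurable_sets[OF f sets_accepts[of p \<eta>' xs \<eta>]]
    by (simp add: vimage_def space_pair_measure)
qed

section \<open>Cutting and gluing random tapes\<close>

text \<open>The \<open>rev\<close> cancels the reversal in \<open>slot\<close>, so that slot
  \<open>0\<close> returns \<open>w\<close>. In this form the first block of a tape becomes a random
  variable of its own.\<close>

definition prepend :: "bits \<Rightarrow> tape \<Rightarrow> tape" where
  "prepend w \<rho> j = (if j < length w then rev w ! j else \<rho> (j - length w))"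

lemma slot_0_prepend: "length w = \<eta> \<Longrightarrow> slot 0 \<eta> (prepend w \<rho>) = w"
  by (auto simp: slot_def prepend_def intro!: nth_equalityI simp: rev_nth)

lemma slot_Suc_prepend: "length w = \<eta> \<Longrightarrow> slot (Suc i) \<eta> (prepend w \<rho>) = slot i \<eta> \<rho>"
  by (simp add: slot_def prepend_def)

lemma shift_prepend: "length w = \<eta> \<Longrightarrow> shift (Suc N * \<eta>) (prepend w \<rho>) = shift (N * \<eta>) \<rho>"
  by (simp add: shift_def prepend_def fun_eq_iff)

lemma comb_seq_eq_prepend: "comb_seq \<eta> \<omega> \<omega>' = prepend (slot 0 \<eta> \<omega>) \<omega>'"
  by (auto simp: comb_seq_def prepend_def slot_def fun_eq_iff)

lemma slot_shift: "slot i \<eta> (shift \<eta> \<rho>) = slot (Suc i) \<eta> \<rho>"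
  by (simp add: slot_def shift_def add.assoc)

lemma slot_0_eq_iff: "slot 0 \<eta> \<rho> = w \<longleftrightarrow> length w = \<eta> \<and> (\<forall>i\<in>{..<\<eta>}. \<rho> i = rev w ! i)"
proof
  assume "length w = \<eta> \<and> (\<forall>i\<in>{..<\<eta>}. \<rho> i = rev w ! i)"
  then have "map \<rho> [0..<\<eta>] = rev w" by (intro nth_equalityI) auto
  then have "rev (map \<rho> [0..<\<eta>]) = w" by simp
  then show "slot 0 \<eta> \<rho> = w" by (simp add: slot_def)
next
  assume "slot 0 \<eta> \<rho> = w"
  then have "w = rev (map \<rho> [0..<\<eta>])" by (simp add: slot_def)
  then show "length w = \<eta> \<and> (\<forall>i\<in>{..<\<eta>}. \<rho> i = rev w ! i)" by simp
qed

lemma measurable_slot_0: "slot 0 \<eta> \<in> measurable random_tape (random_bits \<eta>)"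
  unfolding measurable_random_bits_eq measurable_count_space_eq2_countable
proof (intro conjI ballI)
  fix w :: bits
  have "slot 0 \<eta> -` {w} \<inter> space random_tape =
    {\<rho> \<in> space random_tape. length w = \<eta> \<and> (\<forall>i\<in>{..<\<eta>}. \<rho> i = rev w ! i)}"
    by (simp add: vimage_def slot_0_eq_iff)
  also have "\<dots> \<in> sets random_tape" by measurable
  finally show "slot 0 \<eta> -` {w} \<inter> space random_tape \<in> sets random_tape" .
qed simp

text \<open>It suffices to compare point masses: a string of length \<eta> has probability
  \<open>(1 / 2) ^ \<eta>\<close> on either side, any other string has probability 0.\<close>

lemma measure_preserving_slot_0: "measure_preserving random_tape (random_bits \<eta>) (slot 0 \<eta>)"
  unfolding measure_preserving_def
proof (intro conjI measurable_slot_0 measure_eqI_countable[where A = UNIV])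
  fix w :: bits
  have "emeasure (distr random_tape (random_bits \<eta>) (slot 0 \<eta>)) {w} =
    emeasure random_tape {\<rho>. slot 0 \<eta> \<rho> = w}"
    by (subst emeasure_distr[OF measurable_slot_0]) (auto simp: vimage_def)
  also have "\<dots> = emeasure (random_bits \<eta>) {w}"
  proof (cases "length w = \<eta>")
    case True
    have "{\<rho>. slot 0 \<eta> \<rho> = w} = {\<rho> \<in> space (PiM UNIV (\<lambda>_. coin)). \<forall>i\<in>{..<\<eta>}. \<rho> i \<in> {rev w ! i}}"
      using True by (auto simp: slot_0_eq_iff space_PiM)
    then have "emeasure random_tape {\<rho>. slot 0 \<eta> \<rho> = w} = (\<Prod>i<\<eta>. emeasure coin {rev w ! i})"
      unfolding random_tape_def using coin.emeasure_PiM_Collect[of "{..<\<eta>}" "\<lambda>i. {rev w ! i}"] by simp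
    also have "\<dots> = ennreal (\<Prod>i<\<eta>. 1 / 2)"
      by (subst prod_ennreal[symmetric]) (simp_all add: emeasure_pmf_single pmf_of_set)
    also have "\<dots> = emeasure (random_bits \<eta>) {w}"
      unfolding random_bits_def emeasure_pmf_single
      using True by (simp add: pmf_of_set[OF bits_nonempty finite_bits] card_bits power_one_over)
    finally show ?thesis .
  next
    case False
    then have "{\<rho>. slot 0 \<eta> \<rho> = w} = {}" by auto
    with False show ?thesis
      by (simp add: random_bits_def emeasure_pmf_single pmf_of_set[OF bits_nonempty finite_bits])
  qed
  finally show "emeasure (distr random_tape (random_bits \<eta>) (slot 0 \<eta>)) {w} = emeasure (random_bits \<eta>) {w}" .
qed simp_all

text \<open>Allows \<open>g\<close> to be examined after pulling back to a sample space
  \<open>M\<close> on which the composite is already understood.\<close>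

lemma measure_preserving_cancel:
  assumes "measure_preserving M N f" "measure_preserving M L (\<lambda>x. g (f x))" "g \<in> measurable N L"
  shows "measure_preserving N L g"
  using assms distr_distr[of g N L f M] by (auto simp: measure_preserving_def o_def)

lemma measure_preserving_comb_seq:
  "measure_preserving (random_tape \<Otimes>\<^sub>M random_tape) random_tape (\<lambda>(\<omega>, \<omega>'). comb_seq m \<omega> \<omega>')"
  unfolding measure_preserving_def random_tape_def
  using coin.PiM_comb_seq measurable_comb_seq[of m coin] by blast

lemma measure_preserving_slot_0_pair:
  "measure_preserving (random_tape \<Otimes>\<^sub>M random_tape) (random_bits \<eta> \<Otimes>\<^sub>M random_tape)
    (\<lambda>(\<omega>, \<omega>'). (slot 0 \<eta> \<omega>, \<omega>'))"
  by (rule measure_preserving_pair[OF measure_preserving_slot_0 measure_preserving_id prob_space_random_tape])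

lemma measurable_into_random_tape:
  "(\<And>j. (\<lambda>\<omega>. f \<omega> j) \<in> measurable M (count_space UNIV)) \<Longrightarrow> f \<in> measurable M random_tape"
  unfolding random_tape_def
  by (rule measurable_PiM_single') (auto simp: measurable_def)

text \<open>With the string drawn as the first block of an extra tape, prepending it is
  \<open>comb_seq\<close> of two independent tapes.\<close>

lemma measure_preserving_prepend:
  "measure_preserving (random_bits \<eta> \<Otimes>\<^sub>M random_tape) random_tape (\<lambda>(w, \<rho>). prepend w \<rho>)"
proof (rule measure_preserving_cancel[OF measure_preserving_slot_0_pair])
  show "measure_preserving (random_tape \<Otimes>\<^sub>M random_tape) random_tape
     (\<lambda>x. case case x of (\<omega>, \<omega>') \<Rightarrow> (slot 0 \<eta> \<omega>, \<omega>') of (w, \<rho>) \<Rightarrow> prepend w \<rho>)"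
    using measure_preserving_comb_seq[of \<eta>] by (simp add: case_prod_beta' comb_seq_eq_prepend)
  show "(\<lambda>(w, \<rho>). prepend w \<rho>) \<in> measurable (random_bits \<eta> \<Otimes>\<^sub>M random_tape) random_tape"
  proof (rule measurable_into_random_tape)
    fix j
    have 1: "fst \<in> measurable (random_bits \<eta> \<Otimes>\<^sub>M random_tape) (count_space UNIV)"
      using measurable_fst[of "random_bits \<eta>" random_tape] unfolding measurable_random_bits_eq .
    have 2: "(\<lambda>\<omega>. prepend w (snd \<omega>) j) \<in> measurable (random_bits \<eta> \<Otimes>\<^sub>M random_tape) (count_space UNIV)" for w
      unfolding prepend_def by (cases "j < length w") simp_all
    show "(\<lambda>\<omega>. (case \<omega> of (w, \<rho>) \<Rightarrow> prepend w \<rho>) j) \<in>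
        measurable (random_bits \<eta> \<Otimes>\<^sub>M random_tape) (count_space UNIV)"
      using measurable_compose_countable[OF 2 1] by (simp add: case_prod_beta')
  qed
qed

text \<open>In a tape written as \<open>comb_seq\<close> of two tapes, the first block comes from
  the one and the remainder from the other, which makes them independent.\<close>

lemma measure_preserving_split:
  "measure_preserving random_tape (random_bits \<eta> \<Otimes>\<^sub>M random_tape) (\<lambda>\<rho>. (slot 0 \<eta> \<rho>, shift \<eta> \<rho>))"
proof (rule measure_preserving_cancel[OF measure_preserving_comb_seq[of \<eta>]])
  have "shift \<eta> (comb_seq \<eta> \<omega> \<omega>') = \<omega>'" for \<omega> \<omega>' :: tape
    by (simp add: shift_def comb_seq_def)
  moreover have "slot 0 \<eta> (comb_seq \<eta> \<omega> \<omega>') = slot 0 \<eta> \<omega>" for \<omega> \<omega>'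
    by (simp add: slot_def comb_seq_def)
  ultimately show "measure_preserving (random_tape \<Otimes>\<^sub>M random_tape) (random_bits \<eta> \<Otimes>\<^sub>M random_tape)
     (\<lambda>x. (slot 0 \<eta> (case x of (\<omega>, \<omega>') \<Rightarrow> comb_seq \<eta> \<omega> \<omega>'),
           shift \<eta> (case x of (\<omega>, \<omega>') \<Rightarrow> comb_seq \<eta> \<omega> \<omega>')))"
    using measure_preserving_slot_0_pair[of \<eta>] by (simp add: case_prod_beta')
  have "shift \<eta> \<in> measurable random_tape random_tape"
    by (rule measurable_into_random_tape) (simp add: shift_def)
  then show "(\<lambda>\<rho>. (slot 0 \<eta> \<rho>, shift \<eta> \<rho>)) \<in> measurable random_tape (random_bits \<eta> \<Otimes>\<^sub>M random_tape)"
    by (intro measurable_Pair measurable_slot_0)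
qed

text \<open>Coins at distinct positions are again independent and fair; positions that
  \<open>f\<close> misses are simply integrated out.\<close>

lemma measure_preserving_reindex:
  assumes "inj f"
  shows "measure_preserving random_tape random_tape (\<lambda>\<rho>. \<rho> \<circ> f)"
proof -
  have "distr random_tape random_tape (\<lambda>\<rho>. \<lambda>n\<in>UNIV. \<rho> (f n)) = random_tape"
    unfolding random_tape_def
    by (rule distr_PiM_reindex[OF _ assms]) (simp_all add: prob_space_measure_pmf)
  moreover have "(\<lambda>\<rho>. \<rho> \<circ> f) \<in> measurable random_tape random_tape"
    by (rule measurable_into_random_tape) simp
  ultimately show ?thesis by (simp add: measure_preserving_def o_def restrict_def)
qed

text \<open>Turns the honest tape and the attacker tape into the input of an oracle game: block
  \<open>b 0\<close> becomes the key, the blocks \<open>b 1\<close> to \<open>b N\<close> become the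
  slots of one tape, and the attacker tape follows them. Disjoint blocks make the key independent of
  that tape.\<close>

lemma measure_preserving_blocks:
  assumes disj: "\<And>i j. i \<le> N \<Longrightarrow> j \<le> N \<Longrightarrow> i \<noteq> j \<Longrightarrow> {b i ..< b i + \<eta>} \<inter> {b j ..< b j + \<eta>} = {}"
  obtains T :: "tape \<Rightarrow> tape \<Rightarrow> tape" where
    "measure_preserving (random_tape \<Otimes>\<^sub>M random_tape) (random_bits \<eta> \<Otimes>\<^sub>M random_tape)
      (\<lambda>(\<rho>1, \<rho>2). (map (\<lambda>j. \<rho>1 (b 0 + j)) [0..<\<eta>], T \<rho>1 \<rho>2))"
    and "\<And>i \<rho>1 \<rho>2. i < N \<Longrightarrow> slot i \<eta> (T \<rho>1 \<rho>2) = map (\<lambda>j. \<rho>1 (b (Suc i) + j)) [0..<\<eta>]"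
    and "\<And>\<rho>1 \<rho>2. shift (N * \<eta>) (T \<rho>1 \<rho>2) = \<rho>2"
proof -
  define m where "m = Suc N * \<eta>"
  define B where "B = (\<Sum>i\<le>N. b i + \<eta>)"
  \<comment> \<open>Blocks are read backwards to cancel the reversal in \<open>slot\<close>. From
    \<open>m\<close> on, \<open>comb_seq\<close> takes over with the attacker tape; there
    \<open>f\<close> only has to stay injective, and \<open>B\<close> is chosen to lie beyond all
    the blocks.\<close>
  define f where "f j = (if j < m then b (j div \<eta>) + (\<eta> - 1 - j mod \<eta>) else B + j)" for j
  have div: "0 < \<eta>" "j div \<eta> \<le> N" "j mod \<eta> < \<eta>" if "j < m" for j
  proof -
    show "0 < \<eta>" using that by (cases \<eta>) (auto simp: m_def)
    then show "j mod \<eta> < \<eta>" by simp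
    have "j div \<eta> < Suc N" using that \<open>0 < \<eta>\<close> unfolding m_def by (simp add: less_mult_imp_div_less)
    then show "j div \<eta> \<le> N" by simp
  qed
  have block: "f j \<in> {b (j div \<eta>) ..< b (j div \<eta>) + \<eta>}" if "j < m" for j
    using that div[OF that] by (auto simp: f_def)
  have bound: "f j < B" if "j < m" for j
  proof -
    have "b (j div \<eta>) + \<eta> \<le> B"
      unfolding B_def by (rule member_le_sum) (use div[OF that] in auto)
    with block[OF that] show ?thesis by simp
  qed
  have "inj f"
  proof (rule injI)
    fix i j assume eq: "f i = f j"
    show "i = j"
    proof (cases "i < m \<and> j < m")
      case True
      have same: "i div \<eta> = j div \<eta>"
      proof (rule ccontr)
        assume "i div \<eta> \<noteq> j div \<eta>"
        from disj[OF _ _ this] True div block[of i] block[of j] eq show False by auto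
      qed
      then have "\<eta> - 1 - i mod \<eta> = \<eta> - 1 - j mod \<eta>"
        using eq True by (simp add: f_def)
      then have "i mod \<eta> = j mod \<eta>"
        using div(3)[of i] div(3)[of j] True by arith
      with same show ?thesis by (metis div_mult_mod_eq)
    next
      case False
      with eq bound[of i] bound[of j] show ?thesis
        by (cases "i < m"; cases "j < m") (auto simp: f_def)
    qed
  qed
  define \<tau> where "\<tau> \<rho>1 \<rho>2 = comb_seq m (\<rho>1 \<circ> f) \<rho>2" for \<rho>1 \<rho>2 :: tape
  have slot_\<tau>: "slot i \<eta> (\<tau> \<rho>1 \<rho>2) = map (\<lambda>j. \<rho>1 (b i + j)) [0..<\<eta>]" if "i \<le> N" for i \<rho>1 \<rho>2
  proof -
    have "i * \<eta> + j < m" if "j < \<eta>" for j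
    proof -
      have "i * \<eta> + j < Suc i * \<eta>" using that by simp
      also have "\<dots> \<le> m" unfolding m_def using \<open>i \<le> N\<close> by (intro mult_le_mono1) simp
      finally show ?thesis .
    qed
    then have rev: "\<tau> \<rho>1 \<rho>2 (i * \<eta> + j) = \<rho>1 (b i + (\<eta> - 1 - j))" if "j < \<eta>" for j
      using that by (simp add: \<tau>_def comb_seq_def f_def)
    have "\<tau> \<rho>1 \<rho>2 (i * \<eta> + \<eta> - Suc j) = \<rho>1 (b i + j)" if "j < \<eta>" for j
    proof -
      have "i * \<eta> + (\<eta> - Suc j) = i * \<eta> + \<eta> - Suc j" "\<eta> - 1 - (\<eta> - Suc j) = j" "\<eta> - Suc j < \<eta>"
        using that by simp_all
      with rev[of "\<eta> - Suc j"] show ?thesis by simp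
    qed
    then show ?thesis
      unfolding slot_def by (intro nth_equalityI) (simp_all add: rev_nth)
  qed
  have "measure_preserving (random_tape \<Otimes>\<^sub>M random_tape) (random_tape \<Otimes>\<^sub>M random_tape)
    (\<lambda>(\<rho>1, \<rho>2). (\<rho>1 \<circ> f, \<rho>2))"
    by (rule measure_preserving_pair[OF measure_preserving_reindex[OF \<open>inj f\<close>] measure_preserving_id
          prob_space_random_tape])
  from measure_preserving_comp[OF measure_preserving_comp[OF this measure_preserving_comb_seq[of m]]
      measure_preserving_split[of \<eta>]]
  have "measure_preserving (random_tape \<Otimes>\<^sub>M random_tape) (random_bits \<eta> \<Otimes>\<^sub>M random_tape)
    (\<lambda>(\<rho>1, \<rho>2). (slot 0 \<eta> (\<tau> \<rho>1 \<rho>2), shift \<eta> (\<tau> \<rho>1 \<rho>2)))"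
    by (simp add: case_prod_beta' \<tau>_def)
  then have "measure_preserving (random_tape \<Otimes>\<^sub>M random_tape) (random_bits \<eta> \<Otimes>\<^sub>M random_tape)
    (\<lambda>(\<rho>1, \<rho>2). (map (\<lambda>j. \<rho>1 (b 0 + j)) [0..<\<eta>], shift \<eta> (\<tau> \<rho>1 \<rho>2)))"
    by (simp add: slot_\<tau>)
  moreover have "shift (N * \<eta>) (shift \<eta> (\<tau> \<rho>1 \<rho>2)) = \<rho>2" for \<rho>1 \<rho>2
    by (simp add: shift_def \<tau>_def comb_seq_def m_def)
  ultimately show ?thesis
    using slot_\<tau> by (intro that[of "\<lambda>\<rho>1 \<rho>2. shift \<eta> (\<tau> \<rho>1 \<rho>2)"]) (simp_all add: slot_shift)
qed

text \<open>On a cylinder, a condition at \<open>x\<close> concerns \<open>w\<close> alone and the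
  other conditions concern \<open>g\<close> alone, so the probability is the same product as for an
  untouched random function.\<close>

lemma measure_preserving_resample:
  "measure_preserving (random_fun \<eta> \<Otimes>\<^sub>M random_bits \<eta>) (random_fun \<eta>) (\<lambda>(g, w). g(x := w))"
proof -
  interpret B: prob_space "random_bits \<eta>" by (rule prob_space_random_bits)
  interpret P: product_prob_space "\<lambda>_. random_bits \<eta>" "UNIV :: bits set"
    by (intro product_prob_spaceI prob_space_random_bits)
  let ?f = "\<lambda>(g, w). g(x := w)"
  have f: "?f \<in> measurable (random_fun \<eta> \<Otimes>\<^sub>M random_bits \<eta>) (random_fun \<eta>)"
    unfolding random_fun_def
  proof (rule measurable_PiM_single')
    fix y
    have "(\<lambda>\<omega>. if y = x then snd \<omega> else fst \<omega> y) \<in>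
        measurable (PiM UNIV (\<lambda>_::bits. random_bits \<eta>) \<Otimes>\<^sub>M random_bits \<eta>) (random_bits \<eta>)"
      by (cases "y = x") simp_all
    then show "(\<lambda>\<omega>. (case \<omega> of (g, w) \<Rightarrow> g(x := w)) y) \<in>
        measurable (PiM UNIV (\<lambda>_. random_bits \<eta>) \<Otimes>\<^sub>M random_bits \<eta>) (random_bits \<eta>)"
      by (simp add: case_prod_beta' fun_upd_def)
  qed simp
  moreover have "distr (random_fun \<eta> \<Otimes>\<^sub>M random_bits \<eta>) (random_fun \<eta>) ?f = random_fun \<eta>"
    unfolding random_fun_def
  proof (rule P.PiM_eq)
    fix J and F :: "bits \<Rightarrow> bits set"
    assume J: "finite J" "J \<subseteq> UNIV" "\<And>j. j \<in> J \<Longrightarrow> F j \<in> sets (random_bits \<eta>)"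
    let ?E = "prod_emb UNIV (\<lambda>_. random_bits \<eta>) J (\<Pi>\<^sub>E j\<in>J. F j)"
    let ?P = "PiM UNIV (\<lambda>_::bits. random_bits \<eta>)"
    let ?A = "{g \<in> space ?P. \<forall>j\<in>J - {x}. g j \<in> F j}"
    let ?B = "if x \<in> J then F x else UNIV"
    have E: "?E \<in> sets ?P" using J by (intro sets_PiM_I) auto
    have A: "?A \<in> sets ?P"
      by (intro sets.sets_Collect_finite_All sets_Collect_single') (use J in auto)
    have "?f -` ?E \<inter> space (?P \<Otimes>\<^sub>M random_bits \<eta>) = ?A \<times> ?B"
      by (auto simp: prod_emb_def space_pair_measure space_PiM PiE_iff if_split_mem1)
    then have "emeasure (distr (?P \<Otimes>\<^sub>M random_bits \<eta>) ?P ?f) ?E = emeasure ?P ?A * emeasure (random_bits \<eta>) ?B"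
      using E A f[unfolded random_fun_def] by (simp add: emeasure_distr B.emeasure_pair_measure_Times)
    also have "emeasure ?P ?A = (\<Prod>j\<in>J - {x}. emeasure (random_bits \<eta>) (F j))"
      using J by (intro P.emeasure_PiM_Collect) auto
    also have "\<dots> * emeasure (random_bits \<eta>) ?B = (\<Prod>j\<in>J. emeasure (random_bits \<eta>) (F j))"
    proof (cases "x \<in> J")
      case True
      then show ?thesis using J by (simp add: prod.remove[of J x] mult.commute)
    next
      case False
      then show ?thesis using B.emeasure_space_1 by simp
    qed
    finally show "emeasure (distr (?P \<Otimes>\<^sub>M random_bits \<eta>) ?P ?f) ?E = (\<Prod>j\<in>J. emeasure (random_bits \<eta>) (F j))" .
  qed simp
  ultimately show ?thesis by (simp add: measure_preserving_def)
qed

section \<open>Resampling one oracle answer\<close>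

lemma measure_preserving_fst:
  assumes "prob_space M" "prob_space N"
  shows "measure_preserving (M \<Otimes>\<^sub>M N) M fst"
proof (rule measure_preservingI)
  interpret M: prob_space M by fact
  interpret N: prob_space N by fact
  fix A assume A: "A \<in> sets M"
  then have "fst -` A \<inter> space (M \<Otimes>\<^sub>M N) = A \<times> space N"
    using sets.sets_into_space by (fastforce simp: space_pair_measure)
  then show "emeasure (M \<Otimes>\<^sub>M N) (fst -` A \<inter> space (M \<Otimes>\<^sub>M N)) = emeasure M A"
    using A by (simp add: N.emeasure_pair_measure_Times N.emeasure_space_1)
qed simp

lemma measure_preserving_AE:
  assumes "measure_preserving M N f" "AE y in N. P y"
  shows "AE x in M. P (f x)"
  using assms by (metis AE_distrD measure_preserving_def)

text \<open>Take a random function, a string and a tape independently. Since \<open>D\<close>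
  ignores the string in slot \<open>0\<close>, the string may be used as the answer at
  \<open>x\<close> instead: \<open>g(x := w)\<close> is again a random function independent of the
  tape. By \<open>swap\<close>, lying in \<open>D\<close> after this change is the same as lying in
  \<open>D'\<close> before it.\<close>

lemma emeasure_resample:
  assumes D: "D \<in> sets (random_fun \<eta> \<Otimes>\<^sub>M random_tape)" "D' \<in> sets (random_fun \<eta> \<Otimes>\<^sub>M random_tape)"
    and indep: "\<And>g w w' \<rho>. length w = \<eta> \<Longrightarrow> length w' = \<eta> \<Longrightarrow>
      (g, prepend w \<rho>) \<in> D \<longleftrightarrow> (g, prepend w' \<rho>) \<in> D"
    and swap: "\<And>g w \<rho>. \<forall>y. length (g y) = \<eta> \<Longrightarrow> length w = \<eta> \<Longrightarrow>
      (g, prepend w \<rho>) \<in> D' \<longleftrightarrow> (g(x := w), prepend w \<rho>) \<in> D"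
  shows "emeasure (random_fun \<eta> \<Otimes>\<^sub>M random_tape) D = emeasure (random_fun \<eta> \<Otimes>\<^sub>M random_tape) D'"
proof -
  let ?F = "random_fun \<eta>" and ?B = "random_bits \<eta>" and ?T = random_tape
  let ?W = "?F \<Otimes>\<^sub>M (?B \<Otimes>\<^sub>M ?T)"
  note prob = prob_space_random_fun[of \<eta>] prob_space_random_bits[of \<eta>] prob_space_random_tape
  have probBT: "prob_space (?B \<Otimes>\<^sub>M ?T)" by (intro prob_space_pair prob)
  \<comment> \<open>A constant filling of slot \<open>0\<close>. It removes the string from the
    description of \<open>D\<close> and gives the event \<open>D0\<close> of function and remaining
    tape only.\<close>
  define z where "z = replicate \<eta> False"
  define D0 where "D0 = {(g, \<rho>). (g, prepend z \<rho>) \<in> D}"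
  have "prepend z \<in> measurable ?T ?T"
  proof (rule measurable_into_random_tape)
    fix j show "(\<lambda>\<omega>. prepend z \<omega> j) \<in> measurable ?T (count_space UNIV)"
      unfolding prepend_def by (cases "j < length z") simp_all
  qed
  then have "(\<lambda>\<omega>. (fst \<omega>, prepend z (snd \<omega>))) \<in> measurable (?F \<Otimes>\<^sub>M ?T) (?F \<Otimes>\<^sub>M ?T)"
    by measurable
  from measurable_sets[OF this D(1)] have D0: "D0 \<in> sets (?F \<Otimes>\<^sub>M ?T)"
    by (simp add: D0_def vimage_def space_pair_measure case_prod_beta')
  have A: "measure_preserving ?W (?F \<Otimes>\<^sub>M ?T) (\<lambda>(g, w, \<rho>). (g, prepend w \<rho>))"
    using measure_preserving_pair[OF measure_preserving_id[of ?F] measure_preserving_prepend[of \<eta>] prob(3)]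
    by (simp add: case_prod_beta')
  have B: "measure_preserving ?W (?F \<Otimes>\<^sub>M ?T) (\<lambda>(g, w, \<rho>). (g(x := w), \<rho>))"
    using measure_preserving_comp[OF measure_preserving_assoc[OF prob]
        measure_preserving_pair[OF measure_preserving_resample[of \<eta> x] measure_preserving_id[of ?T] prob(3)]]
    by (simp add: case_prod_beta')
  have C: "measure_preserving ?W (?F \<Otimes>\<^sub>M ?T) (\<lambda>(g, w, \<rho>). (g, \<rho>))"
    using measure_preserving_pair[OF measure_preserving_id[of ?F] measure_preserving_snd[OF prob(2,3)] prob(3)]
    by (simp add: case_prod_beta')
  have AE_g: "AE \<omega> in ?W. \<forall>y. length (fst \<omega> y) = \<eta>"
    by (rule measure_preserving_AE[OF measure_preserving_fst[OF prob(1) probBT] AE_random_fun])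
  have AE_w: "AE \<omega> in ?W. length (fst (snd \<omega>)) = \<eta>"
    by (rule measure_preserving_AE[OF measure_preserving_comp[OF measure_preserving_snd[OF prob(1) probBT]
          measure_preserving_fst[OF prob(2,3)]] AE_random_bits])
  note sets_vimage = measurable_sets[OF measure_preserving_measurable]
  have len: "length z = \<eta>" by (simp add: z_def)
  have "emeasure (?F \<Otimes>\<^sub>M ?T) D = emeasure ?W ((\<lambda>(g, w, \<rho>). (g, prepend w \<rho>)) -` D \<inter> space ?W)"
    by (rule measure_preserving_emeasure[OF A D(1), symmetric])
  also have "\<dots> = emeasure ?W ((\<lambda>(g, w, \<rho>). (g, \<rho>)) -` D0 \<inter> space ?W)"
  proof (rule emeasure_eq_AE)
    show "AE \<omega> in ?W. (\<omega> \<in> (\<lambda>(g, w, \<rho>). (g, prepend w \<rho>)) -` D \<inter> space ?W) =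
        (\<omega> \<in> (\<lambda>(g, w, \<rho>). (g, \<rho>)) -` D0 \<inter> space ?W)"
      using AE_w by eventually_elim (auto simp: D0_def indep[OF _ len])
  qed (rule sets_vimage[OF A D(1)] sets_vimage[OF C D0])+
  also have "\<dots> = emeasure (?F \<Otimes>\<^sub>M ?T) D0"
    by (rule measure_preserving_emeasure[OF C D0])
  also have "\<dots> = emeasure ?W ((\<lambda>(g, w, \<rho>). (g(x := w), \<rho>)) -` D0 \<inter> space ?W)"
    by (rule measure_preserving_emeasure[OF B D0, symmetric])
  also have "\<dots> = emeasure ?W ((\<lambda>(g, w, \<rho>). (g, prepend w \<rho>)) -` D' \<inter> space ?W)"
  proof (rule emeasure_eq_AE)
    show "AE \<omega> in ?W. (\<omega> \<in> (\<lambda>(g, w, \<rho>). (g(x := w), \<rho>)) -` D0 \<inter> space ?W) =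
        (\<omega> \<in> (\<lambda>(g, w, \<rho>). (g, prepend w \<rho>)) -` D' \<inter> space ?W)"
      using AE_w AE_g
    proof eventually_elim
      case (elim \<omega>)
      obtain g w \<rho> where \<omega>: "\<omega> = (g, w, \<rho>)" by (cases \<omega>) auto
      from elim have "length w = \<eta>" "\<forall>y. length (g y) = \<eta>" by (simp_all add: \<omega>)
      with swap[of g w \<rho>] indep[OF this(1) len] show ?case by (simp add: \<omega> D0_def)
    qed
  qed (rule sets_vimage[OF A D(2)] sets_vimage[OF B D0])+
  also have "\<dots> = emeasure (?F \<Otimes>\<^sub>M ?T) D'"
    by (rule measure_preserving_emeasure[OF A D(2)])
  finally show ?thesis .
qed

text \<open>Only for \<eta>-bit answers is \<open>F\<close> known to be computed by the program. On
  that event, a countable intersection, having the value \<open>x\<close> means halting with output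
  \<open>x\<close>.\<close>

lemma sets_oracle_ptime:
  assumes "oracle_ptime F"
  shows "{\<omega>. (\<forall>y. length (fst \<omega> y) = \<eta>) \<and> F \<eta> (fst \<omega>) (snd \<omega>) = x} \<in> sets (random_fun \<eta> \<Otimes>\<^sub>M random_tape)"
proof -
  from assms obtain p where p: "\<And>orc \<rho>. \<forall>x. length (orc x) = \<eta> \<Longrightarrow> \<exists>m. runs orc \<rho> p \<eta> [] m (F \<eta> orc \<rho>)"
    unfolding oracle_ptime_def by blast
  have V: "{\<omega> \<in> space (random_fun \<eta> \<Otimes>\<^sub>M random_tape). \<forall>y. length (fst \<omega> y) = \<eta>} \<in>
      sets (random_fun \<eta> \<Otimes>\<^sub>M random_tape)"
    by measurable
  have "{\<omega>. (\<forall>y. length (fst \<omega> y) = \<eta>) \<and> F \<eta> (fst \<omega>) (snd \<omega>) = x} =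
    {\<omega> \<in> space (random_fun \<eta> \<Otimes>\<^sub>M random_tape). \<forall>y. length (fst \<omega> y) = \<eta>} \<inter>
    {\<omega>. \<exists>m. runs (fst \<omega>) (snd \<omega>) p \<eta> [] m x}"
    using p runs_deterministic by (fastforce simp: space_pair_measure)
  also have "\<dots> \<in> sets (random_fun \<eta> \<Otimes>\<^sub>M random_tape)"
    by (intro sets.Int V sets_runs)
  finally show ?thesis .
qed

text \<open>\<open>TV\<close> stands for the value of \<open>t\<close> and \<open>Fs\<close> for
  those of the hashed terms. On each event that fixes \<open>TV\<close> without a hit the point of
  change is constant, so that \<open>emeasure_resample\<close> applies; by \<open>local\<close> the
  change alters none of these values and hence does not leave the event.\<close>

lemma ideal_games_equal:
  fixes TV :: "nat \<Rightarrow> (bits \<Rightarrow> bits) \<Rightarrow> tape \<Rightarrow> bits"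
  assumes ptime: "\<forall>F\<in>set (TV # Fs). oracle_ptime F"
    and hit: "\<And>g \<rho>. \<forall>y. length (g y) = \<eta> \<Longrightarrow> \<exists>F\<in>set Fs. F \<eta> g \<rho> = TV \<eta> g \<rho> \<Longrightarrow>
      accepts g \<rho> p \<eta> [] \<longleftrightarrow> accepts g \<rho> p' \<eta> []"
    and indep: "\<And>F g w w' \<rho>. \<forall>y. length (g y) = \<eta> \<Longrightarrow> length w = \<eta> \<Longrightarrow> length w' = \<eta> \<Longrightarrow>
      F \<in> set (TV # Fs) \<Longrightarrow> F \<eta> g (prepend w \<rho>) = F \<eta> g (prepend w' \<rho>)"
    and indep_p: "\<And>g w w' \<rho>. \<forall>y. length (g y) = \<eta> \<Longrightarrow> length w = \<eta> \<Longrightarrow> length w' = \<eta> \<Longrightarrow>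
      accepts g (prepend w \<rho>) p \<eta> [] \<longleftrightarrow> accepts g (prepend w' \<rho>) p \<eta> []"
    and local: "\<And>F g w \<rho>. \<forall>y. length (g y) = \<eta> \<Longrightarrow> length w = \<eta> \<Longrightarrow>
      \<forall>F\<in>set Fs. F \<eta> g \<rho> \<noteq> TV \<eta> g \<rho> \<Longrightarrow> F \<in> set (TV # Fs) \<Longrightarrow> F \<eta> (g(TV \<eta> g \<rho> := w)) \<rho> = F \<eta> g \<rho>"
    and swap: "\<And>g w \<rho>. \<forall>y. length (g y) = \<eta> \<Longrightarrow> length w = \<eta> \<Longrightarrow>
      \<forall>F\<in>set Fs. F \<eta> g (prepend w \<rho>) \<noteq> TV \<eta> g (prepend w \<rho>) \<Longrightarrow>
      accepts g (prepend w \<rho>) p' \<eta> [] \<longleftrightarrow>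
      accepts (g(TV \<eta> g (prepend w \<rho>) := w)) (prepend w \<rho>) p \<eta> []"
  shows "\<P>(\<omega> in random_fun \<eta> \<Otimes>\<^sub>M random_tape. accepts (fst \<omega>) (snd \<omega>) p \<eta> []) =
    \<P>(\<omega> in random_fun \<eta> \<Otimes>\<^sub>M random_tape. accepts (fst \<omega>) (snd \<omega>) p' \<eta> [])"
proof -
  let ?M = "random_fun \<eta> \<Otimes>\<^sub>M random_tape"
  define A where "A q = {\<omega>. accepts (fst \<omega>) (snd \<omega>) q \<eta> []}" for q
  define V where "V F x = {\<omega>. (\<forall>y. length (fst \<omega> y) = \<eta>) \<and> F \<eta> (fst \<omega>) (snd \<omega>) = x}"
    for F :: "nat \<Rightarrow> (bits \<Rightarrow> bits) \<Rightarrow> tape \<Rightarrow> bits" and x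
  \<comment> \<open>\<open>None\<close> collects the outcomes with a hit, \<open>Some x\<close>
    those without a hit where \<open>t\<close> has the value \<open>x\<close>.\<close>
  define C where "C q i = (case i of None \<Rightarrow> (\<Union>x. \<Union>F\<in>set Fs. V F x \<inter> V TV x) \<inter> A q
    | Some x \<Rightarrow> (V TV x - (\<Union>F\<in>set Fs. V F x)) \<inter> A q)" for q i
  have A: "A q \<in> sets ?M" for q
    unfolding A_def by (rule sets_accepts)
  have V: "V F x \<in> sets ?M" if "F \<in> set (TV # Fs)" for F x
    unfolding V_def using sets_oracle_ptime ptime that by blast
  have "(\<Union>x. \<Union>F\<in>set Fs. V F x \<inter> V TV x) \<in> sets ?M"
    by (intro sets.countable_UN'' countableI_type sets.Int V countable_finite finite_set) simp_all
  moreover have "(\<Union>F\<in>set Fs. V F x) \<in> sets ?M" for x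
    by (intro sets.countable_UN'' V countable_finite finite_set) simp_all
  ultimately have C: "C q i \<in> sets ?M" for q i
    unfolding C_def by (cases i) (simp_all add: sets.Int sets.Diff V A)
  have disj: "disjoint_family_on (C q) UNIV" for q
    unfolding disjoint_family_on_def C_def by (auto simp: V_def split: option.splits)
  have C_Some: "(g, \<rho>) \<in> C q (Some x) \<longleftrightarrow> (\<forall>y. length (g y) = \<eta>) \<and> TV \<eta> g \<rho> = x \<and>
      (\<forall>F\<in>set Fs. F \<eta> g \<rho> \<noteq> x) \<and> accepts g \<rho> q \<eta> []" for g \<rho> q x
    by (auto simp: C_def V_def A_def)
  \<comment> \<open>Outcomes with an oracle answer of a wrong length lie in no \<open>C q i\<close>,
    but they have probability 0.\<close>
  have emeasure_A: "emeasure ?M (A q) = (\<integral>\<^sup>+i. emeasure ?M (C q i) \<partial>count_space UNIV)" for q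
  proof -
    have "AE \<omega> in ?M. \<forall>y. length (fst \<omega> y) = \<eta>"
      by (rule measure_preserving_AE[OF measure_preserving_fst[OF prob_space_random_fun
              prob_space_random_tape] AE_random_fun])
    then have "AE \<omega> in ?M. \<omega> \<in> A q \<longleftrightarrow> \<omega> \<in> (\<Union>i. C q i)"
    proof eventually_elim
      case (elim \<omega>)
      show ?case
      proof (cases "\<exists>F\<in>set Fs. F \<eta> (fst \<omega>) (snd \<omega>) = TV \<eta> (fst \<omega>) (snd \<omega>)")
        case True
        then have "\<omega> \<in> A q \<longleftrightarrow> \<omega> \<in> C q None" using elim by (auto simp: C_def V_def)
        moreover have "\<omega> \<notin> C q (Some x)" for x using True by (auto simp: C_def V_def)
        ultimately show ?thesis by (auto simp: UNIV_option_conv)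
      next
        case False
        then have "\<omega> \<in> A q \<longleftrightarrow> \<omega> \<in> C q (Some (TV \<eta> (fst \<omega>) (snd \<omega>)))"
          using elim by (auto simp: C_def V_def)
        moreover have "\<omega> \<in> A q" if "\<omega> \<in> C q i" for i
          using that by (cases i) (auto simp: C_def)
        ultimately show ?thesis by blast
      qed
    qed
    then have "emeasure ?M (A q) = emeasure ?M (\<Union>i. C q i)"
      by (rule emeasure_eq_AE) (auto intro!: A sets.countable_UN'' C)
    also have "\<dots> = (\<integral>\<^sup>+i. emeasure ?M (C q i) \<partial>count_space UNIV)"
      by (rule emeasure_UN_countable[OF C _ disj]) simp
    finally show ?thesis .
  qed
  have "emeasure ?M (C p i) = emeasure ?M (C p' i)" for i
  proof (cases i)
    case None
    have "C p None = C p' None"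
      using hit by (auto simp: C_def V_def A_def)
    with None show ?thesis by simp
  next
    case (Some x)
    have "emeasure ?M (C p (Some x)) = emeasure ?M (C p' (Some x))"
    proof (rule emeasure_resample[where x = x, OF C C])
      fix g :: "bits \<Rightarrow> bits" and w w' :: bits and \<rho> assume w: "length w = \<eta>" "length w' = \<eta>"
      show "(g, prepend w \<rho>) \<in> C p (Some x) \<longleftrightarrow> (g, prepend w' \<rho>) \<in> C p (Some x)"
      proof (cases "\<forall>y. length (g y) = \<eta>")
        case True
        have same: "F \<eta> g (prepend w \<rho>) = F \<eta> g (prepend w' \<rho>)" if "F \<in> set (TV # Fs)" for F
          using indep[OF True w that] .
        have "TV \<eta> g (prepend w \<rho>) = TV \<eta> g (prepend w' \<rho>)" by (rule same) simp
        moreover have "(\<forall>F\<in>set Fs. F \<eta> g (prepend w \<rho>) \<noteq> x) \<longleftrightarrow> (\<forall>F\<in>set Fs. F \<eta> g (prepend w' \<rho>) \<noteq> x)"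
          by (rule ball_cong) (simp_all add: same)
        ultimately show ?thesis
          unfolding C_Some using indep_p[OF True w, of \<rho>] by simp
      next
        case False
        then show ?thesis unfolding C_Some by blast
      qed
    next
      fix g :: "bits \<Rightarrow> bits" and w :: bits and \<rho> assume g: "\<forall>y. length (g y) = \<eta>" and w: "length w = \<eta>"
      let ?g = "g(x := w)" and ?\<rho> = "prepend w \<rho>"
      have g': "\<forall>y. length (?g y) = \<eta>" using g w by simp
      show "(g, ?\<rho>) \<in> C p' (Some x) \<longleftrightarrow> (?g, ?\<rho>) \<in> C p (Some x)"
      proof
        assume "(g, ?\<rho>) \<in> C p' (Some x)"
        then have TV: "TV \<eta> g ?\<rho> = x" and no: "\<forall>F\<in>set Fs. F \<eta> g ?\<rho> \<noteq> TV \<eta> g ?\<rho>"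
          and acc: "accepts g ?\<rho> p' \<eta> []"
          unfolding C_Some by auto
        have same: "F \<eta> ?g ?\<rho> = F \<eta> g ?\<rho>" if "F \<in> set (TV # Fs)" for F
          using local[OF g w no that] TV by simp
        have "TV \<eta> ?g ?\<rho> = x" using same[of TV] TV by simp
        moreover have "\<forall>F\<in>set Fs. F \<eta> ?g ?\<rho> \<noteq> x"
        proof
          fix F assume "F \<in> set Fs"
          then show "F \<eta> ?g ?\<rho> \<noteq> x" using same[of F] no TV by auto
        qed
        moreover have "accepts ?g ?\<rho> p \<eta> []" using acc swap[OF g w no] TV by simp
        ultimately show "(?g, ?\<rho>) \<in> C p (Some x)"
          unfolding C_Some using g' by blast
      next
        assume "(?g, ?\<rho>) \<in> C p (Some x)"
        then have TV: "TV \<eta> ?g ?\<rho> = x" and no: "\<forall>F\<in>set Fs. F \<eta> ?g ?\<rho> \<noteq> TV \<eta> ?g ?\<rho>"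
          and acc: "accepts ?g ?\<rho> p \<eta> []"
          unfolding C_Some by auto
        \<comment> \<open>In this direction the changed function is changed once more at
          \<open>x\<close>, back to the old answer \<open>g x\<close>.\<close>
        have same: "F \<eta> g ?\<rho> = F \<eta> ?g ?\<rho>" if "F \<in> set (TV # Fs)" for F
          using local[OF g' _ no that, of "g x"] TV g by simp
        have TV': "TV \<eta> g ?\<rho> = x" using same[of TV] TV by simp
        have no': "\<forall>F\<in>set Fs. F \<eta> g ?\<rho> \<noteq> TV \<eta> g ?\<rho>"
        proof
          fix F assume "F \<in> set Fs"
          then show "F \<eta> g ?\<rho> \<noteq> TV \<eta> g ?\<rho>" using same[of F] no TV TV' by auto
        qed
        have "accepts g ?\<rho> p' \<eta> []" using swap[OF g w no'] acc TV' by simp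
        with no' TV' g show "(g, ?\<rho>) \<in> C p' (Some x)"
          unfolding C_Some by simp
      qed
    qed
    with Some show ?thesis by simp
  qed
  then have "emeasure ?M (A p) = emeasure ?M (A p')" by (simp add: emeasure_A)
  then show ?thesis by (simp add: measure_def A_def space_pair_measure)
qed

text \<open>Using both bounds with exponent \<open>c + 1\<close> leaves a factor
  \<open>2 / \<eta>\<close>, which is at most 1 as soon as \<eta> is at least 2.\<close>

lemma negligible_diff:
  assumes "negligible f" "negligible g"
  shows "negligible (\<lambda>\<eta>. f \<eta> - g \<eta>)"
  unfolding negligible_def
proof
  fix c
  have "\<forall>\<^sub>F \<eta> in sequentially. \<bar>f \<eta>\<bar> < 1 / real \<eta> ^ Suc c" "\<forall>\<^sub>F \<eta> in sequentially. \<bar>g \<eta>\<bar> < 1 / real \<eta> ^ Suc c"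
    using assms unfolding negligible_def by blast+
  then show "\<forall>\<^sub>F \<eta> in sequentially. \<bar>f \<eta> - g \<eta>\<bar> < 1 / real \<eta> ^ c"
    using eventually_ge_at_top[of 2]
  proof eventually_elim
    case (elim \<eta>)
    have "\<bar>f \<eta> - g \<eta>\<bar> < 2 * (1 / real \<eta> ^ Suc c)" using elim by linarith
    also have "\<dots> = (2 / real \<eta>) * (1 / real \<eta> ^ c)" by (simp add: field_simps)
    also have "\<dots> \<le> 1 * (1 / real \<eta> ^ c)"
      using elim by (intro mult_right_mono) auto
    finally show ?case by simp
  qed
qed

section \<open>Real games\<close>

text \<open>Supplies sorts for the hash arguments inside \<open>us\<close> and \<open>t\<close>, as
  needed to evaluate them in polynomial time.\<close>

lemma has_sort_subterm:
  "has_sort S u s \<Longrightarrow> u' \<in> subterms u \<Longrightarrow> \<exists>s'. has_sort S u' s'"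
proof (induction arbitrary: u' rule: has_sort.induct)
  case (9 xs f)
  have "has_sort S (Fun f xs) (snd (fsym_sort S f))"
    by (rule has_sort.intros) (use 9(1) in \<open>auto elim: list_all2_mono\<close>)
  moreover have "\<exists>s'. has_sort S u' s'" if "x \<in> set xs" "u' \<in> subterms x" for x
    using 9(1) that by (auto simp: list_all2_conv_all_nth in_set_conv_nth)
  ultimately show ?case using 9(2) by auto
next
  case (10 xs g)
  have "has_sort S (Att g xs) Term_Sort"
    by (rule has_sort.intros) (use 10 in auto)
  then show ?case using 10 by auto
qed (auto intro: has_sort.intros)

text \<open>The subsort rule keeps the term and changes the sort, so the induction runs over all
  sorts of one term.\<close>

lemma has_sort_H_arg: "has_sort S u s \<Longrightarrow> u = H x y \<Longrightarrow> has_sort S x Term_Sort \<and> has_sort S y Nonce_Sort"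
  by (induction rule: has_sort.induct) auto

lemma subterms_trans: "u \<in> subterms v \<Longrightarrow> subterms u \<subseteq> subterms v"
  by (induction v) auto

lemma names_subterm: "u \<in> subterms v \<Longrightarrow> names u \<subseteq> names v"
  by (induction v) auto

text \<open>The exception is the key, which is itself a subterm of
  \<open>H x (Name k)\<close>.\<close>

lemma only_hash_key_subterm:
  "only_hash_key k v \<Longrightarrow> u \<in> subterms v \<Longrightarrow> u = Name k \<or> only_hash_key k u"
proof (induction v)
  case (H x y)
  then show ?case by auto
qed auto

lemma has_sort_ite_disj:
  assumes "\<forall>b\<in>set bs. has_sort S b Bool_Sort" "has_sort S x s" "has_sort S y s"
  shows "has_sort S (ite_disj bs x y) s"
  using assms(1)
proof (induction bs rule: induct_list012)
  case 1
  show ?case using assms by (auto intro: has_sort.intros)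
next
  case (2 b)
  then show ?case using assms by (auto intro: has_sort.intros)
next
  case (3 b b' bs)
  then show ?case using assms by (auto intro: has_sort.intros(7))
qed

text \<open>The block of \<open>\<kappa>\<close> becomes the oracle key, that of
  \<open>\<nu>\<close> slot \<open>0\<close>, and those of \<open>as\<close> the slots after it.
  Both \<open>\<kappa>\<close> and \<open>\<nu>\<close> are parameters because the two games choose
  them differently; \<open>G\<close> yields the messages.\<close>

lemma accept_prob_eq_oracle_game:
  fixes M :: "('f, 'g) model"
  assumes M: "computational_model S M"
    and N: "N = Suc (length as)"
    and names: "distinct (\<kappa> # \<nu> # as)"
    and P: "\<And>\<eta> orc \<rho>. \<forall>x. length (orc x) = \<eta> \<Longrightarrow>
      accepts orc \<rho> P \<eta> [] \<longleftrightarrow> accepts no_oracle (shift (N * \<eta>) \<rho>) p \<eta> (G \<eta> orc \<rho>)"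
    and G: "\<And>\<eta> \<rho>1 \<rho>2 \<rho>. slot 0 \<eta> \<rho> = interp M \<eta> \<rho>1 \<rho>2 (Name \<nu>) \<Longrightarrow>
      (\<And>i. i < length as \<Longrightarrow> slot (Suc i) \<eta> \<rho> = interp M \<eta> \<rho>1 \<rho>2 (Name (as ! i))) \<Longrightarrow>
      shift (N * \<eta>) \<rho> = \<rho>2 \<Longrightarrow>
      map (interp M \<eta> \<rho>1 \<rho>2) vs = G \<eta> (\<lambda>x. hash M \<eta> x (interp M \<eta> \<rho>1 \<rho>2 (Name \<kappa>))) \<rho>"
  shows "accept_prob M p vs \<eta> =
    \<P>(\<omega> in random_bits \<eta> \<Otimes>\<^sub>M random_tape. accepts (\<lambda>x. hash M \<eta> x (fst \<omega>)) (snd \<omega>) P \<eta> [])"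
proof -
  have blocks: "\<And>a b. a \<noteq> b \<Longrightarrow>
      {name_pos M \<eta> a ..< name_pos M \<eta> a + \<eta>} \<inter> {name_pos M \<eta> b ..< name_pos M \<eta> b + \<eta>} = {}"
    and hash: "\<And>x k. length k = \<eta> \<Longrightarrow> length (hash M \<eta> x k) = \<eta>"
    using M unfolding computational_model_def by blast+
  let ?b = "\<lambda>i. name_pos M \<eta> ((\<kappa> # \<nu> # as) ! i)"
  have "{?b i ..< ?b i + \<eta>} \<inter> {?b j ..< ?b j + \<eta>} = {}" if "i \<le> N" "j \<le> N" "i \<noteq> j" for i j
    by (rule blocks) (use that nth_eq_iff_index_eq[OF names, of i j] N in simp)
  from measure_preserving_blocks[of N ?b \<eta>, OF this] obtain T where
    T: "measure_preserving (random_tape \<Otimes>\<^sub>M random_tape) (random_bits \<eta> \<Otimes>\<^sub>M random_tape)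
      (\<lambda>(\<rho>1, \<rho>2). (map (\<lambda>j. \<rho>1 (?b 0 + j)) [0..<\<eta>], T \<rho>1 \<rho>2))"
    and slot: "\<And>i \<rho>1 \<rho>2. i < N \<Longrightarrow> slot i \<eta> (T \<rho>1 \<rho>2) = map (\<lambda>j. \<rho>1 (?b (Suc i) + j)) [0..<\<eta>]"
    and shift: "\<And>\<rho>1 \<rho>2. shift (N * \<eta>) (T \<rho>1 \<rho>2) = \<rho>2"
    by blast
  let ?Q = "\<lambda>\<omega>. accepts (\<lambda>x. hash M \<eta> x (fst \<omega>)) (snd \<omega>) P \<eta> []"
  have "accepts no_oracle \<rho>2 p \<eta> (map (interp M \<eta> \<rho>1 \<rho>2) vs) \<longleftrightarrow>
      ?Q (map (\<lambda>j. \<rho>1 (?b 0 + j)) [0..<\<eta>], T \<rho>1 \<rho>2)" for \<rho>1 \<rho>2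
  proof -
    have "map (interp M \<eta> \<rho>1 \<rho>2) vs =
        G \<eta> (\<lambda>x. hash M \<eta> x (interp M \<eta> \<rho>1 \<rho>2 (Name \<kappa>))) (T \<rho>1 \<rho>2)"
      by (rule G) (use slot shift N in auto)
    then show ?thesis using P[of "\<lambda>x. hash M \<eta> x (interp M \<eta> \<rho>1 \<rho>2 (Name \<kappa>))" \<eta> "T \<rho>1 \<rho>2"] hash shift
      by simp
  qed
  then have "accept_prob M p vs \<eta> = \<P>(\<omega> in random_tape \<Otimes>\<^sub>M random_tape.
      ?Q ((\<lambda>(\<rho>1, \<rho>2). (map (\<lambda>j. \<rho>1 (?b 0 + j)) [0..<\<eta>], T \<rho>1 \<rho>2)) \<omega>))"
    by (simp add: accept_prob_def case_prod_beta')
  also have "\<dots> = \<P>(\<omega> in random_bits \<eta> \<Otimes>\<^sub>M random_tape. ?Q \<omega>)"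
    by (rule measure_preserving_prob[OF T])
      (use sets_accepts_hash[of "hash M \<eta>" P \<eta> "[]" \<eta>] in \<open>simp add: space_pair_measure\<close>)
  finally show ?thesis .
qed

theorem proposition3:
  fixes S :: "('f, 'g) signature" and M :: "('f, 'g) model"
    and us ts c :: "('f, 'g) tm list" and t :: "('f, 'g) tm" and k n :: nat
  assumes "computational_model S M"
    and "prf_family (hash M)"
    and "\<forall>v \<in> set (us @ [t]). ground_term S v"
    and "\<forall>v \<in> set (us @ [t]). only_hash_key k v"
    and "set ts = {s. \<exists>v \<in> set (us @ [t]). H s (Name k) \<in> subterms v}"
    and "c = map (\<lambda>s. EQ s t) ts"
    and "\<forall>v \<in> set (us @ [t] @ c). n \<notin> names v"
  shows "indist M
    (us @ [ite_disj c Zero (H t (Name k))])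
    (us @ [ite_disj c Zero (Name n)])"
proof -
  note M = assms(1)
  \<comment> \<open>All terms that are evaluated: the condition needs the hash arguments on their
    own as well. They may contain further hashes under \<open>k\<close>, whose arguments are again
    in \<open>ts\<close> by \<open>X_queries\<close> below.\<close>
  define X where "X = set (us @ [t]) \<union> set ts"
  define lhs where "lhs = ite_disj c Zero (H t (Name k))"
  define rhs where "rhs = ite_disj c Zero (Name n)"
  have ts: "\<exists>v\<in>set (us @ [t]). H s (Name k) \<in> subterms v" if "s \<in> set ts" for s
    using that assms(5) by simp
  have X_sort: "has_sort S u Term_Sort" if "u \<in> X" for u
  proof (cases "u \<in> set ts")
    case True
    then obtain v where v: "v \<in> set (us @ [t])" "H u (Name k) \<in> subterms v" using ts by blast
    then obtain s' where "has_sort S (H u (Name k)) s'"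
      using assms(3) has_sort_subterm unfolding ground_term_def by blast
    then show ?thesis using has_sort_H_arg by blast
  next
    case False
    then show ?thesis using that assms(3) unfolding X_def ground_term_def by blast
  qed
  have X_hash_key: "only_hash_key k u" if "u \<in> X" for u
  proof (cases "u \<in> set ts")
    case True
    then obtain v where v: "v \<in> set (us @ [t])" "H u (Name k) \<in> subterms v" using ts by blast
    then have "only_hash_key k (H u (Name k))"
      using only_hash_key_subterm[of k v "H u (Name k)"] assms(4) by blast
    then show ?thesis by simp
  next
    case False
    then show ?thesis using that assms(4) unfolding X_def by blast
  qed
  have X_queries: "s \<in> set ts" if "u \<in> X" "H s (Name k) \<in> subterms u" for u s
  proof (cases "u \<in> set ts")
    case True
    then obtain v where v: "v \<in> set (us @ [t])" "H u (Name k) \<in> subterms v" using ts by blast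
    have "subterms u \<subseteq> subterms (H u (Name k))" by auto
    with subterms_trans[OF v(2)] that(2) v(1) show ?thesis using assms(5) by blast
  next
    case False
    then show ?thesis using that assms(5) unfolding X_def by blast
  qed
  have X_names: "names u \<subseteq> (\<Union>v\<in>set (us @ [t]). names v)" if "u \<in> X" for u
  proof (cases "u \<in> set ts")
    case True
    then obtain v where v: "v \<in> set (us @ [t])" "H u (Name k) \<in> subterms v" using ts by blast
    have "names u \<subseteq> names (H u (Name k))" by auto
    with names_subterm[OF v(2)] v(1) show ?thesis by blast
  next
    case False
    then show ?thesis using that unfolding X_def by blast
  qed
  have fin: "finite (names u)" for u :: "('f, 'g) tm"
    by (induction u) auto
  \<comment> \<open>The name \<open>k\<close> gets no slot, since it is present only through the
    oracle.\<close>
  define A where "A = (\<Union>v\<in>set (us @ [t]). names v) - {k}"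
  have "finite A" unfolding A_def using fin by blast
  then obtain as where as: "set as = A" "distinct as" using finite_distinct_list by blast
  have n: "n \<notin> (\<Union>v\<in>set (us @ [t]). names v)" using assms(7) by auto
  then have "n \<notin> A" "k \<notin> A" by (auto simp: A_def)
  \<comment> \<open>A spare name. It fills slot \<open>0\<close> in the left game, which does not
    read that slot, and supplies the key of the right game if \<open>n = k\<close>.\<close>
  obtain z where z: "z \<notin> A \<union> {n, k}"
    using ex_new_if_finite[of "A \<union> {n, k}"] \<open>finite A\<close> by (auto simp: infinite_UNIV_nat)
  \<comment> \<open>One slot more than there are names in \<open>as\<close>: slot \<open>0\<close>
    is kept for \<open>n\<close>, which shifts the others by one in \<open>pos\<close>.\<close>
  define N where "N = Suc (length as)"
  define pos where "pos a = (if a = n then 0 else Suc (the_inv_into {..<length as} ((!) as) a))" for a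
  have inj: "inj_on ((!) as) {..<length as}"
    using as(2) by (simp add: inj_on_nth)
  have pos: "pos (as ! i) = Suc i" if "i < length as" for i
  proof -
    have "as ! i \<in> A" using that as(1) nth_mem by blast
    then have "as ! i \<noteq> n" using \<open>n \<notin> A\<close> by blast
    then show ?thesis using the_inv_into_f_f[OF inj, of i] that by (simp add: pos_def)
  qed
  have pos_A: "\<exists>i<length as. a = as ! i \<and> pos a = Suc i" if "a \<in> A" for a
    using that as(1) pos by (metis in_set_conv_nth)
  let ?O = "\<lambda>u \<eta> orc \<rho>. ointerp M k \<eta> (\<lambda>a. slot (pos a) \<eta> \<rho>) orc (shift (N * \<eta>) \<rho>) u"
  have O_lhs: "?O lhs \<eta> orc \<rho> = (if \<exists>s\<in>set ts. ?O s \<eta> orc \<rho> = ?O t \<eta> orc \<rho>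
      then replicate \<eta> False else orc (?O t \<eta> orc \<rho>))" for \<eta> orc \<rho>
    unfolding lhs_def assms(6) ointerp_ite_disj by simp
  have O_rhs: "?O rhs \<eta> orc \<rho> = (if \<exists>s\<in>set ts. ?O s \<eta> orc \<rho> = ?O t \<eta> orc \<rho>
      then replicate \<eta> False else slot 0 \<eta> \<rho>)" for \<eta> orc \<rho>
    unfolding rhs_def assms(6) ointerp_ite_disj by (simp add: pos_def)
  have X_mem: "t \<in> X" "u \<in> set us \<Longrightarrow> u \<in> X" "u \<in> set ts \<Longrightarrow> u \<in> X" for u
    by (simp_all add: X_def)
  have bool: "\<forall>b\<in>set c. has_sort S b Bool_Sort"
    unfolding assms(6) using X_sort X_mem by (auto intro: has_sort.intros)
  have lhs: "has_sort S lhs Nonce_Sort" and rhs: "has_sort S rhs Nonce_Sort"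
    unfolding lhs_def rhs_def using bool X_sort[OF X_mem(1)]
    by (auto intro!: has_sort_ite_disj has_sort.intros(1,4,8))
  have ptime_X: "oracle_ptime (?O u)" if "u \<in> X" for u
    using oracle_ptime_ointerp[OF M X_sort[OF that]] by blast
  have ptime_lhs: "oracle_ptime (?O lhs)" and ptime_rhs: "oracle_ptime (?O rhs)"
    using oracle_ptime_ointerp[OF M lhs] oracle_ptime_ointerp[OF M rhs] by blast+
  \<comment> \<open>The string prepended is slot \<open>0\<close>, the place of \<open>n\<close>,
    and \<open>n\<close> does not occur in the terms of \<open>X\<close>.\<close>
  have prepend: "?O u \<eta> orc (prepend w \<rho>) = ?O u \<eta> orc (prepend w' \<rho>)"
    if "u \<in> X" "length w = \<eta>" "length w' = \<eta>" for u \<eta> orc w w' \<rho>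
  proof -
    have shift: "shift (N * \<eta>) (prepend w \<rho>) = shift (N * \<eta>) (prepend w' \<rho>)"
      using that(2,3) by (simp only: N_def shift_prepend)
    have "slot (pos a) \<eta> (prepend w \<rho>) = slot (pos a) \<eta> (prepend w' \<rho>)"
      if "a \<in> names u" "a \<noteq> k" for a
    proof -
      have "a \<in> A" using that X_names[OF \<open>u \<in> X\<close>] by (auto simp: A_def)
      from pos_A[OF this] show ?thesis
        using \<open>length w = \<eta>\<close> \<open>length w' = \<eta>\<close> by (auto simp: slot_Suc_prepend)
    qed
    from ointerp_cong[OF X_hash_key[OF \<open>u \<in> X\<close>] this refl] show ?thesis
      unfolding shift .
  qed
  \<comment> \<open>Every query made in \<open>u\<close> is at the value of a term in
    \<open>ts\<close>, nested hashes included, so a new answer at \<open>x\<close> goes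
    unnoticed.\<close>
  have resample: "?O u \<eta> (g(x := w)) \<rho> = ?O u \<eta> g \<rho>"
    if "u \<in> X" "\<forall>s\<in>set ts. ?O s \<eta> g \<rho> \<noteq> x" for u \<eta> g x w \<rho>
    by (rule ointerp_cong[OF X_hash_key[OF that(1)], symmetric])
      (use X_queries[OF that(1)] that(2) in auto)
  \<comment> \<open>The second alternative for \<open>\<kappa>\<close> covers \<open>n = k\<close>:
    the oracle is keyed by another name, but no term in \<open>X\<close> queries it.\<close>
  have interp_X: "interp M \<eta> \<rho>1 \<rho>2 u = ?O u \<eta> (\<lambda>x. hash M \<eta> x (interp M \<eta> \<rho>1 \<rho>2 (Name \<kappa>))) \<rho>"
    if "u \<in> X" "\<And>i. i < length as \<Longrightarrow> slot (Suc i) \<eta> \<rho> = interp M \<eta> \<rho>1 \<rho>2 (Name (as ! i))"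
      "shift (N * \<eta>) \<rho> = \<rho>2" "\<kappa> = k \<or> k \<notin> (\<Union>v\<in>set (us @ [t]). names v)"
    for u \<eta> \<rho>1 \<rho>2 \<rho> \<kappa>
  proof -
    let ?orc = "\<lambda>x. hash M \<eta> x (interp M \<eta> \<rho>1 \<rho>2 (Name \<kappa>))"
    have "H s (Name k) \<notin> subterms u" if "k \<notin> (\<Union>v\<in>set (us @ [t]). names v)" for s
      using names_subterm[of "H s (Name k)" u] X_names[OF \<open>u \<in> X\<close>] that by auto
    then have "?orc = (\<lambda>x. hash M \<eta> x (interp M \<eta> \<rho>1 \<rho>2 (Name k))) \<or> (\<forall>s. H s (Name k) \<notin> subterms u)"
      using that(4) by blast
    from interp_eq_ointerp[OF this]
    have "interp M \<eta> \<rho>1 \<rho>2 u = ointerp M k \<eta> (\<lambda>a. interp M \<eta> \<rho>1 \<rho>2 (Name a)) ?orc \<rho>2 u" .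
    also have "\<dots> = ointerp M k \<eta> (\<lambda>a. slot (pos a) \<eta> \<rho>) ?orc \<rho>2 u"
    proof (rule ointerp_cong[OF X_hash_key[OF that(1)]])
      fix a assume "a \<in> names u" "a \<noteq> k"
      then have "a \<in> A" using X_names[OF \<open>u \<in> X\<close>] by (auto simp: A_def)
      from pos_A[OF this] show "interp M \<eta> \<rho>1 \<rho>2 (Name a) = slot (pos a) \<eta> \<rho>"
        using that(2) by auto
    qed simp
    finally show ?thesis using that(3) by simp
  qed
  have "negligible (\<lambda>\<eta>. accept_prob M p (us @ [lhs]) \<eta> - accept_prob M p (us @ [rhs]) \<eta>)"
    if p: "ptime_adversary (length (us @ [lhs])) p" for p
  proof -
    let ?L = "map ?O (us @ [lhs])" and ?R = "map ?O (us @ [rhs])"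
    have "\<forall>F\<in>set ?L. oracle_ptime F" "\<forall>F\<in>set ?R. oracle_ptime F"
      using ptime_X X_mem ptime_lhs ptime_rhs by auto
    from ptime_oracle_adversary_compose[OF _ this(1), of p N] ptime_oracle_adversary_compose[OF _ this(2), of p N] p
    obtain P P' where P: "ptime_oracle_adversary P" "\<And>\<eta> orc \<rho>. \<forall>x. length (orc x) = \<eta> \<Longrightarrow>
        accepts orc \<rho> P \<eta> [] \<longleftrightarrow>
        accepts no_oracle (shift (N * \<eta>) \<rho>) p \<eta> (map (\<lambda>F. F \<eta> orc \<rho>) ?L)"
      and P': "ptime_oracle_adversary P'" "\<And>\<eta> orc \<rho>. \<forall>x. length (orc x) = \<eta> \<Longrightarrow>
        accepts orc \<rho> P' \<eta> [] \<longleftrightarrow>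
        accepts no_oracle (shift (N * \<eta>) \<rho>) p \<eta> (map (\<lambda>F. F \<eta> orc \<rho>) ?R)"
      by auto
    define K where "K q \<eta> = \<P>(\<omega> in random_bits \<eta> \<Otimes>\<^sub>M random_tape.
        accepts (\<lambda>x. hash M \<eta> x (fst \<omega>)) (snd \<omega>) q \<eta> [])" for q \<eta>
    define I where "I q \<eta> = \<P>(\<omega> in random_fun \<eta> \<Otimes>\<^sub>M random_tape. accepts (fst \<omega>) (snd \<omega>) q \<eta> [])" for q \<eta>
    have L: "accept_prob M p (us @ [lhs]) \<eta> = K P \<eta>" for \<eta>
      unfolding K_def
    proof (rule accept_prob_eq_oracle_game[where \<kappa> = k and \<nu> = z and as = as
          and G = "\<lambda>\<eta> orc \<rho>. map (\<lambda>F. F \<eta> orc \<rho>) ?L", OF M N_def _ P(2)])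
      show "distinct (k # z # as)" using as z \<open>k \<notin> A\<close> by auto
      fix \<eta> \<rho>1 \<rho>2 \<rho>
      assume slots: "\<And>i. i < length as \<Longrightarrow> slot (Suc i) \<eta> \<rho> = interp M \<eta> \<rho>1 \<rho>2 (Name (as ! i))"
        "shift (N * \<eta>) \<rho> = \<rho>2"
      define orc where "orc = (\<lambda>x. hash M \<eta> x (interp M \<eta> \<rho>1 \<rho>2 (Name k)))"
      have eq: "interp M \<eta> \<rho>1 \<rho>2 u = ?O u \<eta> orc \<rho>" if "u \<in> X" for u
        unfolding orc_def by (rule interp_X[OF that slots]) simp_all
      have "(\<exists>s\<in>set ts. interp M \<eta> \<rho>1 \<rho>2 s = interp M \<eta> \<rho>1 \<rho>2 t) \<longleftrightarrow>
          (\<exists>s\<in>set ts. ?O s \<eta> orc \<rho> = ?O t \<eta> orc \<rho>)"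
        by (rule bex_cong) (simp_all add: eq X_mem)
      moreover have "interp M \<eta> \<rho>1 \<rho>2 (H t (Name k)) = orc (?O t \<eta> orc \<rho>)"
        using eq[OF X_mem(1)] by (simp add: orc_def)
      ultimately have "interp M \<eta> \<rho>1 \<rho>2 lhs = ?O lhs \<eta> orc \<rho>"
        unfolding O_lhs unfolding lhs_def assms(6) interp_ite_disj by (simp only: interp.simps)
      moreover have "map (interp M \<eta> \<rho>1 \<rho>2) us = map (\<lambda>u. ?O u \<eta> orc \<rho>) us"
        using eq X_mem by simp
      ultimately show "map (interp M \<eta> \<rho>1 \<rho>2) (us @ [lhs]) =
          map (\<lambda>F. F \<eta> (\<lambda>x. hash M \<eta> x (interp M \<eta> \<rho>1 \<rho>2 (Name k))) \<rho>) ?L"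
        unfolding orc_def[symmetric] by (simp add: o_def)
    qed
    \<comment> \<open>If \<open>n = k\<close>, the block of \<open>k\<close> is the fresh nonce of
      the right game and cannot also be its key; the key is then taken from
      \<open>z\<close>.\<close>
    define \<kappa> where "\<kappa> = (if n = k then z else k)"
    have \<kappa>: "\<kappa> = k \<or> k \<notin> (\<Union>v\<in>set (us @ [t]). names v)"
      using n by (auto simp: \<kappa>_def)
    have R: "accept_prob M p (us @ [rhs]) \<eta> = K P' \<eta>" for \<eta>
      unfolding K_def
    proof (rule accept_prob_eq_oracle_game[where \<kappa> = \<kappa> and \<nu> = n and as = as
          and G = "\<lambda>\<eta> orc \<rho>. map (\<lambda>F. F \<eta> orc \<rho>) ?R", OF M N_def _ P'(2)])
      show "distinct (\<kappa> # n # as)" using as z \<open>k \<notin> A\<close> \<open>n \<notin> A\<close> by (auto simp: \<kappa>_def)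
      fix \<eta> \<rho>1 \<rho>2 \<rho>
      assume slot_0: "slot 0 \<eta> \<rho> = interp M \<eta> \<rho>1 \<rho>2 (Name n)"
        and slots: "\<And>i. i < length as \<Longrightarrow> slot (Suc i) \<eta> \<rho> = interp M \<eta> \<rho>1 \<rho>2 (Name (as ! i))"
        "shift (N * \<eta>) \<rho> = \<rho>2"
      define orc where "orc = (\<lambda>x. hash M \<eta> x (interp M \<eta> \<rho>1 \<rho>2 (Name \<kappa>)))"
      have eq: "interp M \<eta> \<rho>1 \<rho>2 u = ?O u \<eta> orc \<rho>" if "u \<in> X" for u
        unfolding orc_def by (rule interp_X[OF that slots]) (use \<kappa> in simp_all)
      have "(\<exists>s\<in>set ts. interp M \<eta> \<rho>1 \<rho>2 s = interp M \<eta> \<rho>1 \<rho>2 t) \<longleftrightarrow>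
          (\<exists>s\<in>set ts. ?O s \<eta> orc \<rho> = ?O t \<eta> orc \<rho>)"
        by (rule bex_cong) (simp_all add: eq X_mem)
      then have "interp M \<eta> \<rho>1 \<rho>2 rhs = ?O rhs \<eta> orc \<rho>"
        unfolding O_rhs slot_0 unfolding rhs_def assms(6) interp_ite_disj by (simp only: interp.simps)
      moreover have "map (interp M \<eta> \<rho>1 \<rho>2) us = map (\<lambda>u. ?O u \<eta> orc \<rho>) us"
        using eq X_mem by simp
      ultimately show "map (interp M \<eta> \<rho>1 \<rho>2) (us @ [rhs]) =
          map (\<lambda>F. F \<eta> (\<lambda>x. hash M \<eta> x (interp M \<eta> \<rho>1 \<rho>2 (Name \<kappa>))) \<rho>) ?R"
        unfolding orc_def[symmetric] by (simp add: o_def)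
    qed
    have I: "I P \<eta> = I P' \<eta>" for \<eta>
      unfolding I_def
    proof (rule ideal_games_equal[where TV = "?O t" and Fs = "map ?O ts"])
      show "\<forall>F\<in>set (?O t # map ?O ts). oracle_ptime F" using ptime_X X_mem by auto
    next
      fix g :: "bits \<Rightarrow> bits" and \<rho> assume g: "\<forall>y. length (g y) = \<eta>"
        and "\<exists>F\<in>set (map ?O ts). F \<eta> g \<rho> = ?O t \<eta> g \<rho>"
      then show "accepts g \<rho> P \<eta> [] \<longleftrightarrow> accepts g \<rho> P' \<eta> []"
        unfolding P(2)[OF g] P'(2)[OF g] by (simp add: O_lhs O_rhs)
    next
      fix F and g :: "bits \<Rightarrow> bits" and w w' :: bits and \<rho>
      assume w: "length w = \<eta>" "length w' = \<eta>" and "F \<in> set (?O t # map ?O ts)"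
      then obtain u where "u \<in> X" "F = ?O u" using X_mem by auto
      then show "F \<eta> g (prepend w \<rho>) = F \<eta> g (prepend w' \<rho>)" using prepend[OF _ w] by simp
    next
      fix g :: "bits \<Rightarrow> bits" and w w' :: bits and \<rho>
      assume g: "\<forall>y. length (g y) = \<eta>" and w: "length w = \<eta>" "length w' = \<eta>"
      have eq: "?O u \<eta> g (prepend w \<rho>) = ?O u \<eta> g (prepend w' \<rho>)" if "u \<in> X" for u
        by (rule prepend[OF that w])
      have "(\<exists>s\<in>set ts. ?O s \<eta> g (prepend w \<rho>) = ?O t \<eta> g (prepend w \<rho>)) \<longleftrightarrow>
          (\<exists>s\<in>set ts. ?O s \<eta> g (prepend w' \<rho>) = ?O t \<eta> g (prepend w' \<rho>))"
        by (rule bex_cong) (simp_all add: eq X_mem)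
      then have "?O lhs \<eta> g (prepend w \<rho>) = ?O lhs \<eta> g (prepend w' \<rho>)"
        unfolding O_lhs using eq[OF X_mem(1)] by simp
      then have "map (\<lambda>F. F \<eta> g (prepend w \<rho>)) ?L = map (\<lambda>F. F \<eta> g (prepend w' \<rho>)) ?L"
        using eq X_mem by simp
      moreover have "shift (N * \<eta>) (prepend w \<rho>) = shift (N * \<eta>) (prepend w' \<rho>)"
        using w by (simp only: N_def shift_prepend)
      ultimately show "accepts g (prepend w \<rho>) P \<eta> [] \<longleftrightarrow> accepts g (prepend w' \<rho>) P \<eta> []"
        unfolding P(2)[OF g] by (simp only:)
    next
      fix F and g :: "bits \<Rightarrow> bits" and w :: bits and \<rho>
      assume no: "\<forall>F\<in>set (map ?O ts). F \<eta> g \<rho> \<noteq> ?O t \<eta> g \<rho>" and "F \<in> set (?O t # map ?O ts)"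
      then obtain u where "u \<in> X" "F = ?O u" using X_mem by auto
      then show "F \<eta> (g(?O t \<eta> g \<rho> := w)) \<rho> = F \<eta> g \<rho>"
        using no by (simp add: resample)
    next
      fix g :: "bits \<Rightarrow> bits" and w :: bits and \<rho>
      let ?\<rho> = "prepend w \<rho>"
      let ?x = "?O t \<eta> g ?\<rho>"
      let ?g = "g(?x := w)"
      assume g: "\<forall>y. length (g y) = \<eta>" and w: "length w = \<eta>"
        and no: "\<forall>F\<in>set (map ?O ts). F \<eta> g ?\<rho> \<noteq> ?x"
      have g': "\<forall>y. length (?g y) = \<eta>" using g w by simp
      have eq: "?O u \<eta> ?g ?\<rho> = ?O u \<eta> g ?\<rho>" if "u \<in> X" for u
        by (rule resample[OF that]) (use no in simp)
      \<comment> \<open>The condition still fails after the change, so the left game queries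
        \<open>?x\<close> and receives the new answer \<open>w\<close>, the very string that the
        right game reads from slot \<open>0\<close>.\<close>
      have "?O lhs \<eta> ?g ?\<rho> = w"
        unfolding O_lhs using no eq X_mem by simp
      moreover have "?O rhs \<eta> g ?\<rho> = w"
        unfolding O_rhs using no w by (simp add: slot_0_prepend)
      ultimately have "map (\<lambda>F. F \<eta> g ?\<rho>) ?R = map (\<lambda>F. F \<eta> ?g ?\<rho>) ?L"
        using eq X_mem by simp
      then show "accepts g ?\<rho> P' \<eta> [] \<longleftrightarrow> accepts ?g ?\<rho> P \<eta> []"
        unfolding P(2)[OF g'] P'(2)[OF g] by (simp only:)
    qed
    \<comment> \<open>As the ideal probabilities coincide, they cancel when the two negligible
      differences are subtracted, leaving the difference of the real games.\<close>
    have "negligible (\<lambda>\<eta>. K P \<eta> - I P \<eta>)" "negligible (\<lambda>\<eta>. K P' \<eta> - I P' \<eta>)"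
      using assms(2) P(1) P'(1) unfolding prf_family_def K_def I_def by blast+
    from negligible_diff[OF this] show ?thesis by (simp add: L R I)
  qed
  then show ?thesis
    unfolding indist_def lhs_def rhs_def by simp
qed

end
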